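(* If $k$ is a negative integer, then there exist parameters $c>1$ and $p,q,r\ge0$ with $p+q+r=1$, $p+r>0$, $q+r>0$ such that $\mu^{(k)}\in ID$ and $\rho^{(k)}\in ID^0$.
   Context: For $k\in\mathbb{Z}$ and parameters $c,p,q,r$ as in the claim, let $\{(N_t^{(k)},L_t^{(k)}),t\ge0\}$ be the bivariate compound Poisson process (pure jump, no drift) with $E[e^{i(z_1N_t^{(k)}+z_2L_t^{(k)})}]=\exp[t\int_{\mathbb{R}^2}(e^{i(z_1x_1+z_2x_2)}-1)\nu^{(k)}(dx)]$, where $\nu^{(k)}$ is concentrated on the points $(1,0)$, $(0,1)$, $(1,c^{-k})$ with masses $u,v,w\ge0$ respectively, and $p=u/(u+v+w)$, $q=v/(u+v+w)$, $r=w/(u+v+w)$. Let $T$ be the first jump time of $\{N_t^{(k)}\}$. Define $\rho^{(k)}$ as the distribution of $L_T^{(k)}$, and $\mu^{(k)}$ as the distribution of $\int_0^{\infty-}c^{-N^{(k)}_{s-}}\,dL_s^{(k)}$ (the almost sure limit of $\int_0^t$ as $t\to\infty$, which exists). These depend on $u,v,w$ only through $p,q,r$. A distribution $\sigma$ on $\mathbb{R}$ is quasi-infinitely divisible if its characteristic function is $\widehat\sigma(z)=\exp[i\gamma z-az^2+\int_{\mathbb{R}}(e^{izx}-1-izx1_{[-1,1]}(x))\,\nu_\sigma(dx)]$, where $\gamma,a\in\mathbb{R}$ and $\nu_\sigma$ is a signed measure (a difference $\nu_\sigma^+-\nu_\sigma^-$ of mutually singular measures, possibly both of infinite mass near $0$)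 with total variation measure $|\nu_\sigma|$ satisfying $\nu_\sigma(\{0\})=0$ and $\int(x^2\wedge1)\,|\nu_\sigma|(dx)<\infty$. $ID$ is the class of infinitely divisible distributions on $\mathbb{R}$; $ID^0$ is the class of quasi-infinitely divisible distributions that are not infinitely divisible. *)

theory Defs
  imports "HOL-Probability.Probability"
begin

section \<open>Infinitely divisible and quasi-infinitely divisible distributions\<close>

definition conv_power :: "nat \<Rightarrow> real measure \<Rightarrow> real measure" where
  "conv_power n \<tau> = ((\<lambda>\<sigma>. \<tau> \<star> \<sigma>) ^^ n) (return borel 0)"

definition infinitely_divisible :: "real measure \<Rightarrow> bool" where
  "infinitely_divisible \<sigma> \<longleftrightarrow>
     real_distribution \<sigma> \<and>
     (\<forall>n>0. \<exists>\<tau>. real_distribution \<tau> \<and> conv_power n \<tau> = \<sigma>)"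

definition mutually_singular :: "'a measure \<Rightarrow> 'a measure \<Rightarrow> bool" where
  "mutually_singular \<nu>1 \<nu>2 \<longleftrightarrow>
     sets \<nu>1 = sets \<nu>2 \<and>
     (\<exists>A\<in>sets \<nu>1. emeasure \<nu>1 A = 0 \<and> emeasure \<nu>2 (space \<nu>2 - A) = 0)"

definition levy_condition :: "real measure \<Rightarrow> bool" where
  "levy_condition \<nu> \<longleftrightarrow>
     sets \<nu> = sets borel \<and> emeasure \<nu> {0} = 0 \<and>
     (\<integral>\<^sup>+ x. ennreal (min (x\<^sup>2) 1) \<partial>\<nu>) < \<infinity>"

definition levy_kernel :: "real \<Rightarrow> real \<Rightarrow> complex" where
  "levy_kernel z x = iexp (z * x) - 1 - \<i> * of_real (z * x * indicator {-1..1} x)"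

text \<open>The signed measure is given by its Jordan decomposition \<open>(\<nu>p, \<nu>m)\<close>. Its total variation is
  \<open>\<nu>p + \<nu>m\<close>, so the conditions on the total variation hold iff they hold for both parts, and the
  integral against the signed measure is the difference of the two integrals.\<close>

definition quasi_infinitely_divisible :: "real measure \<Rightarrow> bool" where
  "quasi_infinitely_divisible \<sigma> \<longleftrightarrow>
     real_distribution \<sigma> \<and>
     (\<exists>(\<gamma>::real) (a::real) \<nu>p \<nu>m.
        levy_condition \<nu>p \<and> levy_condition \<nu>m \<and> mutually_singular \<nu>p \<nu>m \<and>
        (\<forall>z. char \<sigma> z =
           exp (\<i> * of_real (\<gamma> * z) - of_real (a * z\<^sup>2)
                + ((CLINT x|\<nu>p. levy_kernel z x) - (CLINT x|\<nu>m. levy_kernel z x)))))"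

definition ID :: "real measure set" where
  "ID = {\<sigma>. infinitely_divisible \<sigma>}"

definition ID0 :: "real measure set" where
  "ID0 = {\<sigma>. quasi_infinitely_divisible \<sigma> \<and> \<not> infinitely_divisible \<sigma>}"


section \<open>Compound Poisson processes\<close>

text \<open>The time set is \<open>[0, \<infinity>)\<close>; the values \<open>X t\<close> for \<open>t < 0\<close> are irrelevant.\<close>

definition levy_process ::
    "'a measure \<Rightarrow> (real \<Rightarrow> 'a \<Rightarrow> 'b::euclidean_space) \<Rightarrow> bool" where
  "levy_process M X \<longleftrightarrow>
     prob_space M \<and>
     (\<forall>t\<ge>0. X t \<in> borel_measurable M) \<and>
     (AE \<omega> in M. X 0 \<omega> = 0) \<and>
     (\<forall>n (t::nat \<Rightarrow> real). 0 \<le> t 0 \<and> mono t \<longrightarrow>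
        prob_space.indep_vars M (\<lambda>_. borel) (\<lambda>i \<omega>. X (t (Suc i)) \<omega> - X (t i) \<omega>) {..<n}) \<and>
     (\<forall>s\<ge>0. \<forall>t\<ge>0. distr M borel (\<lambda>\<omega>. X (s + t) \<omega> - X s \<omega>) = distr M borel (X t)) \<and>
     (AE \<omega> in M.
        (\<forall>t\<ge>0. ((\<lambda>s. X s \<omega>) \<longlongrightarrow> X t \<omega>) (at_right t)) \<and>
        (\<forall>t>0. \<exists>l. ((\<lambda>s. X s \<omega>) \<longlongrightarrow> l) (at_left t)))"

definition compound_poisson_process ::
    "'a measure \<Rightarrow> (real \<Rightarrow> 'a \<Rightarrow> 'b::euclidean_space) \<Rightarrow> 'b measure \<Rightarrow> bool" where
  "compound_poisson_process M X \<nu> \<longleftrightarrow>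
     levy_process M X \<and>
     sets \<nu> = sets borel \<and> finite_measure \<nu> \<and> emeasure \<nu> {0} = 0 \<and>
     (\<forall>t\<ge>0. \<forall>z. (CLINT \<omega>|M. iexp (z \<bullet> X t \<omega>)) =
        exp (of_real t * (CLINT x|\<nu>. iexp (z \<bullet> x) - 1)))"

definition jump_measure ::
    "int \<Rightarrow> real \<Rightarrow> real \<Rightarrow> real \<Rightarrow> real \<Rightarrow> (real \<times> real) measure" where
  "jump_measure k c u v w =
     distr (point_measure {(1, 0), (0, 1), (1, c powi (-k))}
             (\<lambda>x. if x = (1, 0) then ennreal u else if x = (0, 1) then ennreal v else ennreal w))
           borel (\<lambda>x. x)"

lemma emeasure_jump_measure:
  assumes "c > 0" "A \<in> sets borel"
  shows "emeasure (jump_measure k c u v w) A =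
           ennreal u * indicator A (1, 0) + ennreal v * indicator A (0, 1)
           + ennreal w * indicator A (1, c powi (-k))"
proof -
  define a where "a = c powi (-k)"
  have a: "a \<noteq> 0"
    using assms(1) by (simp add: a_def power_int_eq_0_iff)
  define S :: "(real \<times> real) set" where "S = {(1, 0), (0, 1), (1, a)}"
  define f where "f = (\<lambda>x::real \<times> real. if x = (1, 0) then ennreal u else if x = (0, 1) then ennreal v else ennreal w)"
  have S: "finite S" by (simp add: S_def)
  have id: "(\<lambda>x. x) \<in> point_measure S f \<rightarrow>\<^sub>M borel"
    by (simp add: measurable_point_measure_eq1)
  have "emeasure (jump_measure k c u v w) A = emeasure (distr (point_measure S f) borel (\<lambda>x. x)) A"
    by (simp only: jump_measure_def S_def f_def a_def)
  also have "\<dots> = emeasure (point_measure S f) (A \<inter> S)"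
    using emeasure_distr[OF id assms(2)] by (simp add: space_point_measure vimage_def)
  also have "\<dots> = (\<Sum>x\<in>A \<inter> S. f x)"
    using S by (intro emeasure_point_measure_finite) auto
  also have "\<dots> = (\<Sum>x\<in>S. f x * indicator A x)"
    using S by (intro sum.mono_neutral_cong_left) (auto simp: indicator_def)
  also have "\<dots> = ennreal u * indicator A (1, 0) + ennreal v * indicator A (0, 1) + ennreal w * indicator A (1, a)"
  proof -
    have "sum g S = g (1, 0) + g (0, 1) + g (1, a)" for g :: "real \<times> real \<Rightarrow> ennreal"
      using a by (simp add: S_def add.assoc)
    then show ?thesis
      using a by (simp add: f_def)
  qed
  finally show ?thesis unfolding a_def .
qed


section \<open>The laws \<open>\<rho>\<close> and \<open>\<mu>\<close>\<close>

definition first_jump_time :: "(real \<Rightarrow> 'a \<Rightarrow> real) \<Rightarrow> 'a \<Rightarrow> real" where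
  "first_jump_time N \<omega> = Inf {t. 0 < t \<and> \<not> isCont (\<lambda>s. N s \<omega>) t}"

text \<open>Pathwise Lebesgue-Stieltjes integral of \<open>c^(-N (s-))\<close> over \<open>(0, t]\<close>. Almost every path of \<open>L\<close>
  is nondecreasing and right-continuous on \<open>[0, \<infinity>)\<close>; it is extended constantly to the
  left of 0 because \<^const>\<open>interval_measure\<close> expects a function on the whole line.\<close>

definition exp_integral ::
    "real \<Rightarrow> (real \<Rightarrow> 'a \<Rightarrow> real) \<Rightarrow> (real \<Rightarrow> 'a \<Rightarrow> real) \<Rightarrow> real \<Rightarrow> 'a \<Rightarrow> real" where
  "exp_integral c N L t \<omega> =
     (LINT s:{0<..t}|interval_measure (\<lambda>s. L (max 0 s) \<omega>).
        c powr (- Lim (at_left s) (\<lambda>r. N r \<omega>)))"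

text \<open>The random variables in question are only determined almost surely, so a law is the
  distribution of a measurable version. In particular \<open>mu_law\<close> includes the almost sure
  convergence of the integral as \<open>t \<rightarrow> \<infinity>\<close>.\<close>

definition rho_law ::
    "'a measure \<Rightarrow> (real \<Rightarrow> 'a \<Rightarrow> real) \<Rightarrow> (real \<Rightarrow> 'a \<Rightarrow> real) \<Rightarrow> real measure \<Rightarrow> bool" where
  "rho_law M N L \<rho> \<longleftrightarrow>
     (\<exists>Y\<in>borel_measurable M.
        (AE \<omega> in M. Y \<omega> = L (first_jump_time N \<omega>) \<omega>) \<and> \<rho> = distr M borel Y)"

definition mu_law ::
    "'a measure \<Rightarrow> real \<Rightarrow> (real \<Rightarrow> 'a \<Rightarrow> real) \<Rightarrow> (real \<Rightarrow> 'a \<Rightarrow> real) \<Rightarrow> real measure \<Rightarrow> bool" where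
  "mu_law M c N L \<mu> \<longleftrightarrow>
     (\<exists>Y\<in>borel_measurable M.
        (AE \<omega> in M. ((\<lambda>t. exp_integral c N L t \<omega>) \<longlongrightarrow> Y \<omega>) at_top) \<and> \<mu> = distr M borel Y)"

definition is_bivariate_process ::
    "int \<Rightarrow> real \<Rightarrow> real \<Rightarrow> real \<Rightarrow> real \<Rightarrow> 'a measure
       \<Rightarrow> (real \<Rightarrow> 'a \<Rightarrow> real) \<Rightarrow> (real \<Rightarrow> 'a \<Rightarrow> real) \<Rightarrow> bool" where
  "is_bivariate_process k c p q r M N L \<longleftrightarrow>
     (\<exists>u v w. u \<ge> 0 \<and> v \<ge> 0 \<and> w \<ge> 0 \<and> u + v + w > 0 \<and>
        p = u / (u + v + w) \<and> q = v / (u + v + w) \<and> r = w / (u + v + w) \<and>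
        compound_poisson_process M (\<lambda>t \<omega>. (N t \<omega>, L t \<omega>)) (jump_measure k c u v w))"

end

theory Submission
  imports Defs
begin

text \<open>
  Take \<open>c > 1\<close> with \<open>c ^ \<bar>k\<bar> = 2\<close>, and \<open>p : q : r = 20 : 63 : 7\<close>. The value of \<open>L\<close> at the first jump
  of \<open>N\<close> has characteristic function \<open>(p + r w\<^sup>2) / (1 - q w)\<close> with \<open>w = iexp z\<close>. Its logarithm is the
  exponent of a signed Levy measure on the positive integers whose only negative mass sits at 4, and
  this mass is smaller in absolute value than the positive mass at 8. The characteristic function of
  the integral is the product over \<open>m\<close> of the dilates of this function by \<open>c ^ m\<close>. The mass at 8 of the
  factor \<open>m + \<bar>k\<bar>\<close> lies at the same point as the negative mass at 4 of the factor \<open>m\<close>, so the product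
  has a positive Levy measure.

  Both random variables are limits of integrals \<open>I t\<close> of \<open>a (N (s-))\<close> with respect to \<open>L\<close> over \<open>(0, t]\<close>:
  \<open>a n = c powr (- n)\<close> gives the one, and the indicator of \<open>n = 0\<close> gives the other. If \<open>\<psi> n\<close> is the
  product of the values \<open>(p + r w\<^sup>2) / (1 - q w)\<close> at \<open>w = iexp (z * a m)\<close>, \<open>m \<ge> n\<close>, then
  \<open>iexp (z * I t) * \<psi> (N t)\<close> has constant expectation, which identifies the law of the limit.
\<close>


section \<open>Poisson series and infinitely divisible laws\<close>

text \<open>At an even point \<open>2 * m\<close> with \<open>m > 0\<close> the Levy mass has the
  sign of \<open>(7/10) ^ (2 * m) - 2 * (- 7/20) ^ m\<close>. In general it is negative just for
  even \<open>m\<close> at which the m-th power of q^2 / (r/p) is below 2. A quotient slightly under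
  the square root of 2, here 7/5, leaves \<open>m = 2\<close> as the sole exception and keeps the
  defect small. With q = 7/10 this gives r/p = 7/20, and p + r = 3/10 fixes the rest. The equation
  for \<open>c\<close> serves twice: the joint jump becomes (1, 2), so \<open>L\<close> stays on the
  integers, and dilation by 2 carries 4 to 8.

  The process is known only through its increments, its characteristic function and the regularity
  of its paths; jump times and jump sizes are not given. Hence there is no conditioning on the first
  jump. Instead time is cut into a grid of mesh h. The product form of \<open>\<psi>\<close> says
  that the generator annihilates the functional, so one step changes the expectation by O(h^2) and
  all steps together by O(h).

  ##\<close>

lemma poisson_sums:
  fixes f :: "nat \<Rightarrow> 'b :: {banach, second_countable_topology}"
  assumes "0 < l" "summable (\<lambda>k. norm ((l ^ k / fact k * exp (-l)) *\<^sub>R f k))"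
  shows "integrable (measure_pmf (poisson_pmf l)) f"
    and "(\<lambda>k. (l ^ k / fact k * exp (-l)) *\<^sub>R f k) sums (\<integral>k. f k \<partial>measure_pmf (poisson_pmf l))"
proof -
  have eq: "measure_pmf (poisson_pmf l) = density (count_space UNIV) (\<lambda>k. ennreal (pmf (poisson_pmf l) k))"
    by (rule measure_pmf_eq_density)
  have int: "integrable (count_space UNIV) (\<lambda>k. (l ^ k / fact k * exp (-l)) *\<^sub>R f k)"
    using assms by (simp add: integrable_count_space_nat_iff)
  then show "integrable (measure_pmf (poisson_pmf l)) f"
    using assms(1) unfolding eq by (subst integrable_density) auto
  have "(\<integral>k. f k \<partial>measure_pmf (poisson_pmf l)) = (\<integral>k. (l ^ k / fact k * exp (-l)) *\<^sub>R f k \<partial>count_space UNIV)"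
    using assms(1) unfolding eq by (subst integral_density) auto
  then show "(\<lambda>k. (l ^ k / fact k * exp (-l)) *\<^sub>R f k) sums (\<integral>k. f k \<partial>measure_pmf (poisson_pmf l))"
    using sums_integral_count_space_nat[OF int] by simp
qed

text \<open>The rate 0 is set apart as a point mass, so that the formula of
  \<open>char_scaled_poisson\<close> covers every \<open>0 \<le> l\<close>; zero weights and time 0
  both occur in \<open>levy_exponent_poisson\<close>.\<close>

definition scaled_poisson :: "real \<Rightarrow> real \<Rightarrow> real measure" where
  "scaled_poisson l y =
     (if l = 0 then return borel 0 else distr (measure_pmf (poisson_pmf l)) borel (\<lambda>k. y * real k))"

lemma real_distribution_scaled_poisson [simp]: "real_distribution (scaled_poisson l y)"
proof (cases "l = 0")
  case True
  then show ?thesis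
    by (auto simp: scaled_poisson_def real_distribution_def real_distribution_axioms_def intro!: prob_space_return)
next
  case False
  then show ?thesis
    by (auto simp: scaled_poisson_def real_distribution_def real_distribution_axioms_def
        intro!: measure_pmf.prob_space_distr)
qed

lemma char_poisson:
  assumes "0 < l"
  shows "(CLINT k|measure_pmf (poisson_pmf l). iexp (z * real k)) = exp (of_real l * (iexp z - 1))"
proof -
  have pw: "iexp (z * real k) = iexp z ^ k" for k
    by (simp add: exp_of_nat_mult[symmetric] mult_ac)
  have "(\<lambda>k. (l * iexp z) ^ k /\<^sub>R fact k) sums exp (of_real l * iexp z)"
    by (rule exp_converges)
  then have "(\<lambda>k. of_real (exp (-l)) * ((of_real l * iexp z) ^ k /\<^sub>R fact k)) sums (of_real (exp (-l)) * exp (of_real l * iexp z))"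
    by (rule sums_mult)
  also have "(\<lambda>k. of_real (exp (-l)) * ((of_real l * iexp z) ^ k /\<^sub>R fact k)) = (\<lambda>k. (l ^ k / fact k * exp (-l)) *\<^sub>R iexp (z * real k))"
    unfolding pw by (auto simp: scaleR_conv_of_real power_mult_distrib field_simps)
  also have "of_real (exp (-l)) * exp (of_real l * iexp z) = exp (of_real l * (iexp z - 1))"
    by (simp add: exp_of_real[symmetric] exp_add[symmetric] algebra_simps)
  finally have 1: "(\<lambda>k. (l ^ k / fact k * exp (-l)) *\<^sub>R iexp (z * real k)) sums exp (of_real l * (iexp z - 1))" .
  have "summable (\<lambda>k. exp (-l) * (l ^ k /\<^sub>R fact k))"
    by (intro summable_mult summable_exp_generic)
  then have "summable (\<lambda>k. norm ((l ^ k / fact k * exp (-l)) *\<^sub>R iexp (z * real k)))"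
    using assms by (simp add: divide_inverse mult_ac del: of_real_mult)
  from sums_unique2[OF 1 poisson_sums(2)[OF assms this]] show ?thesis by simp
qed

lemma char_scaled_poisson:
  assumes "0 \<le> l"
  shows "char (scaled_poisson l y) z = exp (of_real l * (iexp (z * y) - 1))"
proof (cases "l = 0")
  case True
  then show ?thesis by (simp add: scaled_poisson_def char_def integral_return)
next
  case False
  then show ?thesis
    using assms char_poisson[of l "z * y"]
    by (simp add: scaled_poisson_def char_def integral_distr mult.assoc)
qed

lemma poisson_mean:
  assumes "0 < l"
  shows "integrable (measure_pmf (poisson_pmf l)) real"
    and "(\<integral>k. real k \<partial>measure_pmf (poisson_pmf l)) = l"
proof -
  have "(\<lambda>k. l ^ k /\<^sub>R fact k) sums exp l"
    by (rule exp_converges)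
  then have "(\<lambda>k. (l * exp (-l)) * (l ^ k /\<^sub>R fact k)) sums (l * exp (-l) * exp l)"
    by (rule sums_mult)
  also have "(\<lambda>k. (l * exp (-l)) * (l ^ k /\<^sub>R fact k)) = (\<lambda>k. (l ^ Suc k / fact (Suc k) * exp (-l)) *\<^sub>R real (Suc k))"
    by (auto simp: divide_inverse fact_Suc simp del: of_nat_Suc)
  finally have 1: "(\<lambda>k. (l ^ k / fact k * exp (-l)) *\<^sub>R real k) sums l"
    using exp_minus_inverse[of l] by (subst (asm) sums_Suc_iff) (simp add: exp_minus mult.assoc)
  then have "summable (\<lambda>k. norm ((l ^ k / fact k * exp (-l)) *\<^sub>R real k))"
    using assms by (auto simp: sums_iff)
  note 2 = poisson_sums[OF assms this]
  from 2(1) show "integrable (measure_pmf (poisson_pmf l)) real" .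
  from sums_unique2[OF 1 2(2)] show "(\<integral>k. real k \<partial>measure_pmf (poisson_pmf l)) = l" by simp
qed

lemma scaled_poisson_abs_mean:
  assumes "0 \<le> l"
  shows "integrable (scaled_poisson l y) abs" and "(\<integral>x. \<bar>x\<bar> \<partial>scaled_poisson l y) = l * \<bar>y\<bar>"
proof -
  have "integrable (scaled_poisson l y) abs \<and> (\<integral>x. \<bar>x\<bar> \<partial>scaled_poisson l y) = l * \<bar>y\<bar>"
  proof (cases "l = 0")
    case True
    then show ?thesis by (simp add: scaled_poisson_def integral_return)
        (subst integrable_iff_bounded, simp add: nn_integral_return)
  next
    case False
    then show ?thesis
      using assms poisson_mean[of l] by (simp add: scaled_poisson_def integrable_distr_eq integral_distr abs_mult)
  qed
  then show "integrable (scaled_poisson l y) abs" "(\<integral>x. \<bar>x\<bar> \<partial>scaled_poisson l y) = l * \<bar>y\<bar>" by auto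
qed

text \<open>Independent variables with laws \<open>\<sigma> i\<close> live on the infinite product
  space. The sum of their absolute values has finite expectation, so the series converges absolutely
  almost surely. Its sum has law \<open>\<tau>\<close>, and dominated convergence takes the finite
  products of characteristic functions to the limit.\<close>

lemma infinite_convolution_exists:
  fixes \<sigma> :: "nat \<Rightarrow> real measure"
  assumes "\<And>i. real_distribution (\<sigma> i)"
    and int: "\<And>i. integrable (\<sigma> i) abs"
    and summ: "summable (\<lambda>i. \<integral>x. \<bar>x\<bar> \<partial>\<sigma> i)"
  shows "\<exists>\<tau>. real_distribution \<tau> \<and> integrable \<tau> abs \<and> (\<integral>x. \<bar>x\<bar> \<partial>\<tau>) \<le> (\<Sum>i. \<integral>x. \<bar>x\<bar> \<partial>\<sigma> i) \<and>
    (\<forall>z. (\<lambda>n. \<Prod>i<n. char (\<sigma> i) z) \<longlonglongrightarrow> char \<tau> z)"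
proof -
  interpret real_distribution "\<sigma> i" for i by fact
  define P where "P = (\<Pi>\<^sub>M i\<in>(UNIV::nat set). \<sigma> i)"
  interpret P: prob_space P
    unfolding P_def by (intro prob_space_PiM) (rule prob_space_axioms)
  have X[measurable]: "(\<lambda>\<omega>. \<omega> i) \<in> borel_measurable P" for i
  proof -
    have "(\<lambda>\<omega>. \<omega> i) \<in> measurable P (\<sigma> i)" unfolding P_def by simp
    then show ?thesis by (simp cong: measurable_cong_sets)
  qed
  have dX: "distr P borel (\<lambda>\<omega>. \<omega> i) = \<sigma> i" for i
  proof -
    have "distr P (\<sigma> i) (\<lambda>\<omega>. \<omega> i) = \<sigma> i"
      unfolding P_def by (rule distr_PiM_component) (auto intro: prob_space_axioms)
    moreover have "distr P (\<sigma> i) (\<lambda>\<omega>. \<omega> i) = distr P borel (\<lambda>\<omega>. \<omega> i)"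
      by (rule distr_cong) auto
    ultimately show ?thesis by simp
  qed
  have ind: "P.indep_vars (\<lambda>_. borel) (\<lambda>i \<omega>. \<omega> i) UNIV"
  proof (subst P.indep_vars_iff_distr_eq_PiM)
    have "distr P (\<Pi>\<^sub>M i\<in>(UNIV::nat set). (borel::real measure)) (\<lambda>x. \<lambda>i\<in>UNIV. x i) = distr P P (\<lambda>x. x)"
      by (rule distr_cong) (auto simp: P_def intro!: sets_PiM_cong)
    also have "\<dots> = (\<Pi>\<^sub>M i\<in>UNIV. distr P borel (\<lambda>\<omega>. \<omega> i))"
      unfolding dX by (simp add: P_def)
    finally show "distr P (\<Pi>\<^sub>M i\<in>(UNIV::nat set). borel) (\<lambda>x. \<lambda>i\<in>UNIV. x i) = (\<Pi>\<^sub>M i\<in>UNIV. distr P borel (\<lambda>\<omega>. \<omega> i))" .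
  qed auto
  have nn_eq: "(\<integral>\<^sup>+\<omega>. (\<Sum>i. ennreal \<bar>\<omega> i\<bar>) \<partial>P) = ennreal (\<Sum>i. \<integral>x. \<bar>x\<bar> \<partial>\<sigma> i)"
  proof -
    have "(\<integral>\<^sup>+\<omega>. (\<Sum>i. ennreal \<bar>\<omega> i\<bar>) \<partial>P) = (\<Sum>i. \<integral>\<^sup>+\<omega>. ennreal \<bar>\<omega> i\<bar> \<partial>P)"
      by (rule nn_integral_suminf) simp
    also have "(\<lambda>i. \<integral>\<^sup>+\<omega>. ennreal \<bar>\<omega> i\<bar> \<partial>P) = (\<lambda>i. ennreal (\<integral>x. \<bar>x\<bar> \<partial>\<sigma> i))"
    proof
      fix i
      have "(\<integral>\<^sup>+\<omega>. ennreal \<bar>\<omega> i\<bar> \<partial>P) = (\<integral>\<^sup>+x. ennreal \<bar>x\<bar> \<partial>distr P borel (\<lambda>\<omega>. \<omega> i))"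
        by (simp add: nn_integral_distr)
      also have "\<dots> = ennreal (\<integral>x. \<bar>x\<bar> \<partial>\<sigma> i)"
        unfolding dX by (rule nn_integral_eq_integral[OF int]) simp
      finally show "(\<integral>\<^sup>+\<omega>. ennreal \<bar>\<omega> i\<bar> \<partial>P) = ennreal (\<integral>x. \<bar>x\<bar> \<partial>\<sigma> i)" .
    qed
    also have "(\<Sum>i. ennreal (\<integral>x. \<bar>x\<bar> \<partial>\<sigma> i)) = ennreal (\<Sum>i. \<integral>x. \<bar>x\<bar> \<partial>\<sigma> i)"
      by (rule suminf_ennreal2[OF _ summ]) (rule integral_nonneg_AE, simp)
    finally show ?thesis .
  qed
  have "AE \<omega> in P. (\<Sum>i. ennreal \<bar>\<omega> i\<bar>) \<noteq> \<infinity>"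
    by (rule nn_integral_noteq_infinite) (simp_all add: nn_eq)
  then have abs_summable: "AE \<omega> in P. summable (\<lambda>i. \<bar>\<omega> i\<bar>)"
  proof eventually_elim
    case (elim \<omega>)
    then show ?case
      using summable_suminf_not_top[of "\<lambda>i. \<bar>\<omega> i\<bar>", OF abs_ge_zero] unfolding infinity_ennreal_def by blast
  qed
  then have lim: "AE \<omega> in P. (\<lambda>n. \<Sum>i<n. \<omega> i) \<longlonglongrightarrow> (\<Sum>i. \<omega> i)"
    by eventually_elim (rule summable_LIMSEQ[OF summable_rabs_cancel])
  define \<tau> where "\<tau> = distr P borel (\<lambda>\<omega>. \<Sum>i. \<omega> i)"
  have m[measurable]: "(\<lambda>\<omega>. \<Sum>i. \<omega> i) \<in> borel_measurable P"
    by (rule borel_measurable_suminf) simp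
  have "real_distribution \<tau>"
    unfolding \<tau>_def by simp
  moreover have "integrable \<tau> abs" "(\<integral>x. \<bar>x\<bar> \<partial>\<tau>) \<le> (\<Sum>i. \<integral>x. \<bar>x\<bar> \<partial>\<sigma> i)"
  proof -
    have nonneg: "0 \<le> (\<Sum>i. \<integral>x. \<bar>x\<bar> \<partial>\<sigma> i)"
      by (rule suminf_nonneg[OF summ]) (rule integral_nonneg_AE, simp)
    have "(\<integral>\<^sup>+x. ennreal \<bar>x\<bar> \<partial>\<tau>) = (\<integral>\<^sup>+\<omega>. ennreal \<bar>\<Sum>i. \<omega> i\<bar> \<partial>P)"
      by (simp add: \<tau>_def nn_integral_distr)
    also have "\<dots> \<le> (\<integral>\<^sup>+\<omega>. (\<Sum>i. ennreal \<bar>\<omega> i\<bar>) \<partial>P)"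
      using abs_summable
      by (intro nn_integral_mono_AE, eventually_elim)
         (simp add: suminf_ennreal2 summable_rabs ennreal_leI)
    finally have le: "(\<integral>\<^sup>+x. ennreal \<bar>x\<bar> \<partial>\<tau>) \<le> ennreal (\<Sum>i. \<integral>x. \<bar>x\<bar> \<partial>\<sigma> i)"
      unfolding nn_eq .
    show int: "integrable \<tau> abs"
    proof (rule integrableI_bounded)
      show "abs \<in> borel_measurable \<tau>" by (simp add: \<tau>_def)
      show "(\<integral>\<^sup>+x. ennreal (norm \<bar>x\<bar>) \<partial>\<tau>) < \<infinity>"
        using order.strict_trans1[OF le ennreal_less_top] by simp
    qed
    have "ennreal (\<integral>x. \<bar>x\<bar> \<partial>\<tau>) \<le> ennreal (\<Sum>i. \<integral>x. \<bar>x\<bar> \<partial>\<sigma> i)"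
      using le nn_integral_eq_integral[OF int] by simp
    then show "(\<integral>x. \<bar>x\<bar> \<partial>\<tau>) \<le> (\<Sum>i. \<integral>x. \<bar>x\<bar> \<partial>\<sigma> i)"
      using nonneg by (simp add: ennreal_le_iff)
  qed
  moreover have "(\<lambda>n. \<Prod>i<n. char (\<sigma> i) z) \<longlonglongrightarrow> char \<tau> z" for z
  proof -
    have "(\<lambda>n. \<Prod>i<n. char (\<sigma> i) z) = (\<lambda>n. CLINT \<omega>|P. iexp (z * (\<Sum>i<n. \<omega> i)))"
    proof
      fix n
      have "(\<Prod>i<n. char (\<sigma> i) z) = (\<Prod>i<n. char (distr P borel (\<lambda>\<omega>. \<omega> i)) z)"
        by (simp add: dX)
      also have "\<dots> = char (distr P borel (\<lambda>\<omega>. \<Sum>i<n. \<omega> i)) z"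
        by (rule P.char_distr_sum[symmetric]) (rule P.indep_vars_subset[OF ind], simp)
      also have "\<dots> = (CLINT \<omega>|P. iexp (z * (\<Sum>i<n. \<omega> i)))"
        by (simp add: char_def integral_distr)
      finally show "(\<Prod>i<n. char (\<sigma> i) z) = (CLINT \<omega>|P. iexp (z * (\<Sum>i<n. \<omega> i)))" .
    qed
    moreover have "char \<tau> z = (CLINT \<omega>|P. iexp (z * (\<Sum>i. \<omega> i)))"
      by (simp add: \<tau>_def char_def integral_distr)
    moreover have "(\<lambda>n. CLINT \<omega>|P. iexp (z * (\<Sum>i<n. \<omega> i))) \<longlonglongrightarrow> (CLINT \<omega>|P. iexp (z * (\<Sum>i. \<omega> i)))"
    proof (rule integral_dominated_convergence[where w = "\<lambda>_. 1"])
      show "AE \<omega> in P. (\<lambda>n. iexp (z * (\<Sum>i<n. \<omega> i))) \<longlonglongrightarrow> iexp (z * (\<Sum>i. \<omega> i))"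
        using lim by eventually_elim (intro tendsto_intros)
    qed auto
    ultimately show ?thesis by simp
  qed
  ultimately show ?thesis by blast
qed

text \<open>The first-moment bound \<open>B\<close> is what makes the class closed under infinite sums.\<close>

definition levy_exponent :: "real \<Rightarrow> (real \<Rightarrow> complex) \<Rightarrow> bool" where
  "levy_exponent B f \<longleftrightarrow> 0 \<le> B \<and> (\<forall>z. norm (f z) \<le> B * \<bar>z\<bar>) \<and>
     (\<forall>t\<ge>0. \<exists>\<tau>. real_distribution \<tau> \<and> integrable \<tau> abs \<and> (\<integral>x. \<bar>x\<bar> \<partial>\<tau>) \<le> t * B \<and>
        (\<forall>z. char \<tau> z = exp (of_real t * f z)))"

lemma levy_exponent_poisson:
  assumes "0 \<le> l"
  shows "levy_exponent (l * \<bar>y\<bar>) (\<lambda>z. of_real l * (iexp (z * y) - 1))"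
  unfolding levy_exponent_def
proof (intro conjI allI impI)
  fix z
  have "norm (iexp (z * y) - 1) \<le> \<bar>z * y\<bar>"
    using iexp_approx1[of "z * y" 0] by simp
  from mult_left_mono[OF this assms] show "norm (of_real l * (iexp (z * y) - 1)) \<le> l * \<bar>y\<bar> * \<bar>z\<bar>"
    using assms by (simp add: norm_mult abs_mult mult_ac)
next
  fix t :: real assume t: "0 \<le> t"
  have "real_distribution (scaled_poisson (t * l) y) \<and> integrable (scaled_poisson (t * l) y) abs \<and>
    (\<integral>x. \<bar>x\<bar> \<partial>scaled_poisson (t * l) y) \<le> t * (l * \<bar>y\<bar>) \<and>
    (\<forall>z. char (scaled_poisson (t * l) y) z = exp (of_real t * (of_real l * (iexp (z * y) - 1))))"
    using t assms scaled_poisson_abs_mean[of "t * l" y] char_scaled_poisson[of "t * l" y]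
    by (simp add: mult.assoc)
  then show "\<exists>\<tau>. real_distribution \<tau> \<and> integrable \<tau> abs \<and> (\<integral>x. \<bar>x\<bar> \<partial>\<tau>) \<le> t * (l * \<bar>y\<bar>) \<and>
      (\<forall>z. char \<tau> z = exp (of_real t * (of_real l * (iexp (z * y) - 1))))"
    by blast
qed (use assms in simp)

text \<open>For fixed \<open>t\<close> the laws with exponents \<open>t * f i\<close> are convolved;
  their first moments are at most \<open>t * B i\<close>, hence summable.\<close>

lemma levy_exponent_suminf:
  assumes f: "\<And>i. levy_exponent (B i) (f i)" and B: "summable B"
  shows "levy_exponent (\<Sum>i. B i) (\<lambda>z. \<Sum>i. f i z)" and "summable (\<lambda>i. f i z)"
proof -
  have B0: "0 \<le> B i" for i using f[of i] by (simp add: levy_exponent_def)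
  have fB: "norm (f i z) \<le> B i * \<bar>z\<bar>" for i z using f[of i] by (simp add: levy_exponent_def)
  have sumn: "summable (\<lambda>i. norm (f i z))" for z
    by (rule summable_comparison_test'[OF summable_mult2[OF B, of "\<bar>z\<bar>"]]) (simp add: fB)
  then show summ: "summable (\<lambda>i. f i z)" for z by (rule summable_norm_cancel)
  show "levy_exponent (\<Sum>i. B i) (\<lambda>z. \<Sum>i. f i z)"
    unfolding levy_exponent_def
  proof (intro conjI allI impI)
    show "0 \<le> (\<Sum>i. B i)" by (rule suminf_nonneg[OF B B0])
    fix z
    have "norm (\<Sum>i. f i z) \<le> (\<Sum>i. norm (f i z))" by (rule summable_norm[OF sumn])
    also have "\<dots> \<le> (\<Sum>i. B i * \<bar>z\<bar>)"
      by (rule suminf_le[OF fB sumn summable_mult2[OF B]])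
    finally show "norm (\<Sum>i. f i z) \<le> (\<Sum>i. B i) * \<bar>z\<bar>"
      by (simp add: suminf_mult2[OF B])
  next
    fix t :: real assume t: "0 \<le> t"
    have "\<exists>\<tau>. real_distribution \<tau> \<and> integrable \<tau> abs \<and> (\<integral>x. \<bar>x\<bar> \<partial>\<tau>) \<le> t * B i \<and>
        (\<forall>z. char \<tau> z = exp (of_real t * f i z))" for i
      using f[of i] t by (simp add: levy_exponent_def)
    then obtain \<sigma> where \<sigma>: "\<And>i. real_distribution (\<sigma> i)" "\<And>i. integrable (\<sigma> i) abs"
      "\<And>i. (\<integral>x. \<bar>x\<bar> \<partial>\<sigma> i) \<le> t * B i" "\<And>i z. char (\<sigma> i) z = exp (of_real t * f i z)"
      by metis
    have nonneg: "0 \<le> (\<integral>x. \<bar>x\<bar> \<partial>\<sigma> i)" for i by (rule integral_nonneg_AE) simp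
    have \<sigma>sum: "summable (\<lambda>i. \<integral>x. \<bar>x\<bar> \<partial>\<sigma> i)"
      by (rule summable_comparison_test'[OF summable_mult[OF B, of t]]) (simp add: \<sigma>(3) abs_of_nonneg[OF nonneg])
    obtain \<tau> where \<tau>: "real_distribution \<tau>" "integrable \<tau> abs"
      "(\<integral>x. \<bar>x\<bar> \<partial>\<tau>) \<le> (\<Sum>i. \<integral>x. \<bar>x\<bar> \<partial>\<sigma> i)" "\<And>z. (\<lambda>n. \<Prod>i<n. char (\<sigma> i) z) \<longlonglongrightarrow> char \<tau> z"
      using infinite_convolution_exists[of \<sigma>, OF \<sigma>(1,2) \<sigma>sum] by blast
    have "(\<integral>x. \<bar>x\<bar> \<partial>\<tau>) \<le> t * (\<Sum>i. B i)"
      using \<tau>(3) suminf_le[OF \<sigma>(3) \<sigma>sum summable_mult[OF B]] suminf_mult[OF B, of t] by simp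
    moreover have "char \<tau> z = exp (of_real t * (\<Sum>i. f i z))" for z
    proof -
      have "(\<lambda>n. \<Prod>i<n. char (\<sigma> i) z) = (\<lambda>n. exp (of_real t * (\<Sum>i<n. f i z)))"
        by (simp add: \<sigma>(4) exp_sum[symmetric] sum_distrib_left)
      moreover have "(\<lambda>n. exp (of_real t * (\<Sum>i<n. f i z))) \<longlonglongrightarrow> exp (of_real t * (\<Sum>i. f i z))"
        by (intro tendsto_intros summable_LIMSEQ summ)
      ultimately show ?thesis
        using \<tau>(4)[of z] by (auto intro: LIMSEQ_unique)
    qed
    ultimately show "\<exists>\<tau>. real_distribution \<tau> \<and> integrable \<tau> abs \<and> (\<integral>x. \<bar>x\<bar> \<partial>\<tau>) \<le> t * (\<Sum>i. B i) \<and>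
        (\<forall>z. char \<tau> z = exp (of_real t * (\<Sum>i. f i z)))"
      using \<tau>(1,2) by blast
  qed
qed

lemma levy_exponent_scale:
  assumes "levy_exponent B f"
  shows "levy_exponent (B * \<bar>a\<bar>) (\<lambda>z. f (a * z))"
  unfolding levy_exponent_def
proof (intro conjI allI impI)
  show "0 \<le> B * \<bar>a\<bar>" using assms by (simp add: levy_exponent_def)
  show "norm (f (a * z)) \<le> B * \<bar>a\<bar> * \<bar>z\<bar>" for z
    using assms unfolding levy_exponent_def by (metis abs_mult mult.assoc)
  fix t :: real assume "0 \<le> t"
  then obtain \<tau> where \<tau>: "real_distribution \<tau>" "integrable \<tau> abs" "(\<integral>x. \<bar>x\<bar> \<partial>\<tau>) \<le> t * B"
    "\<And>z. char \<tau> z = exp (of_real t * f z)"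
    using assms by (auto simp: levy_exponent_def)
  interpret real_distribution \<tau> by fact
  have 1: "real_distribution (distr \<tau> borel (\<lambda>x. a * x))"
    by simp
  have 2: "integrable (distr \<tau> borel (\<lambda>x. a * x)) abs"
    using \<tau>(2) by (simp add: integrable_distr_eq abs_mult)
  have "(\<integral>x. \<bar>x\<bar> \<partial>distr \<tau> borel (\<lambda>x. a * x)) = \<bar>a\<bar> * (\<integral>x. \<bar>x\<bar> \<partial>\<tau>)"
    by (simp add: integral_distr abs_mult)
  then have 3: "(\<integral>x. \<bar>x\<bar> \<partial>distr \<tau> borel (\<lambda>x. a * x)) \<le> t * (B * \<bar>a\<bar>)"
    using mult_left_mono[OF \<tau>(3), of "\<bar>a\<bar>"] by (simp add: mult_ac)
  have 4: "char (distr \<tau> borel (\<lambda>x. a * x)) z = exp (of_real t * f (a * z))" for z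
    unfolding \<tau>(4)[symmetric] by (simp add: char_def integral_distr mult_ac)
  show "\<exists>\<tau>. real_distribution \<tau> \<and> integrable \<tau> abs \<and> (\<integral>x. \<bar>x\<bar> \<partial>\<tau>) \<le> t * (B * \<bar>a\<bar>) \<and>
      (\<forall>z. char \<tau> z = exp (of_real t * f (a * z)))"
    using 1 2 3 4 by blast
qed

section \<open>Convolution powers and roots of laws\<close>

lemma real_distribution_convolution:
  assumes "real_distribution M" "real_distribution N"
  shows "real_distribution (M \<star> N)"
proof -
  interpret M: real_distribution M by fact
  interpret N: real_distribution N by fact
  interpret pair_prob_space M N ..
  show ?thesis unfolding convolution_def by simp
qed

lemma char_convolution:
  assumes "real_distribution M" "real_distribution N"
  shows "char (M \<star> N) z = char M z * char N z"
proof -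
  interpret M: real_distribution M by fact
  interpret N: real_distribution N by fact
  interpret pair_prob_space M N ..
  have "char (M \<star> N) z = (CLINT p|M \<Otimes>\<^sub>M N. iexp (z * (fst p + snd p)))"
    unfolding convolution_def char_def by (subst integral_distr) (auto simp: split_beta)
  also have "\<dots> = (CLINT x|M. CLINT y|N. iexp (z * (x + y)))"
    by (subst integral_fst'[symmetric]) (auto intro!: integrable_const_bound[where B = 1])
  also have "\<dots> = (CLINT x|M. iexp (z * x) * char N z)"
    unfolding char_def by (simp add: distrib_left exp_add)
  also have "\<dots> = char M z * char N z"
    by (simp add: char_def)
  finally show ?thesis .
qed

lemma conv_power_0 [simp]: "conv_power 0 \<tau> = return borel 0"
  and conv_power_Suc [simp]: "conv_power (Suc n) \<tau> = (\<tau> \<star> conv_power n \<tau>)"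
  by (simp_all add: conv_power_def)

lemma real_distribution_conv_power:
  assumes "real_distribution \<tau>"
  shows "real_distribution (conv_power n \<tau>)"
proof (induction n)
  case 0
  show ?case
    by (auto simp: real_distribution_def real_distribution_axioms_def intro!: prob_space_return)
qed (simp add: real_distribution_convolution assms)

lemma char_conv_power:
  assumes "real_distribution \<tau>"
  shows "char (conv_power n \<tau>) z = char \<tau> z ^ n"
proof (induction n)
  case 0
  show ?case by (simp add: char_def integral_return)
qed (simp add: char_convolution real_distribution_conv_power assms)

text \<open>The law at time \<open>1 / n\<close> is an \<open>n\<close>-th convolution root, by
  uniqueness of characteristic functions.\<close>

lemma levy_exponent_infinitely_divisible:
  assumes "levy_exponent B f" "real_distribution \<mu>" "\<And>z. char \<mu> z = exp (f z)"
  shows "infinitely_divisible \<mu>"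
  unfolding infinitely_divisible_def
proof (intro conjI allI impI)
  fix n :: nat assume n: "0 < n"
  then obtain \<tau> where \<tau>: "real_distribution \<tau>" "\<And>z. char \<tau> z = exp (of_real (1 / n) * f z)"
    using assms(1) unfolding levy_exponent_def by (metis of_nat_0_le_iff zero_le_divide_1_iff)
  have "conv_power n \<tau> = \<mu>"
  proof (rule Levy_uniqueness)
    show "char (conv_power n \<tau>) = char \<mu>"
      using n by (auto simp: char_conv_power \<tau> assms(3) exp_of_nat_mult[symmetric])
  qed (use real_distribution_conv_power \<tau>(1) assms(2) in auto)
  then show "\<exists>\<tau>. real_distribution \<tau> \<and> conv_power n \<tau> = \<mu>" using \<tau>(1) by blast
qed fact


section \<open>The law of the first-jump value and its Levy measure\<close>

definition lattice_measure :: "(nat \<Rightarrow> real) \<Rightarrow> real measure" where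
  "lattice_measure w = distr (density (count_space UNIV) (\<lambda>n. ennreal (w n))) borel real"

lemma sets_lattice_measure [simp, measurable_cong]: "sets (lattice_measure w) = sets borel"
  and space_lattice_measure [simp]: "space (lattice_measure w) = UNIV"
  by (simp_all add: lattice_measure_def)

lemma nn_integral_lattice_measure:
  assumes "f \<in> borel_measurable borel"
  shows "(\<integral>\<^sup>+x. f x \<partial>lattice_measure w) = (\<Sum>n. ennreal (w n) * f (real n))"
  using assms by (simp add: lattice_measure_def nn_integral_distr nn_integral_density nn_integral_count_space_nat)

lemma emeasure_lattice_measure:
  assumes "A \<in> sets borel"
  shows "emeasure (lattice_measure w) A = (\<Sum>n. ennreal (w n) * indicator A (real n))"
  using nn_integral_lattice_measure[of "indicator A" w] assms by simp

lemma lattice_measure_sums: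
  fixes f :: "real \<Rightarrow> 'b :: {banach, second_countable_topology}"
  assumes w: "\<And>n. 0 \<le> w n" and f: "f \<in> borel_measurable borel"
    and "summable (\<lambda>n. norm (w n *\<^sub>R f (real n)))"
  shows "(\<lambda>n. w n *\<^sub>R f (real n)) sums (\<integral>x. f x \<partial>lattice_measure w)"
proof -
  have int: "integrable (count_space UNIV) (\<lambda>n. w n *\<^sub>R f (real n))"
    using assms by (simp add: integrable_count_space_nat_iff)
  have "(\<integral>x. f x \<partial>lattice_measure w) = (\<integral>n. w n *\<^sub>R f (real n) \<partial>count_space UNIV)"
    using f w by (simp add: lattice_measure_def integral_distr integral_density)
  then show ?thesis using sums_integral_count_space_nat[OF int] by simp
qed

lemma emeasure_lattice_measure_singleton:
  "emeasure (lattice_measure w) {real n} = ennreal (w n)"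
proof -
  have "(\<lambda>k. ennreal (w k) * indicator {real n} (real k)) sums ennreal (w n)"
    using sums_single[of n "\<lambda>k. ennreal (w k)"] by (rule sums_cong[THEN iffD1, rotated]) auto
  then show ?thesis by (simp add: emeasure_lattice_measure sums_iff)
qed

lemma real_distribution_lattice_measure:
  assumes "\<And>n. 0 \<le> w n" "w sums 1"
  shows "real_distribution (lattice_measure w)"
proof -
  have "(\<Sum>n. ennreal (w n)) = 1"
    using assms by (simp add: suminf_ennreal2 sums_iff)
  then have "prob_space (lattice_measure w)"
    by (intro prob_spaceI) (simp add: emeasure_lattice_measure)
  then show ?thesis by (simp add: real_distribution_def real_distribution_axioms_def)
qed

lemma char_lattice_measure:
  assumes "\<And>n. 0 \<le> w n" "summable w"
  shows "(\<lambda>n. of_real (w n) * iexp z ^ n) sums char (lattice_measure w) z"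
proof -
  have "(\<lambda>n. w n *\<^sub>R iexp (z * real n)) sums (CLINT x|lattice_measure w. iexp (z * x))"
    by (rule lattice_measure_sums) (use assms in \<open>auto\<close>)
  moreover have "iexp (z * real n) = iexp z ^ n" for n
    by (simp add: exp_of_nat_mult[symmetric] mult_ac)
  ultimately show ?thesis by (simp add: char_def scaleR_conv_of_real)
qed

text \<open>Before the first jump of \<open>N\<close>, the process \<open>L\<close> makes a
  geometric number of unit jumps. The jump of \<open>N\<close> itself then adds 0 with weight p =
  2/9 or 2 with weight r = 7/90. These are the power series coefficients of
  \<open>rho_char\<close>.\<close>

definition rho_weight :: "nat \<Rightarrow> real" where
  "rho_weight n = 2 / 9 * (7 / 10) ^ n + (if n < 2 then 0 else 7 / 90 * (7 / 10) ^ (n - 2))"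

definition rho :: "real measure" where
  "rho = lattice_measure rho_weight"

definition rho_char :: "complex \<Rightarrow> complex" where
  "rho_char w = (2 / 9 + 7 / 90 * w\<^sup>2) / (1 - 7 / 10 * w)"

lemma rho_weight_nonneg: "0 \<le> rho_weight n"
  by (simp add: rho_weight_def)

lemma rho_weight_power_sums:
  fixes w :: complex
  assumes "norm w \<le> 1"
  shows "(\<lambda>n. of_real (rho_weight n) * w ^ n) sums rho_char w"
proof -
  have lt: "norm (7 / 10 * w) < 1" using assms by (simp add: norm_mult)
  have g: "(\<lambda>n. (7 / 10 * w) ^ n) sums (1 / (1 - 7 / 10 * w))"
    by (rule geometric_sums[OF lt])
  have "(\<lambda>n. 7 / 90 * w\<^sup>2 * (7 / 10 * w) ^ n) sums (7 / 90 * w\<^sup>2 * (1 / (1 - 7 / 10 * w)))"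
    by (rule sums_mult[OF g])
  \<comment> \<open>The guard \<open>n + 2 < 2\<close> is false; it is written so that shifting the
    index back by two gives the second part of \<open>rho_weight\<close>.\<close>
  also have "(\<lambda>n. 7 / 90 * w\<^sup>2 * (7 / 10 * w) ^ n) =
      (\<lambda>n. (if n + 2 < 2 then 0 else 7 / 90 * (7 / 10) ^ (n + 2 - 2)) * w ^ (n + 2))"
    by (auto simp: power_mult_distrib power_divide power2_eq_square)
  finally have "(\<lambda>n. (if n < 2 then 0 else 7 / 90 * (7 / 10) ^ (n - 2)) * w ^ n) sums (7 / 90 * w\<^sup>2 * (1 / (1 - 7 / 10 * w)))"
    by (subst (asm) sums_iff_shift) (simp add: eval_nat_numeral)
  from sums_add[OF sums_mult[OF g, of "2 / 9"] this]
  have "(\<lambda>n. 2 / 9 * (7 / 10 * w) ^ n + (if n < 2 then 0 else 7 / 90 * (7 / 10) ^ (n - 2)) * w ^ n) sums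
      (2 / 9 * (1 / (1 - 7 / 10 * w)) + 7 / 90 * w\<^sup>2 * (1 / (1 - 7 / 10 * w)))" .
  also have "(\<lambda>n. 2 / 9 * (7 / 10 * w) ^ n + (if n < 2 then 0 else 7 / 90 * (7 / 10) ^ (n - 2)) * w ^ n) =
      (\<lambda>n. of_real (rho_weight n) * w ^ n)"
    by (rule ext) (simp add: rho_weight_def power_mult_distrib power_divide algebra_simps)
  also have "2 / 9 * (1 / (1 - 7 / 10 * w)) + 7 / 90 * w\<^sup>2 * (1 / (1 - 7 / 10 * w)) = rho_char w"
    by (simp add: rho_char_def add_divide_distrib)
  finally show ?thesis .
qed

lemma rho_weight_sums: "rho_weight sums 1"
proof -
  have "(\<lambda>n. complex_of_real (rho_weight n)) sums of_real 1"
    using rho_weight_power_sums[of 1] by (simp add: rho_char_def)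
  then show ?thesis by (simp only: sums_of_real_iff)
qed

lemma real_distribution_rho: "real_distribution rho"
  unfolding rho_def by (rule real_distribution_lattice_measure[OF rho_weight_nonneg rho_weight_sums])

lemma char_rho: "char rho z = rho_char (iexp z)"
proof -
  have "(\<lambda>n. of_real (rho_weight n) * iexp z ^ n) sums char rho z"
    unfolding rho_def
    by (rule char_lattice_measure) (use rho_weight_nonneg rho_weight_sums in \<open>auto simp: sums_iff\<close>)
  with rho_weight_power_sums[of "iexp z"] show ?thesis
    by (auto dest: sums_unique2)
qed

text \<open>The coefficients of \<open>ln (1 + 7/20 * w\<^sup>2) - ln (1 - 7/10 * w)\<close>, the
  logarithm of \<open>rho_char w\<close> up to a constant. Division by 0 gives 0, so the value at
  \<open>n = 0\<close> is 0 and no mass sits at the origin.\<close>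

definition levy_weight :: "nat \<Rightarrow> real" where
  "levy_weight n = (7 / 10) ^ n / n - (if even n then (- 7 / 20) ^ (n div 2) / real (n div 2) else 0)"

lemma levy_weight_power_sums:
  fixes w :: complex
  assumes "norm w \<le> 1"
  shows "(\<lambda>n. of_real (levy_weight n) * w ^ n) sums (ln (1 + 7 / 20 * w\<^sup>2) - ln (1 - 7 / 10 * w))"
proof -
  have "norm (- (7 / 10 * w)) < 1" using assms by (simp add: norm_mult)
  note Ln_series[OF this]
  also have "(\<lambda>n. (-1) ^ Suc n / of_nat n * (- (7 / 10 * w)) ^ n) = (\<lambda>n. - ((7 / 10) ^ n * w ^ n / of_nat n))"
  proof
    show "(-1) ^ Suc n / of_nat n * (- (7 / 10 * w)) ^ n = - ((7 / 10) ^ n * w ^ n / of_nat n)" for n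
      by (cases "even n") (auto simp: power_mult_distrib power_divide)
  qed
  finally have a: "(\<lambda>n. - ((7 / 10) ^ n * w ^ n / of_nat n)) sums ln (1 - 7 / 10 * w)"
    by simp
  have "norm (7 / 20 * w\<^sup>2) < 1"
  proof -
    have "norm (w\<^sup>2) \<le> 1" using assms by (simp add: norm_power power_le_one)
    then show ?thesis by (simp add: norm_mult)
  qed
  from Ln_series[OF this]
  have s: "(\<lambda>n. (-1) ^ Suc n / of_nat n * (7 / 20 * w\<^sup>2) ^ n) sums ln (1 + 7 / 20 * w\<^sup>2)" .
  \<comment> \<open>\<open>h\<close> spreads the series in the square of \<open>w\<close> over the
    even exponents, with zeros at the odd ones.\<close>
  define h where "h n = (if even n then (-1) ^ Suc (n div 2) / of_nat (n div 2) * (7 / 20 * w\<^sup>2) ^ (n div 2) else 0)" for n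
  have "(\<lambda>n. h (2 * n)) sums ln (1 + 7 / 20 * w\<^sup>2)"
    using s by (simp add: h_def)
  then have b: "h sums ln (1 + 7 / 20 * w\<^sup>2)"
    by (subst (asm) sums_mono_reindex[of "\<lambda>n. 2 * n"]) (auto simp: strict_mono_def h_def elim!: evenE)
  from sums_diff[OF b a] show ?thesis
  proof (rule sums_cong[THEN iffD1, rotated])
    fix n
    show "h n - - ((7 / 10) ^ n * w ^ n / of_nat n) = of_real (levy_weight n) * w ^ n"
    proof (cases "even n")
      case True
      then obtain m where n: "n = 2 * m" by (elim evenE)
      have weight_n: "complex_of_real (levy_weight n) = (7/10) ^ n / of_nat n - (-1) ^ m * (7/20) ^ m / of_nat m"
        by (simp add: levy_weight_def n power_minus[of "7/20"])
      show ?thesis unfolding weight_n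
        by (simp add: h_def n power_mult_distrib power_divide power_mult[symmetric] algebra_simps)
    qed (simp add: levy_weight_def h_def)
  qed
qed

definition rho_exponent :: "complex \<Rightarrow> complex" where
  "rho_exponent w = (\<Sum>n. of_real (levy_weight n) * (w ^ n - 1))"

text \<open>Subtracting the series at 1 turns the logarithm into a compound Poisson exponent. The
  subtracted constant is the logarithm of (27/20) / (3/10) = 9/2, which accounts for the factor 2/9
  in \<open>rho_char\<close>.\<close>

lemma rho_exponent:
  assumes "norm w \<le> 1"
  shows "(\<lambda>n. of_real (levy_weight n) * (w ^ n - 1)) sums rho_exponent w" and "exp (rho_exponent w) = rho_char w"
proof -
  have s: "(\<lambda>n. of_real (levy_weight n) * (w ^ n - 1)) sums
      (ln (1 + 7 / 20 * w\<^sup>2) - ln (1 - 7 / 10 * w) - (ln (1 + 7 / 20 * 1\<^sup>2) - ln (1 - 7 / 10 * 1)))"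
    using sums_diff[OF levy_weight_power_sums[OF assms] levy_weight_power_sums[of 1]] by (simp add: algebra_simps)
  then show "(\<lambda>n. of_real (levy_weight n) * (w ^ n - 1)) sums rho_exponent w"
    by (simp add: rho_exponent_def sums_iff)
  have nz1: "1 - 7 / 10 * w \<noteq> 0"
  proof
    assume "1 - 7 / 10 * w = 0"
    then have "norm (7 / 10 * w) = 1" by (metis eq_iff_diff_eq_0 norm_one)
    then show False using assms by (simp add: norm_mult)
  qed
  have nz2: "1 + 7 / 20 * w\<^sup>2 \<noteq> 0"
  proof
    assume "1 + 7 / 20 * w\<^sup>2 = 0"
    then have "norm (7 / 20 * w\<^sup>2) = 1" by (metis add.commute add_eq_0_iff norm_minus_cancel norm_one)
    moreover have "norm (w\<^sup>2) \<le> 1" using assms by (simp add: norm_power power_le_one)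
    ultimately show False by (simp add: norm_mult)
  qed
  have "exp (rho_exponent w) = (1 + 7 / 20 * w\<^sup>2) / (1 - 7 / 10 * w) / ((1 + 7 / 20 * 1\<^sup>2) / (1 - 7 / 10 * 1))"
    unfolding sums_unique[OF s, folded rho_exponent_def, symmetric] exp_diff
    using nz1 nz2 by (subst exp_Ln exp_Ln, simp)+ simp
  also have "\<dots> = rho_char w"
    using nz1 by (simp add: rho_char_def divide_simps) (simp add: algebra_simps)
  finally show "exp (rho_exponent w) = rho_char w" .
qed

text \<open>For \<open>n = 2 * m\<close> the comparison is between \<open>(7/10) ^ n\<close> and
  twice \<open>(- 7/20) ^ m\<close>. In absolute value the two powers differ by the factor
  \<open>(7/5) ^ m\<close>, which exceeds 2 from \<open>m = 3\<close> on; for \<open>m = 1\<close>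
  the second term has the favourable sign.\<close>

lemma levy_weight_nonneg:
  assumes "n \<noteq> 4"
  shows "0 \<le> levy_weight n"
proof (cases "even n")
  case True
  then obtain m where n: "n = 2 * m" by (elim evenE)
  consider "m = 0" | "m = 1" | "3 \<le> m" using assms n by linarith
  then show ?thesis
  proof cases
    case 3
    have "(- 7 / 20) ^ m \<le> \<bar>(- 7 / 20 :: real) ^ m\<bar>" by (rule abs_ge_self)
    also have "\<dots> = (7 / 20) ^ m" by (simp add: power_abs)
    also have "\<dots> = (5 / 7) ^ m * (7 / 10) ^ n"
      unfolding n power_mult power_mult_distrib[symmetric] by (simp add: power2_eq_square)
    also have "(5 / 7 :: real) ^ m \<le> (5 / 7) ^ 3" using 3 by (intro power_decreasing) auto
    also have "(5 / 7 :: real) ^ 3 \<le> 1 / 2" by (simp add: eval_nat_numeral)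
    finally have "2 * (- 7 / 20) ^ m \<le> (7 / 10 :: real) ^ n" by simp
    then show ?thesis using 3 by (simp add: levy_weight_def n field_simps)
  qed (auto simp: n levy_weight_def)
qed (simp add: levy_weight_def)

lemma levy_weight_values:
  "levy_weight 0 = 0" "levy_weight 4 = - 49 / 40000" "0 \<le> levy_weight 4 + levy_weight 8"
  by (simp_all add: levy_weight_def power_divide)

lemma levy_weight_summable: "summable (\<lambda>n. \<bar>levy_weight n\<bar>)" and levy_weight_mean_summable: "summable (\<lambda>n. \<bar>levy_weight n\<bar> * real n)"
proof -
  have b: "\<bar>levy_weight n\<bar> * real n \<le> 3 * (7 / 10) ^ n" for n
  proof (cases "even n")
    case True
    then obtain m where n: "n = 2 * m" by (elim evenE)
    have "(7 / 20 :: real) ^ m \<le> (49 / 100) ^ m" by (rule power_mono) auto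
    also have "(49 / 100 :: real) ^ m = (7 / 10) ^ n" by (simp add: n power_mult power2_eq_square)
    finally have le: "\<bar>(- 7 / 20 :: real) ^ m\<bar> \<le> (7 / 10) ^ n" by (simp add: power_abs)
    define y where "y = (- 7 / 20 :: real) ^ m"
    have "levy_weight n * n = (7 / 10) ^ n - 2 * y" if "m > 0"
      using that by (simp add: levy_weight_def n y_def field_simps)
    moreover have "\<bar>(7 / 10) ^ n - 2 * y\<bar> \<le> 3 * (7 / 10) ^ n"
      using le unfolding y_def[symmetric] by linarith
    moreover have "\<bar>levy_weight n\<bar> * real n = \<bar>levy_weight n * n\<bar>" by (simp add: abs_mult)
    ultimately show ?thesis by (cases "m = 0") (auto simp: n)
  qed (auto simp: levy_weight_def)
  show 1: "summable (\<lambda>n. \<bar>levy_weight n\<bar> * real n)"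
    by (rule summable_comparison_test'[where g = "\<lambda>n. 3 * (7 / 10) ^ n"])
       (auto intro!: summable_mult summable_geometric simp: b)
  have "\<bar>levy_weight n\<bar> \<le> \<bar>levy_weight n\<bar> * real n" for n
    using mult_left_mono[of 1 "real n" "\<bar>levy_weight n\<bar>"] by (cases "n = 0") (auto simp: levy_weight_values)
  then show "summable (\<lambda>n. \<bar>levy_weight n\<bar>)"
    by (intro summable_comparison_test'[OF 1]) auto
qed

lemma levy_condition_lattice_measure:
  assumes "\<And>n. 0 \<le> w n" "w 0 = 0" "summable w"
  shows "levy_condition (lattice_measure w)"
proof -
  have "(\<integral>\<^sup>+ x. ennreal (min (x\<^sup>2) 1) \<partial>lattice_measure w) = (\<Sum>n. ennreal (w n) * ennreal (min ((real n)\<^sup>2) 1))"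
    by (rule nn_integral_lattice_measure) simp
  also have "\<dots> \<le> (\<Sum>n. ennreal (w n))"
  proof (intro suminf_le allI)
    show "ennreal (w n) * ennreal (min ((real n)\<^sup>2) 1) \<le> ennreal (w n)" for n
      using mult_left_mono[of "ennreal (min ((real n)\<^sup>2) 1)" 1 "ennreal (w n)"] by simp
  qed auto
  also have "\<dots> < \<infinity>"
    using ennreal_suminf_neq_top[OF assms(3,1)] by (simp add: less_top)
  finally show ?thesis
    using emeasure_lattice_measure_singleton[of w 0] assms(2) by (simp add: levy_condition_def)
qed

text \<open>The compensator in \<open>levy_kernel\<close> meets the nonnegative integers only at 0,
  where it vanishes, and at 1. It amounts to the drift \<open>z * w 1\<close>, the source of the
  constant \<open>levy_weight 1\<close> in the representation of \<open>rho\<close>.\<close>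

lemma levy_kernel_lattice_measure:
  assumes w: "\<And>n. 0 \<le> w n" "w 0 = 0" "summable w"
  shows "(\<lambda>n. of_real (w n) * (iexp z ^ n - 1)) sums
     ((CLINT x|lattice_measure w. levy_kernel z x) + \<i> * of_real (z * w 1))"
proof -
  have k: "levy_kernel z (real n) = (iexp z ^ n - 1) - \<i> * of_real z * (if n = 1 then 1 else 0)" if "n > 0" for n
  proof -
    have "iexp (z * real n) = iexp z ^ n"
      by (simp add: exp_of_nat_mult[symmetric] mult_ac)
    then show ?thesis using that by (auto simp: levy_kernel_def)
  qed
  have wk: "w n *\<^sub>R levy_kernel z (real n) = of_real (w n) * (iexp z ^ n - 1) - (if n = 1 then \<i> * of_real (z * w 1) else 0)" for n
    using w(2) by (cases "n = 0") (auto simp: k scaleR_conv_of_real algebra_simps)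
  have "summable (\<lambda>n. norm (w n *\<^sub>R levy_kernel z (real n)))"
  proof (rule summable_comparison_test'[where g = "\<lambda>n. (2 + \<bar>z\<bar>) * w n"])
    show "summable (\<lambda>n. (2 + \<bar>z\<bar>) * w n)" by (rule summable_mult[OF w(3)])
    fix n
    have "norm (levy_kernel z (real n)) \<le> 2 + \<bar>z\<bar>" if "n > 0"
    proof -
      have "norm (iexp z ^ n - 1) \<le> 2"
        using norm_triangle_ineq4[of "iexp z ^ n" 1] by (simp add: norm_power)
      then show ?thesis
        unfolding k[OF that]
        using norm_triangle_ineq4[of "iexp z ^ n - 1" "\<i> * of_real z * (if n = 1 then 1 else 0)"]
        by (auto simp: norm_mult split: if_splits)
    qed
    then show "norm (norm (w n *\<^sub>R levy_kernel z (real n))) \<le> (2 + \<bar>z\<bar>) * w n"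
      using w by (cases "n = 0") (auto simp: mult_left_mono mult.commute)
  qed
  then have "(\<lambda>n. w n *\<^sub>R levy_kernel z (real n)) sums (CLINT x|lattice_measure w. levy_kernel z x)"
    by (intro lattice_measure_sums w) (auto simp: levy_kernel_def)
  from sums_add[OF this sums_single[of 1 "\<lambda>_. \<i> * of_real (z * w 1)"]]
  show ?thesis by (simp only: wk diff_add_cancel)
qed

lemma quasi_infinitely_divisible_rho: "quasi_infinitely_divisible rho"
proof -
  define wp where "wp n = (if n = 4 then 0 else levy_weight n)" for n
  define wm where "wm n = (if n = 4 then - levy_weight 4 else 0)" for n :: nat
  have p: "\<And>n. 0 \<le> wp n" "wp 0 = 0" "summable wp"
    using levy_weight_nonneg levy_weight_values summable_comparison_test'[OF levy_weight_summable, of 0 wp]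
    by (auto simp: wp_def)
  have m: "\<And>n. 0 \<le> wm n" "wm 0 = 0" "summable wm"
    using levy_weight_values summable_finite[of "{4}" wm] by (auto simp: wm_def)
  have "mutually_singular (lattice_measure wp) (lattice_measure wm)"
    unfolding mutually_singular_def
  proof (intro conjI bexI)
    show "emeasure (lattice_measure wp) {4} = 0"
      using emeasure_lattice_measure_singleton[of wp 4] by (simp add: wp_def)
    have "(\<lambda>n. ennreal (wm n) * indicator (UNIV - {4}) (real n)) = (\<lambda>n. 0)"
      by (auto simp: wm_def)
    then show "emeasure (lattice_measure wm) (space (lattice_measure wm) - {4}) = 0"
      by (simp add: emeasure_lattice_measure)
  qed auto
  moreover have "char rho z = exp (\<i> * of_real (levy_weight 1 * z) - of_real (0 * z\<^sup>2)
                + ((CLINT x|lattice_measure wp. levy_kernel z x) - (CLINT x|lattice_measure wm. levy_kernel z x)))" for z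
  proof -
    have "wp n - wm n = levy_weight n" for n by (simp add: wp_def wm_def)
    then have "of_real (wp n) * (iexp z ^ n - 1) - of_real (wm n) * (iexp z ^ n - 1) = of_real (levy_weight n) * (iexp z ^ n - 1)" for n
      by (metis left_diff_distrib of_real_diff)
    then have "rho_exponent (iexp z) = ((CLINT x|lattice_measure wp. levy_kernel z x) + \<i> * of_real (z * wp 1))
       - ((CLINT x|lattice_measure wm. levy_kernel z x) + \<i> * of_real (z * wm 1))"
      using sums_diff[OF levy_kernel_lattice_measure[OF p, of z] levy_kernel_lattice_measure[OF m, of z]]
        rho_exponent(1)[of "iexp z", OF norm_exp_i_times[THEN eq_refl]] by (simp only:) (rule sums_unique2)
    then have "rho_exponent (iexp z) = \<i> * of_real (levy_weight 1 * z) - of_real (0 * z\<^sup>2)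
        + ((CLINT x|lattice_measure wp. levy_kernel z x) - (CLINT x|lattice_measure wm. levy_kernel z x))"
      by (simp add: wp_def wm_def algebra_simps)
    with rho_exponent(2)[of "iexp z"] show ?thesis by (simp only: char_rho norm_exp_i_times order_refl)
  qed
  ultimately show ?thesis
    unfolding quasi_infinitely_divisible_def
    using real_distribution_rho levy_condition_lattice_measure[OF p] levy_condition_lattice_measure[OF m] by blast
qed

text \<open>The Levy masses of a factor of \<open>\<mu>\<close> after the mass at 8 has been moved to 4.\<close>

definition mu_weight :: "nat \<Rightarrow> real" where
  "mu_weight n = (if n = 4 then levy_weight 4 + levy_weight 8 else if n = 8 then 0 else levy_weight n)"

lemma mu_weight_nonneg: "0 \<le> mu_weight n"
  using levy_weight_nonneg levy_weight_values by (auto simp: mu_weight_def)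

lemma mu_weight_mean_summable: "summable (\<lambda>n. mu_weight n * real n)"
proof (rule summable_comparison_test_ev[OF _ levy_weight_mean_summable])
  show "\<forall>\<^sub>F n in sequentially. norm (mu_weight n * real n) \<le> \<bar>levy_weight n\<bar> * real n"
    using eventually_gt_at_top[of 8] by eventually_elim (auto simp: mu_weight_def abs_mult)
qed

definition mu_factor :: "real \<Rightarrow> complex" where
  "mu_factor z = (\<Sum>n. of_real (mu_weight n) * (iexp (z * real n) - 1))"

lemma levy_exponent_mu_factor: "levy_exponent (\<Sum>n. mu_weight n * real n) mu_factor"
  unfolding mu_factor_def
proof (rule levy_exponent_suminf(1)[OF _ mu_weight_mean_summable])
  show "levy_exponent (mu_weight n * real n) (\<lambda>z. of_real (mu_weight n) * (iexp (z * real n) - 1))" for n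
    using levy_exponent_poisson[OF mu_weight_nonneg, of n "real n"] unfolding abs_of_nat .
qed

text \<open>The price of moving mass from 8 to 4. Summed over the dilates by \<open>c ^ m\<close>
  these differences telescope, because \<open>8 * z / c ^ (m + K) = 4 * z / c ^ m\<close> when
  \<open>c ^ K = 2\<close>.\<close>

lemma mu_factor_eq:
  "mu_factor z = rho_exponent (iexp z) + of_real (levy_weight 8) * (iexp (4 * z) - iexp (8 * z))"
proof -
  have pw: "iexp (z * real n) = iexp z ^ n" for n
    by (simp add: exp_of_nat_mult[symmetric] mult_ac)
  have "(\<lambda>n. of_real (levy_weight n) * (iexp z ^ n - 1) + (if n = 4 then of_real (levy_weight 8) * (iexp z ^ 4 - 1) else 0)
      - (if n = 8 then of_real (levy_weight 8) * (iexp z ^ 8 - 1) else 0)) sums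
      (rho_exponent (iexp z) + of_real (levy_weight 8) * (iexp z ^ 4 - 1) - of_real (levy_weight 8) * (iexp z ^ 8 - 1))"
    using sums_single[of 4 "\<lambda>_. of_real (levy_weight 8) * (iexp z ^ 4 - 1)"] sums_single[of 8 "\<lambda>_. of_real (levy_weight 8) * (iexp z ^ 8 - 1)"]
    by (intro sums_add sums_diff rho_exponent(1)) auto
  also have "(\<lambda>n. of_real (levy_weight n) * (iexp z ^ n - 1) + (if n = 4 then of_real (levy_weight 8) * (iexp z ^ 4 - 1) else 0)
      - (if n = 8 then of_real (levy_weight 8) * (iexp z ^ 8 - 1) else 0)) = (\<lambda>n. of_real (mu_weight n) * (iexp (z * real n) - 1))"
    unfolding pw mu_weight_def by (rule ext) (auto simp: algebra_simps)
  finally have "mu_factor z = rho_exponent (iexp z) + of_real (levy_weight 8) * (iexp z ^ 4 - 1) - of_real (levy_weight 8) * (iexp z ^ 8 - 1)"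
    by (simp add: mu_factor_def sums_iff)
  then show ?thesis
    using pw[of 4] pw[of 8] by (simp add: algebra_simps)
qed

text \<open>When the exponents of all factors are added, the masses at 8 of the first
  \<open>K\<close> factors have no negative mass to compensate. They survive as the Poisson terms
  with index below \<open>K\<close>; the other terms are the dilates of \<open>mu_factor\<close>.
  The functional equation replaces the infinite product in all that follows.\<close>

lemma mu_exists:
  fixes c :: real
  assumes c: "1 < c" "c ^ K = 2"
  shows "\<exists>\<mu>. infinitely_divisible \<mu> \<and> (\<forall>z. char \<mu> z = rho_char (iexp z) * char \<mu> (z / c))"
proof -
  define f where "f i = (if i < K then (\<lambda>z. of_real (levy_weight 8) * (iexp (z * (8 / c ^ i)) - 1)) else (\<lambda>z. mu_factor (1 / c ^ (i - K) * z)))" for i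
  define B where "B i = (if i < K then levy_weight 8 * \<bar>8 / c ^ i\<bar> else (\<Sum>n. mu_weight n * real n) * \<bar>1 / c ^ (i - K)\<bar>)" for i
  have f: "levy_exponent (B i) (f i)" for i
  proof (cases "i < K")
    case True
    have "0 \<le> levy_weight 8" by (rule levy_weight_nonneg) simp
    from levy_exponent_poisson[OF this] show ?thesis
      unfolding B_def f_def by (simp only: True if_True)
  next
    case False
    show ?thesis
      unfolding B_def f_def by (simp only: False if_False levy_exponent_scale[OF levy_exponent_mu_factor])
  qed
  have "summable (\<lambda>i. (\<Sum>n. mu_weight n * real n) * \<bar>1 / c ^ i\<bar>)"
    using summable_geometric[of "1 / c"] c(1) by (intro summable_mult) (simp add: power_one_over)
  then have B: "summable B"
    by (subst summable_iff_shift[of _ K, symmetric]) (simp add: B_def)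
  note F = levy_exponent_suminf[OF f B]
  define F where "F z = (\<Sum>i. f i z)" for z
  have "levy_exponent (suminf B) F" unfolding F_def by (rule F(1))
  then obtain \<mu> where \<mu>: "real_distribution \<mu>" "\<And>z. char \<mu> z = exp (F z)"
    unfolding levy_exponent_def by (metis mult_1 of_real_1 zero_le_one)
  have id: "infinitely_divisible \<mu>"
    by (rule levy_exponent_infinitely_divisible[OF \<open>levy_exponent (suminf B) F\<close> \<mu>])
  have summ: "summable (\<lambda>m. mu_factor (z / c ^ m))" for z
    using F(2)[of z] by (subst (asm) summable_iff_shift[of _ K, symmetric]) (simp add: f_def)
  define e where "e x = of_real (levy_weight 8) * (iexp x - 1)" for x
  have Fz: "F z = (\<Sum>m. mu_factor (z / c ^ m)) + (\<Sum>i<K. e (8 * z / c ^ i))" for z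
    unfolding F_def e_def by (subst suminf_split_initial_segment[OF F(2), of _ K]) (simp add: f_def mult.commute)
  have F_eq: "F z = rho_exponent (iexp z) + F (z / c)" for z
  proof -
    have S: "(\<Sum>m. mu_factor (z / c ^ m)) = (\<Sum>m. mu_factor (z / c / c ^ m)) + mu_factor z"
      using suminf_split_head[OF summ[of z]] by (simp add: divide_divide_eq_left)
    \<comment> \<open>Passing from \<open>z\<close> to \<open>z / c\<close> shifts the index: the
      finite sum loses \<open>e (8 * z)\<close> and gains the term at \<open>K\<close>, which is
      \<open>e (4 * z)\<close>.\<close>
    have "(\<Sum>i<K. e (8 * z / c ^ i)) - (\<Sum>i<K. e (8 * (z / c) / c ^ i)) = e (8 * z) - e (8 * z / c ^ K)"
      using sum_lessThan_telescope'[of "\<lambda>i. e (8 * z / c ^ i)" K]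
      by (simp add: sum_subtractf divide_divide_eq_left)
    moreover have "8 * z / c ^ K = 4 * z" using c by simp
    ultimately have T: "(\<Sum>i<K. e (8 * z / c ^ i)) = e (8 * z) - e (4 * z) + (\<Sum>i<K. e (8 * (z / c) / c ^ i))"
      by (simp only: diff_eq_eq)
    have L: "mu_factor z = rho_exponent (iexp z) + e (4 * z) - e (8 * z)"
      unfolding mu_factor_eq e_def by (simp add: algebra_simps)
    show ?thesis
      unfolding Fz[of z] Fz[of "z / c"] S T L by simp
  qed
  have "char \<mu> z = rho_char (iexp z) * char \<mu> (z / c)" for z
    unfolding \<mu>(2) F_eq[of z] exp_add using rho_exponent(2)[of "iexp z"] by simp
  with id show ?thesis by blast
qed


section \<open>Failure of infinite divisibility\<close>

lemma Nats_in_borel: "(\<nat> :: real set) \<in> sets borel"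
  unfolding Nats_def by (rule sets.countable) auto

section \<open>Convolutions of laws with restricted support\<close>

lemma emeasure_convolution_nn_integral:
  assumes "real_distribution \<sigma>" "real_distribution \<tau>" "A \<in> sets borel"
  shows "emeasure (\<sigma> \<star> \<tau>) A = (\<integral>\<^sup>+x. \<integral>\<^sup>+y. indicator A (x + y) \<partial>\<tau> \<partial>\<sigma>)"
proof -
  interpret \<sigma>: real_distribution \<sigma> by fact
  interpret \<tau>: real_distribution \<tau> by fact
  show ?thesis
    by (rule convolution_emeasure'[OF assms(3) \<sigma>.finite_measure_axioms \<tau>.finite_measure_axioms]) simp_all
qed

lemma emeasure_convolution_ge:
  assumes "real_distribution \<sigma>" "real_distribution \<tau>"
    and [measurable]: "A \<in> sets borel" "B \<in> sets borel" "C \<in> sets borel"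
    and "\<And>x y. x \<in> A \<Longrightarrow> y \<in> B \<Longrightarrow> x + y \<in> C"
  shows "emeasure \<sigma> A * emeasure \<tau> B \<le> emeasure (\<sigma> \<star> \<tau>) C"
proof -
  interpret \<sigma>: real_distribution \<sigma> by fact
  interpret \<tau>: real_distribution \<tau> by fact
  have "emeasure \<sigma> A * emeasure \<tau> B = (\<integral>\<^sup>+x. \<integral>\<^sup>+y. indicator A x * indicator B y \<partial>\<tau> \<partial>\<sigma>)"
    by (simp add: nn_integral_cmult nn_integral_multc)
  also have "\<dots> \<le> (\<integral>\<^sup>+x. \<integral>\<^sup>+y. indicator C (x + y) \<partial>\<tau> \<partial>\<sigma>)"
    by (intro nn_integral_mono) (auto simp: indicator_def assms(6))
  finally show ?thesis by (simp add: emeasure_convolution_nn_integral[OF assms(1,2)])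
qed

lemma AE_convolution:
  assumes "real_distribution \<sigma>" "real_distribution \<tau>"
    and C: "C \<in> sets borel" and A: "AE x in \<sigma>. x \<in> A" and B: "AE y in \<tau>. y \<in> B"
    and "\<And>x y. x \<in> A \<Longrightarrow> y \<in> B \<Longrightarrow> x + y \<in> C"
  shows "AE z in (\<sigma> \<star> \<tau>). z \<in> C"
proof -
  have "emeasure (\<sigma> \<star> \<tau>) (- C) = (\<integral>\<^sup>+x. \<integral>\<^sup>+y. indicator (- C) (x + y) \<partial>\<tau> \<partial>\<sigma>)"
    using C by (intro emeasure_convolution_nn_integral assms(1,2)) (simp add: borel_comp)
  also have "\<dots> = (\<integral>\<^sup>+x. 0 \<partial>\<sigma>)"
  proof (rule nn_integral_cong_AE)
    show "AE x in \<sigma>. (\<integral>\<^sup>+y. indicator (- C) (x + y) \<partial>\<tau>) = 0"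
      using A
    proof eventually_elim
      case (elim x)
      have "(\<integral>\<^sup>+y. indicator (- C) (x + y) \<partial>\<tau>) = (\<integral>\<^sup>+y. 0 \<partial>\<tau>)"
        using B by (intro nn_integral_cong_AE, eventually_elim) (use elim assms(6) in auto)
      then show ?case by simp
    qed
  qed
  finally have "- C \<in> null_sets (\<sigma> \<star> \<tau>)" using C by (simp add: null_sets_def borel_comp)
  then show ?thesis by (rule AE_I') auto
qed

text \<open>Here \<open>A\<close> and \<open>B\<close> carry the two laws, and the finite set
  \<open>S\<close> of pairs with sum \<open>a\<close> contains all such pairs from
  \<open>A \<times> B\<close>. Almost everywhere the indicator of \<open>{a}\<close> at
  \<open>x + y\<close> is then a finite sum of product indicators, so the double integral
  factorizes.\<close>

lemma measure_convolution_singleton: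
  assumes "real_distribution \<sigma>" "real_distribution \<tau>"
    and S: "finite S" "\<And>x y. (x, y) \<in> S \<Longrightarrow> x + y = a"
    and A: "AE x in \<sigma>. x \<in> A" and B: "AE y in \<tau>. y \<in> B"
    and AB: "\<And>x y. x \<in> A \<Longrightarrow> y \<in> B \<Longrightarrow> x + y = a \<Longrightarrow> (x, y) \<in> S"
  shows "measure (\<sigma> \<star> \<tau>) {a} = (\<Sum>p\<in>S. measure \<sigma> {fst p} * measure \<tau> {snd p})"
proof -
  interpret \<sigma>: real_distribution \<sigma> by fact
  interpret \<tau>: real_distribution \<tau> by fact
  interpret \<sigma>\<tau>: real_distribution "\<sigma> \<star> \<tau>" by (rule real_distribution_convolution) fact+
  have ind: "indicator {a} (x + y) = (\<Sum>p\<in>S. indicator {fst p} x * indicator {snd p} y :: ennreal)"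
    if "x \<in> A" "y \<in> B" for x y
  proof (cases "x + y = a")
    case True
    have "(\<Sum>p\<in>S. indicator {fst p} x * indicator {snd p} y :: ennreal) = (\<Sum>p\<in>S. if p = (x, y) then 1 else 0)"
      by (rule sum.cong) (auto simp: indicator_def)
    then show ?thesis using S(1) AB[OF that True] True by (simp add: sum.delta')
  next
    case False
    then have "(\<Sum>p\<in>S. indicator {fst p} x * indicator {snd p} y :: ennreal) = (\<Sum>p\<in>S. 0)"
      using S(2) by (intro sum.cong) (auto simp: indicator_def)
    then show ?thesis using False by simp
  qed
  have "emeasure (\<sigma> \<star> \<tau>) {a} = (\<integral>\<^sup>+x. \<integral>\<^sup>+y. indicator {a} (x + y) \<partial>\<tau> \<partial>\<sigma>)"
    by (intro emeasure_convolution_nn_integral assms(1,2)) simp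
  also have "\<dots> = (\<integral>\<^sup>+x. \<integral>\<^sup>+y. (\<Sum>p\<in>S. indicator {fst p} x * indicator {snd p} y) \<partial>\<tau> \<partial>\<sigma>)"
  proof (rule nn_integral_cong_AE)
    show "AE x in \<sigma>. (\<integral>\<^sup>+y. indicator {a} (x + y) \<partial>\<tau>) = (\<integral>\<^sup>+y. (\<Sum>p\<in>S. indicator {fst p} x * indicator {snd p} y) \<partial>\<tau>)"
      using A
    proof eventually_elim
      case (elim x)
      show ?case
        using B by (intro nn_integral_cong_AE, eventually_elim) (rule ind[OF elim])
    qed
  qed
  also have "\<dots> = (\<Sum>p\<in>S. emeasure \<sigma> {fst p} * emeasure \<tau> {snd p})"
    by (simp add: nn_integral_sum nn_integral_cmult nn_integral_multc)
  also have "\<dots> = ennreal (\<Sum>p\<in>S. measure \<sigma> {fst p} * measure \<tau> {snd p})"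
    by (simp add: \<sigma>.emeasure_eq_measure \<tau>.emeasure_eq_measure ennreal_mult[symmetric] sum_ennreal)
  finally show ?thesis
    by (simp add: \<sigma>\<tau>.emeasure_eq_measure sum_nonneg)
qed

lemma conv_power_nonneg_atom_zero:
  assumes \<tau>: "real_distribution \<tau>" and "AE x in \<tau>. 0 \<le> x"
  shows "(AE x in conv_power n \<tau>. 0 \<le> x) \<and> measure (conv_power n \<tau>) {0} = measure \<tau> {0} ^ n"
proof (induction n)
  case 0
  show ?case unfolding conv_power_0 by (simp add: AE_return measure_return)
next
  case (Suc n)
  have 1: "AE x in \<tau>. x \<in> {0..}" "AE x in conv_power n \<tau>. x \<in> {0..}" using assms(2) Suc by auto
  have "AE x in (\<tau> \<star> conv_power n \<tau>). x \<in> {0..}"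
    by (rule AE_convolution[OF \<tau> real_distribution_conv_power[OF \<tau>] _ 1]) auto
  moreover have "measure (\<tau> \<star> conv_power n \<tau>) {0} =
      (\<Sum>p\<in>{(0,0)}. measure \<tau> {fst p} * measure (conv_power n \<tau>) {snd p})"
    by (rule measure_convolution_singleton[OF \<tau> real_distribution_conv_power[OF \<tau>] _ _ 1]) auto
  ultimately show ?case using Suc unfolding conv_power_Suc by simp
qed

text \<open>A sum of negative terms is negative. The zeroth power is the point mass at 0 and has no
  negative mass, hence the start at \<open>Suc n\<close>.\<close>

lemma emeasure_negative_conv_power:
  assumes "real_distribution \<tau>"
  shows "emeasure \<tau> {..<0} ^ Suc n \<le> emeasure (conv_power (Suc n) \<tau>) {..<0}"
proof (induction n)
  case 0
  have "emeasure \<tau> {..<0} * emeasure (return borel 0) {0::real} \<le> emeasure (\<tau> \<star> conv_power 0 \<tau>) {..<0}"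
    using real_distribution_conv_power[OF assms, of 0] unfolding conv_power_0
    by (rule emeasure_convolution_ge[OF assms]) auto
  then show ?case by simp
next
  case (Suc n)
  have "emeasure \<tau> {..<0} ^ Suc (Suc n) \<le> emeasure \<tau> {..<0} * emeasure (conv_power (Suc n) \<tau>) {..<0}"
    using Suc by (simp add: mult_left_mono)
  also have "\<dots> \<le> emeasure (\<tau> \<star> conv_power (Suc n) \<tau>) {..<0}"
    by (intro emeasure_convolution_ge assms real_distribution_conv_power) auto
  finally show ?case by simp
qed

text \<open>Negative mass of the root would give negative mass of the power, so the root lives on
  the half-line. There 0 arises only as a sum of zeros, so the atom of the power at 0 forces one of
  the root. Finally, one summand outside \<nat> and zeros elsewhere would put mass of the power
  outside \<nat>.\<close>

lemma conv_root_nat: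
  assumes \<tau>: "real_distribution \<tau>" and nat: "AE x in conv_power (Suc n) \<tau>. x \<in> \<nat>"
    and pos: "measure (conv_power (Suc n) \<tau>) {0} > 0"
  shows "AE x in \<tau>. x \<in> \<nat>" "measure \<tau> {0} > 0"
proof -
  interpret \<tau>: real_distribution \<tau> by fact
  interpret c: real_distribution "conv_power m \<tau>" for m by (rule real_distribution_conv_power[OF \<tau>])
  have "AE x in conv_power (Suc n) \<tau>. x \<notin> {..<0}"
    using nat by eventually_elim (auto simp: Nats_def)
  then have "emeasure (conv_power (Suc n) \<tau>) {..<0} = 0"
    by (subst (asm) AE_iff_measurable[of "{..<0}"]) auto
  then have "emeasure \<tau> {..<0} ^ Suc n \<le> 0"
    using emeasure_negative_conv_power[OF \<tau>, of n] by metis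
  then have "emeasure \<tau> {..<0} = 0" by (simp del: power_Suc)
  then have "AE x in \<tau>. x \<notin> {..<0}"
    by (subst AE_iff_measurable[of "{..<0}"]) auto
  then have nonneg: "AE x in \<tau>. 0 \<le> x" by eventually_elim auto
  note zero = conv_power_nonneg_atom_zero[OF \<tau> this]
  have "measure \<tau> {0} \<noteq> 0" using zero[of "Suc n"] pos by (metis less_irrefl zero_power zero_less_Suc)
  then show p: "measure \<tau> {0} > 0" using measure_nonneg[of \<tau> "{0}"] by linarith
  have "AE x in conv_power (Suc n) \<tau>. x \<notin> - \<nat>" using nat by simp
  then have "emeasure (conv_power (Suc n) \<tau>) (- \<nat>) = 0"
    using Nats_in_borel by (subst (asm) AE_iff_measurable[of "- \<nat>"]) (auto simp: borel_comp)
  moreover have "emeasure \<tau> (- \<nat>) * emeasure (conv_power n \<tau>) {0} \<le> emeasure (conv_power (Suc n) \<tau>) (- \<nat>)"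
    unfolding conv_power_Suc
    by (rule emeasure_convolution_ge[OF \<tau> real_distribution_conv_power[OF \<tau>]])
       (auto intro: Nats_in_borel borel_comp)
  moreover have "emeasure (conv_power n \<tau>) {0} \<noteq> 0"
    using zero[of n] p by (simp add: c.emeasure_eq_measure)
  ultimately have "emeasure \<tau> (- \<nat>) = 0" by auto
  then have "- \<nat> \<in> null_sets \<tau>" using Nats_in_borel by (auto simp: null_sets_def borel_comp)
  then show "AE x in \<tau>. x \<in> \<nat>" by (rule AE_I') auto
qed

text \<open>Convolution on the naturals is the Cauchy product of generating functions, so a
  convolution root becomes a root in the ring of formal power series.\<close>

lemma conv_power_fps:
  assumes \<tau>: "real_distribution \<tau>" and nat: "AE x in \<tau>. x \<in> \<nat>"
  shows "(AE x in conv_power n \<tau>. x \<in> \<nat>) \<and>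
     Abs_fps (\<lambda>j. measure (conv_power n \<tau>) {real j}) = Abs_fps (\<lambda>j. measure \<tau> {real j}) ^ n"
proof (induction n)
  case 0
  have "AE x in return borel (0::real). x \<in> \<nat>"
    using Nats_in_borel pred_sets2[OF Nats_in_borel measurable_ident] by (subst AE_return) auto
  then show ?case unfolding conv_power_0 by (auto simp: measure_return fps_eq_iff indicator_def)
next
  case (Suc n)
  then have IH: "AE x in conv_power n \<tau>. x \<in> \<nat>"
    "Abs_fps (\<lambda>j. measure (conv_power n \<tau>) {real j}) = Abs_fps (\<lambda>j. measure \<tau> {real j}) ^ n" by auto
  have "AE x in (\<tau> \<star> conv_power n \<tau>). x \<in> \<nat>"
    by (rule AE_convolution[OF \<tau> real_distribution_conv_power[OF \<tau>] Nats_in_borel nat IH(1)]) (rule Nats_add)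
  moreover have "measure (\<tau> \<star> conv_power n \<tau>) {real j} =
      (\<Sum>i=0..j. measure \<tau> {real i} * measure (conv_power n \<tau>) {real (j - i)})" for j
  proof -
    have "measure (\<tau> \<star> conv_power n \<tau>) {real j} =
      (\<Sum>p\<in>(\<lambda>i. (real i, real (j - i))) ` {0..j}. measure \<tau> {fst p} * measure (conv_power n \<tau>) {snd p})"
    proof (rule measure_convolution_singleton[OF \<tau> real_distribution_conv_power[OF \<tau>] _ _ nat IH(1)])
      fix x y :: real assume "x \<in> \<nat>" "y \<in> \<nat>" and xy: "x + y = real j"
      then obtain a b where ab: "x = real a" "y = real b" by (auto elim!: Nats_cases)
      then have "a + b = j" using xy by linarith
      then show "(x, y) \<in> (\<lambda>i. (real i, real (j - i))) ` {0..j}"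
        using ab by (intro image_eqI[of _ _ a]) auto
    qed auto
    then show ?thesis by (subst (asm) sum.reindex) (auto simp: inj_on_def)
  qed
  ultimately show ?case
    unfolding conv_power_Suc power_Suc IH(2)[symmetric] by (simp add: fps_eq_iff fps_mult_nth)
qed

section \<open>The generating function of a convolution root of \<open>rho\<close>\<close>

lemma fps_rho:
  "Abs_fps rho_weight * (1 - fps_const (7/10) * fps_X) = fps_const (2/9) + fps_const (7/90) * fps_X\<^sup>2"
proof (rule fps_ext)
  fix n
  consider "n = 0" | "n = 1" | "n = 2" | m where "n = Suc (Suc (Suc m))"
    by (metis One_nat_def Suc_1 not0_implies_Suc)
  then show "fps_nth (Abs_fps rho_weight * (1 - fps_const (7/10) * fps_X)) n = fps_nth (fps_const (2/9) + fps_const (7/90) * fps_X\<^sup>2) n"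
  proof cases
    case 4
    then show ?thesis
      by (simp add: algebra_simps rho_weight_def fps_X_power_nth)
  qed (simp_all add: algebra_simps rho_weight_def fps_X_power_nth eval_nat_numeral)
qed

text \<open>From \<open>G = H ^ n\<close> follows n H' / H = G' / G, and \<open>G\<close> is a
  quotient V / U of polynomials. Cleared of denominators, this is a linear recursion for the
  coefficients of \<open>H\<close>.\<close>

lemma fps_root_ode:
  fixes H :: "real fps"
  assumes "0 < n" and GH: "G = H ^ n" and GU: "G * (1 - fps_const q * fps_X) = fps_const p + fps_const r * fps_X\<^sup>2"
  shows "of_nat n * fps_deriv H * (fps_const p + fps_const r * fps_X\<^sup>2) * (1 - fps_const q * fps_X) =
    (2 * fps_const r * fps_X * (1 - fps_const q * fps_X) + fps_const q * (fps_const p + fps_const r * fps_X\<^sup>2)) * H"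
proof -
  define U where "U = 1 - fps_const q * fps_X"
  define V where "V = fps_const p + fps_const r * fps_X\<^sup>2"
  have GU: "G * U = V" using GU by (simp add: U_def V_def)
  have "fps_deriv (G * U) = 2 * fps_const r * fps_X"
    unfolding GU V_def by (simp add: fps_deriv_power algebra_simps power2_eq_square)
  then have dG: "fps_deriv G * U = 2 * fps_const r * fps_X + fps_const q * G"
    by (simp add: U_def algebra_simps)
  have HG: "of_nat n * fps_deriv H * G = fps_deriv G * H"
    unfolding GH fps_deriv_power using \<open>0 < n\<close> by (cases n) (simp_all add: fps_of_nat[symmetric] algebra_simps)
  have "of_nat n * fps_deriv H * V * U = (of_nat n * fps_deriv H * G) * U * U"
    unfolding GU[symmetric] by (simp add: mult_ac)
  also have "\<dots> = (fps_deriv G * U) * U * H"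
    unfolding HG by (simp add: mult_ac)
  also have "\<dots> = (2 * fps_const r * fps_X * U + fps_const q * (G * U)) * H"
    unfolding dG by (simp add: algebra_simps)
  finally show ?thesis unfolding GU unfolding U_def V_def .
qed

text \<open>For an \<open>n\<close>-th root with generating function \<open>H\<close>, the coefficients of \<open>n H' / H\<close> do not depend on
  \<open>n\<close>. The one of degree 3 is negative, so the coefficient of \<open>H\<close> at 4 is negative for large \<open>n\<close>.\<close>

lemma rho_not_infinitely_divisible: "\<not> infinitely_divisible rho"
proof
  assume "infinitely_divisible rho"
  \<comment> \<open>So large that in the coefficient of \<open>H\<close> at 4 the terms of order 1 /
    n^2 and higher cannot outweigh the term of order 1 / n, which comes from the mass -49/40000. The
    successor form matches \<open>conv_root_nat\<close>.\<close>
  moreover define n :: nat where "n = Suc 99999"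
  ultimately obtain \<tau> where \<tau>: "real_distribution \<tau>" and conv: "conv_power n \<tau> = rho"
    unfolding infinitely_divisible_def by (metis zero_less_Suc)
  interpret \<tau>: real_distribution \<tau> by fact
  have atom: "measure rho {real j} = rho_weight j" for j
    using emeasure_lattice_measure_singleton[of rho_weight j] rho_weight_nonneg[of j]
    by (simp add: rho_def measure_def)
  have "AE x in rho. x \<in> \<nat>"
    unfolding rho_def lattice_measure_def by (subst AE_distr_iff) (auto simp: Nats_in_borel)
  moreover have "measure rho {0} > 0"
    using atom[of 0] by (simp add: rho_weight_def)
  ultimately have nat: "AE x in \<tau>. x \<in> \<nat>" and pos: "measure \<tau> {0} > 0"
    using conv_root_nat[OF \<tau>, of 99999] unfolding conv[unfolded n_def] by auto
  define H where "H = Abs_fps (\<lambda>j. measure \<tau> {real j})"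
  have GH: "Abs_fps rho_weight = H ^ n"
    using conv_power_fps[OF \<tau> nat, of n] by (simp add: conv atom H_def)
  have "0 < n" by (simp add: n_def)
  note ode = fps_root_ode[OF this GH fps_rho]
  have e: "fps_nth (of_nat n * fps_deriv H * (fps_const (2/9) + fps_const (7/90) * fps_X\<^sup>2) * (1 - fps_const (7/10) * fps_X)) j =
     fps_nth ((2 * fps_const (7/90) * fps_X * (1 - fps_const (7/10) * fps_X) + fps_const (7/10) * (fps_const (2/9) + fps_const (7/90) * fps_X\<^sup>2)) * H) j" for j
    by (simp only: ode)
  have H0: "fps_nth H 0 > 0" using pos by (simp add: H_def)
  have H4: "fps_nth H (Suc (Suc (Suc (Suc 0)))) \<ge> 0" by (simp add: H_def)
  have X2: "fps_nth (A * (fps_X\<^sup>2 * fps_const c)) j = c * (if j < 2 then 0 else fps_nth A (j - 2))"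
    for A :: "real fps" and c j
    by (simp add: mult.assoc[symmetric] fps_mult_right_const_nth fps_X_power_mult_right_nth mult.commute)
  \<comment> \<open>Degrees 0 to 3 of the equation express the coefficients of \<open>H\<close> at 1
    to 4 as multiples of the positive one at 0; the last multiple is negative.\<close>
  show False
    using e[of 0] e[of 1] e[of 2] e[of 3] H0 H4
    by (simp add: n_def algebra_simps numeral_fps_const fps_of_nat X2 numeral_2_eq_2 numeral_3_eq_3)
qed


section \<open>Short-time behaviour of the process\<close>

lemma jump_measure_char:
  fixes z :: "real \<times> real"
  assumes "c powi (-k) = 2" "0 \<le> u" "0 \<le> v" "0 \<le> w"
  shows "(CLINT x|jump_measure k c u v w. iexp (z \<bullet> x) - 1) =
    of_real u * (iexp (fst z) - 1) + of_real v * (iexp (snd z) - 1) + of_real w * (iexp (fst z + 2 * snd z) - 1)"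
proof -
  define S :: "(real \<times> real) set" where "S = {(1, 0), (0, 1), (1, 2)}"
  define f :: "real \<times> real \<Rightarrow> real" where "f = (\<lambda>x. if x = (1, 0) then u else if x = (0, 1) then v else w)"
  have f: "(\<lambda>x. if x = (1, 0) then ennreal u else if x = (0, 1) then ennreal v else ennreal w) = (\<lambda>x. ennreal (f x))"
    by (auto simp: f_def)
  have f0: "0 \<le> f x" for x using assms by (simp add: f_def)
  have S: "finite S" by (simp add: S_def)
  have "(CLINT x|jump_measure k c u v w. iexp (z \<bullet> x) - 1) = (CLINT x|distr (point_measure S f) borel (\<lambda>x. x). iexp (z \<bullet> x) - 1)"
    by (simp only: jump_measure_def assms(1) S_def f)
  also have "\<dots> = (CLINT x|point_measure S f. iexp (z \<bullet> x) - 1)"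
    by (rule integral_distr) (auto simp: measurable_point_measure_eq1)
  also have "\<dots> = (\<Sum>x\<in>S. f x *\<^sub>R (iexp (z \<bullet> x) - 1))"
    by (rule lebesgue_integral_point_measure_finite[OF S f0])
  also have "\<dots> = of_real u * (iexp (fst z) - 1) + of_real v * (iexp (snd z) - 1) + of_real w * (iexp (fst z + 2 * snd z) - 1)"
    by (simp add: S_def f_def scaleR_conv_of_real inner_prod_def algebra_simps)
  finally show ?thesis .
qed

lemma emeasure_scaled_poisson_ge:
  assumes "0 < l"
  shows "ennreal (l ^ k / fact k * exp (- l)) \<le> emeasure (scaled_poisson l y) {y * real k}"
proof -
  have "ennreal (pmf (poisson_pmf l) k) = emeasure (measure_pmf (poisson_pmf l)) {k}"
    by (simp add: emeasure_pmf_single)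
  also have "\<dots> \<le> emeasure (measure_pmf (poisson_pmf l)) ((\<lambda>k. y * real k) -` {y * real k})"
    by (intro emeasure_mono) auto
  also have "\<dots> = emeasure (scaled_poisson l y) {y * real k}"
    using assms by (simp add: scaled_poisson_def emeasure_distr)
  finally show ?thesis using assms by simp
qed

lemma AE_scaled_poisson_Nats:
  assumes "0 < l"
  shows "AE x in scaled_poisson l (real m). x \<in> \<nat>"
  using assms Nats_in_borel unfolding scaled_poisson_def
  by (simp add: AE_distr_iff)

lemma ennreal_mult3:
  "0 \<le> a \<Longrightarrow> 0 \<le> b \<Longrightarrow> 0 \<le> c \<Longrightarrow> ennreal (a * (b * c)) = ennreal a * (ennreal b * ennreal c)"
  by (simp add: ennreal_mult)

text \<open>The constant 2 in \<open>char_pair\<close> is the value of \<open>c powi (- k)\<close>.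
  All statements about jumps are derived from the path and increment properties together with this
  characteristic function.\<close>

locale cp_process = prob_space M for M :: "'a measure" +
  fixes N L :: "real \<Rightarrow> 'a \<Rightarrow> real" and u v w :: real
  assumes pos: "0 < u" "0 < v" "0 < w"
    and levy: "levy_process M (\<lambda>t \<omega>. (N t \<omega>, L t \<omega>))"
    and char_pair: "0 \<le> t \<Longrightarrow> (CLINT \<omega>|M. iexp (z \<bullet> (N t \<omega>, L t \<omega>))) =
       exp (of_real t * (of_real u * (iexp (fst z) - 1) + of_real v * (iexp (snd z) - 1)
          + of_real w * (iexp (fst z + 2 * snd z) - 1)))"
begin

abbreviation X :: "real \<Rightarrow> 'a \<Rightarrow> real \<times> real" where
  "X t \<omega> \<equiv> (N t \<omega>, L t \<omega>)"

lemma measurable_X: "0 \<le> t \<Longrightarrow> X t \<in> borel_measurable M"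
  using levy by (simp add: levy_process_def)

lemma measurable_N: "0 \<le> t \<Longrightarrow> N t \<in> borel_measurable M"
  and measurable_L: "0 \<le> t \<Longrightarrow> L t \<in> borel_measurable M"
  using measurable_compose[OF measurable_X[unfolded borel_prod[symmetric]] measurable_fst, of t]
    measurable_compose[OF measurable_X[unfolded borel_prod[symmetric]] measurable_snd, of t]
  by simp_all

text \<open>The law of \<open>z1 * N t + z2 * L t\<close> as a sum of three independent Poisson
  sources: the jumps (1, 0), (0, 1) and (1, 2) contribute \<open>z1\<close>, \<open>z2\<close> and
  \<open>z1 + 2 * z2\<close>.\<close>

definition functional_law :: "real \<Rightarrow> real \<Rightarrow> real \<Rightarrow> real measure" where
  "functional_law t z1 z2 = (scaled_poisson (u * t) z1 \<star>
     (scaled_poisson (v * t) z2 \<star> scaled_poisson (w * t) (z1 + 2 * z2)))"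

lemma distr_functional:
  assumes "0 < t"
  shows "distr M borel (\<lambda>\<omega>. z1 * N t \<omega> + z2 * L t \<omega>) = functional_law t z1 z2"
proof (rule Levy_uniqueness)
  have [measurable]: "N t \<in> borel_measurable M" "L t \<in> borel_measurable M"
    using assms by (auto intro: measurable_N measurable_L)
  show "real_distribution (distr M borel (\<lambda>\<omega>. z1 * N t \<omega> + z2 * L t \<omega>))" by simp
  show "real_distribution (functional_law t z1 z2)"
    unfolding functional_law_def by (intro real_distribution_convolution real_distribution_scaled_poisson)
  show "char (distr M borel (\<lambda>\<omega>. z1 * N t \<omega> + z2 * L t \<omega>)) = char (functional_law t z1 z2)"
  proof
    fix z
    have "char (distr M borel (\<lambda>\<omega>. z1 * N t \<omega> + z2 * L t \<omega>)) z = (CLINT \<omega>|M. iexp ((z * z1, z * z2) \<bullet> X t \<omega>))"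
      by (simp add: char_def integral_distr inner_prod_def algebra_simps)
    also have "\<dots> = char (functional_law t z1 z2) z"
      using assms pos char_pair[of t "(z * z1, z * z2)"]
      by (simp add: functional_law_def char_convolution real_distribution_convolution char_scaled_poisson
          exp_add[symmetric] algebra_simps)
    finally show "char (distr M borel (\<lambda>\<omega>. z1 * N t \<omega> + z2 * L t \<omega>)) z = char (functional_law t z1 z2) z" .
  qed
qed

lemma AE_Nats_functional:
  assumes "0 < t"
  shows "AE \<omega> in M. real m * N t \<omega> + real n * L t \<omega> \<in> \<nat>"
proof -
  have [measurable]: "N t \<in> borel_measurable M" "L t \<in> borel_measurable M"
    using assms by (auto intro: measurable_N measurable_L)
  have m: "real m + 2 * real n = real (m + 2 * n)" by simp
  have t: "0 < u * t" "0 < v * t" "0 < w * t" using assms pos by auto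
  have "AE x in functional_law t (real m) (real n). x \<in> \<nat>"
    unfolding functional_law_def m
    by (intro AE_convolution[where A = \<nat> and B = \<nat>] AE_scaled_poisson_Nats t Nats_in_borel Nats_add
        real_distribution_convolution real_distribution_scaled_poisson)
  then show ?thesis
    unfolding distr_functional[OF assms, symmetric] by (rule AE_distrD[rotated]) measurable
qed

lemma AE_Nats_X:
  assumes "0 < t"
  shows "AE \<omega> in M. N t \<omega> \<in> \<nat> \<and> L t \<omega> \<in> \<nat>"
  using AE_Nats_functional[OF assms, of 1 0] AE_Nats_functional[OF assms, of 0 1] by eventually_elim auto

text \<open>The functional \<open>3 N + 4 L\<close> takes the values 0, 3, 4, 11 on \<open>\<nat> \<times> \<nat>\<close> only at the four points in question.
  This reduces the joint law to uniqueness of one-dimensional characteristic functions.\<close>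

lemma prob_X_eq:
  assumes "0 < t" and x: "x = (0, 0) \<or> x = (1, 0) \<or> x = (0, 1) \<or> x = (1, 2)"
  shows "emeasure (functional_law t 3 4) {3 * fst x + 4 * snd x} = emeasure M {\<omega> \<in> space M. X t \<omega> = x}"
proof -
  have [measurable]: "N t \<in> borel_measurable M" "L t \<in> borel_measurable M" 
    using assms by (auto intro: measurable_N measurable_L)
  have [measurable]: "X t \<in> borel_measurable M" using assms by (auto intro: measurable_X)
  have "emeasure (functional_law t 3 4) {3 * fst x + 4 * snd x} = emeasure M {\<omega> \<in> space M. 3 * N t \<omega> + 4 * L t \<omega> = 3 * fst x + 4 * snd x}"
    unfolding distr_functional[OF assms(1), symmetric] by (subst emeasure_distr) (auto intro!: arg_cong[where f = "emeasure M"])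
  also have "\<dots> = emeasure M {\<omega> \<in> space M. X t \<omega> = x}"
  proof (rule emeasure_eq_AE)
    show "AE \<omega> in M. (\<omega> \<in> {\<omega> \<in> space M. 3 * N t \<omega> + 4 * L t \<omega> = 3 * fst x + 4 * snd x}) = (\<omega> \<in> {\<omega> \<in> space M. X t \<omega> = x})"
      using AE_Nats_X[OF assms(1)]
    proof eventually_elim
      case (elim \<omega>)
      then obtain a b where ab: "N t \<omega> = real a" "L t \<omega> = real b" by (auto elim!: Nats_cases)
      have "3 * real a + 4 * real b = 3 * fst x + 4 * snd x \<longleftrightarrow> (real a, real b) = x"
      proof -
        obtain i j where ij: "x = (real i, real j)" "(i, j) \<in> {(0, 0), (1, 0), (0, 1), (1, 2)}"
          using x by (metis insertCI of_nat_0 of_nat_1 of_nat_numeral)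
        have "3 * a + 4 * b = 3 * i + 4 * j \<longleftrightarrow> a = i \<and> b = j"
          using ij(2) by auto presburger+
        moreover have "3 * real a + 4 * real b = 3 * real i + 4 * real j \<longleftrightarrow> 3 * a + 4 * b = 3 * i + 4 * j"
          by linarith
        ultimately show ?thesis using ij(1) by simp
      qed
      then show ?case using ab by auto
    qed
  qed measurable
  finally show ?thesis .
qed

definition rate :: real where "rate = u + v + w"

text \<open>Each bound keeps a single configuration of the three Poisson counts: no jump, or exactly
  one jump of the given kind. The exponential factor is at least
  \<open>1 - rate * t\<close>.\<close>

lemma prob_X_ge:
  assumes "0 < t"
  shows "1 - rate * t \<le> prob {\<omega> \<in> space M. X t \<omega> = (0, 0)}"
    "u * t * (1 - rate * t) \<le> prob {\<omega> \<in> space M. X t \<omega> = (1, 0)}"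
    "v * t * (1 - rate * t) \<le> prob {\<omega> \<in> space M. X t \<omega> = (0, 1)}"
    "w * t * (1 - rate * t) \<le> prob {\<omega> \<in> space M. X t \<omega> = (1, 2)}"
proof -
  have t: "0 < u * t" "0 < v * t" "0 < w * t" using assms pos by auto
  have e: "1 - rate * t \<le> exp (- (u * t)) * (exp (- (v * t)) * exp (- (w * t)))"
    using exp_ge_add_one_self[of "- (rate * t)"]
    by (simp add: exp_add[symmetric] rate_def algebra_simps)
  \<comment> \<open>The sizes 3, 4 and 11 = 3 + 2 * 4 are the values of \<open>3 * N + 4 * L\<close>
    on the three kinds of jump.\<close>
  have ge: "ennreal (((u * t) ^ i / fact i * exp (- (u * t))) * (((v * t) ^ j / fact j * exp (- (v * t))) * ((w * t) ^ k / fact k * exp (- (w * t)))))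
     \<le> emeasure (functional_law t 3 4) {3 * real i + (4 * real j + 11 * real k)}" for i j k
  proof -
    have "ennreal (((u * t) ^ i / fact i * exp (- (u * t))) * (((v * t) ^ j / fact j * exp (- (v * t))) * ((w * t) ^ k / fact k * exp (- (w * t)))))
      = ennreal ((u * t) ^ i / fact i * exp (- (u * t))) * (ennreal ((v * t) ^ j / fact j * exp (- (v * t))) * ennreal ((w * t) ^ k / fact k * exp (- (w * t))))"
      using t by (intro ennreal_mult3) auto
    also have "\<dots> \<le> emeasure (scaled_poisson (u * t) 3) {3 * real i} *
       (emeasure (scaled_poisson (v * t) 4) {4 * real j} * emeasure (scaled_poisson (w * t) 11) {11 * real k})"
      by (intro mult_mono emeasure_scaled_poisson_ge t) auto
    also have "\<dots> \<le> emeasure (scaled_poisson (u * t) 3) {3 * real i} *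
       emeasure (scaled_poisson (v * t) 4 \<star> scaled_poisson (w * t) 11) {4 * real j + 11 * real k}"
      by (intro mult_left_mono emeasure_convolution_ge) auto
    also have "\<dots> \<le> emeasure (functional_law t 3 4) {3 * real i + (4 * real j + 11 * real k)}"
      unfolding functional_law_def
      by (simp, intro emeasure_convolution_ge) (auto intro: real_distribution_convolution)
    finally show ?thesis .
  qed
  have t0: "0 \<le> u * t" "0 \<le> v * t" "0 \<le> w * t" using t by auto
  define p where "p = exp (- (u * t)) * (exp (- (v * t)) * exp (- (w * t)))"
  have z: "0 \<le> u * t * p" "0 \<le> v * t * p" "0 \<le> w * t * p"
    using t by (simp_all add: p_def)
  note z = z[unfolded p_def]
  have tr: "a \<le> prob A" if "ennreal b \<le> emeasure M A" "a \<le> b" "0 \<le> b" for a b A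
    using that by (simp add: emeasure_eq_measure)
  show "1 - rate * t \<le> prob {\<omega> \<in> space M. X t \<omega> = (0, 0)}"
    using ge[of 0 0 0] prob_X_eq[OF assms, of "(0, 0)"] e by (intro tr) auto
  show "u * t * (1 - rate * t) \<le> prob {\<omega> \<in> space M. X t \<omega> = (1, 0)}"
    using ge[of 1 0 0] prob_X_eq[OF assms, of "(1, 0)"] mult_left_mono[OF e t0(1)] z(1)
    by (intro tr[rotated]) (auto simp: mult_ac)
  show "v * t * (1 - rate * t) \<le> prob {\<omega> \<in> space M. X t \<omega> = (0, 1)}"
    using ge[of 0 1 0] prob_X_eq[OF assms, of "(0, 1)"] mult_left_mono[OF e t0(2)] z(2)
    by (intro tr[rotated]) (auto simp: mult_ac)
  show "w * t * (1 - rate * t) \<le> prob {\<omega> \<in> space M. X t \<omega> = (1, 2)}"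
    using ge[of 0 0 1] prob_X_eq[OF assms, of "(1, 2)"] mult_left_mono[OF e t0(3)] z(3)
    by (intro tr[rotated]) (auto simp: mult_ac)
qed

text \<open>The first-order expansion in \<open>h\<close> of the expectation of
  \<open>\<phi> (X h)\<close>: the value at the origin plus \<open>h\<close> times the generator of
  the process applied to \<open>\<phi>\<close> there.\<close>

definition linearized :: "real \<Rightarrow> (real \<times> real \<Rightarrow> complex) \<Rightarrow> complex" where
  "linearized h \<phi> = of_real (1 - rate * h) * \<phi> (0, 0)
     + of_real h * (of_real u * \<phi> (1, 0) + of_real v * \<phi> (0, 1) + of_real w * \<phi> (1, 2))"

text \<open>The lower bounds of \<open>prob_X_ge\<close> sum up to \<open>1 - (rate * h)\<^sup>2\<close>, so they are sharp up to this error.\<close>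

lemma one_step:
  assumes h: "0 < h" "rate * h \<le> 1"
    and [measurable]: "\<phi> \<in> borel_measurable borel" and \<phi>: "\<And>x. norm (\<phi> x) \<le> 1"
  shows "norm ((CLINT \<omega>|M. \<phi> (X h \<omega>)) - linearized h \<phi>) \<le> 2 * (rate * h)\<^sup>2"
proof -
  have [measurable]: "X h \<in> borel_measurable M" using h by (auto intro: measurable_X)
  define E where "E x = {\<omega> \<in> space M. X h \<omega> = x}" for x
  have E[measurable]: "E x \<in> events" for x unfolding E_def by measurable
  define S :: "(real \<times> real) set" where "S = {(0, 0), (1, 0), (0, 1), (1, 2)}"
  have S: "finite S" by (simp add: S_def)
  define b where "b x = (if x = (0, 0) then 1 - rate * h else if x = (1, 0) then u * h * (1 - rate * h)
    else if x = (0, 1) then v * h * (1 - rate * h) else w * h * (1 - rate * h))" for x :: "real \<times> real"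
  have bp: "b x \<le> prob (E x)" if "x \<in> S" for x
    using that prob_X_ge[OF h(1)] by (auto simp: S_def b_def E_def)
  have b_sum: "(\<Sum>x\<in>S. b x) = 1 - (rate * h)\<^sup>2"
    by (simp add: S_def b_def rate_def algebra_simps power2_eq_square)
  have bb: "(\<Sum>x\<in>S. of_real (b x) * \<phi> x) = linearized h \<phi> - of_real (rate * h) * (of_real h *
     (of_real u * \<phi> (1, 0) + of_real v * \<phi> (0, 1) + of_real w * \<phi> (1, 2)))"
    by (simp add: S_def b_def linearized_def algebra_simps)
  have int: "integrable M (\<lambda>\<omega>. \<phi> (X h \<omega>))"
    by (rule integrable_const_bound[where B = 1]) (auto simp: \<phi>)
  have sE: "(\<Sum>x\<in>S. indicator (E x) \<omega> *\<^sub>R c x) = (if X h \<omega> \<in> S then c (X h \<omega>) else 0)"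
    if "\<omega> \<in> space M" for \<omega> and c :: "real \<times> real \<Rightarrow> 'c :: real_vector"
  proof -
    have "(\<Sum>x\<in>S. indicator (E x) \<omega> *\<^sub>R c x) = (\<Sum>x\<in>S. if x = X h \<omega> then c x else 0)"
      using that by (intro sum.cong) (auto simp: E_def indicator_def)
    then show ?thesis using S by (simp add: sum.delta')
  qed
  \<comment> \<open>The error splits into three parts: the mass outside \<open>S\<close>, the slack
    in the lower bounds \<open>b\<close>, and the quadratic terms of \<open>b\<close>. The first two
    add up to at most \<open>1 - (\<Sum>x\<in>S. b x) = (rate * h)\<^sup>2\<close>, and the third
    has the same bound.\<close>
  have 1: "norm ((CLINT \<omega>|M. \<phi> (X h \<omega>)) - (\<Sum>x\<in>S. prob (E x) *\<^sub>R \<phi> x)) \<le> 1 - (\<Sum>x\<in>S. prob (E x))"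
  proof -
    have "(CLINT \<omega>|M. \<phi> (X h \<omega>)) - (\<Sum>x\<in>S. prob (E x) *\<^sub>R \<phi> x) = (CLINT \<omega>|M. \<phi> (X h \<omega>) - (\<Sum>x\<in>S. indicator (E x) \<omega> *\<^sub>R \<phi> x))"
    proof (subst Bochner_Integration.integral_diff[OF int])
      show "integrable M (\<lambda>\<omega>. \<Sum>x\<in>S. indicator (E x) \<omega> *\<^sub>R \<phi> x)"
        by (intro Bochner_Integration.integrable_sum integrable_scaleR_left integrable_real_indicator)
           (auto simp: emeasure_eq_measure)
      show "(CLINT \<omega>|M. \<phi> (X h \<omega>)) - (\<Sum>x\<in>S. prob (E x) *\<^sub>R \<phi> x) = (CLINT \<omega>|M. \<phi> (X h \<omega>)) - (CLINT \<omega>|M. \<Sum>x\<in>S. indicator (E x) \<omega> *\<^sub>R \<phi> x)"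
        by (subst Bochner_Integration.integral_sum) (auto intro!: integrable_scaleR_left integrable_real_indicator simp: emeasure_eq_measure)
    qed
    also have "norm \<dots> \<le> (LINT \<omega>|M. norm (\<phi> (X h \<omega>) - (\<Sum>x\<in>S. indicator (E x) \<omega> *\<^sub>R \<phi> x)))"
      by (rule integral_norm_bound)
    also have "\<dots> \<le> (LINT \<omega>|M. 1 - (\<Sum>x\<in>S. indicator (E x) \<omega> *\<^sub>R (1::real)))"
    proof (rule integral_mono)
      show "integrable M (\<lambda>\<omega>. norm (\<phi> (X h \<omega>) - (\<Sum>x\<in>S. indicator (E x) \<omega> *\<^sub>R \<phi> x)))"
        using int by (intro integrable_norm Bochner_Integration.integrable_diff Bochner_Integration.integrable_sum integrable_scaleR_left integrable_real_indicator)
          (auto simp: emeasure_eq_measure)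
      show "integrable M (\<lambda>\<omega>. 1 - (\<Sum>x\<in>S. indicator (E x) \<omega> *\<^sub>R (1::real)))"
        by (intro Bochner_Integration.integrable_diff Bochner_Integration.integrable_sum integrable_scaleR_left integrable_real_indicator)
          (auto simp: emeasure_eq_measure)
      show "norm (\<phi> (X h \<omega>) - (\<Sum>x\<in>S. indicator (E x) \<omega> *\<^sub>R \<phi> x)) \<le> 1 - (\<Sum>x\<in>S. indicator (E x) \<omega> *\<^sub>R (1::real))" if "\<omega> \<in> space M" for \<omega>
        unfolding sE[OF that] using \<phi> by auto
    qed
    also have "\<dots> = 1 - (\<Sum>x\<in>S. prob (E x))"
    proof -
      have i: "integrable M (\<lambda>\<omega>. indicator (E x) \<omega> *\<^sub>R (1::real))" for x
        by (intro integrable_scaleR_left integrable_real_indicator) (auto simp: emeasure_eq_measure)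
      have "(LINT \<omega>|M. 1 - (\<Sum>x\<in>S. indicator (E x) \<omega> *\<^sub>R (1::real))) = 1 - (LINT \<omega>|M. (\<Sum>x\<in>S. indicator (E x) \<omega> *\<^sub>R (1::real)))"
        by (subst Bochner_Integration.integral_diff[OF _ Bochner_Integration.integrable_sum[OF i]]) (simp_all add: prob_space)
      also have "\<dots> = 1 - (\<Sum>x\<in>S. LINT \<omega>|M. indicator (E x) \<omega> *\<^sub>R (1::real))"
        by (subst Bochner_Integration.integral_sum[OF i]) simp
      finally show ?thesis by simp
    qed
    finally show ?thesis .
  qed
  have 2: "norm ((\<Sum>x\<in>S. prob (E x) *\<^sub>R \<phi> x) - (\<Sum>x\<in>S. of_real (b x) * \<phi> x)) \<le> (\<Sum>x\<in>S. prob (E x)) - (\<Sum>x\<in>S. b x)"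
  proof -
    have "(\<Sum>x\<in>S. prob (E x) *\<^sub>R \<phi> x) - (\<Sum>x\<in>S. of_real (b x) * \<phi> x) = (\<Sum>x\<in>S. (prob (E x) - b x) *\<^sub>R \<phi> x)"
      by (simp add: sum_subtractf scaleR_conv_of_real algebra_simps)
    also have "norm \<dots> \<le> (\<Sum>x\<in>S. prob (E x) - b x)"
    proof (rule sum_norm_le)
      show "norm ((prob (E x) - b x) *\<^sub>R \<phi> x) \<le> prob (E x) - b x" if "x \<in> S" for x
        using bp[OF that] \<phi>[of x] by (simp add: mult_left_le)
    qed
    finally show ?thesis by (simp add: sum_subtractf)
  qed
  have 3: "norm ((\<Sum>x\<in>S. of_real (b x) * \<phi> x) - linearized h \<phi>) \<le> (rate * h)\<^sup>2"
  proof -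
    have "norm (of_real u * \<phi> (1, 0) + of_real v * \<phi> (0, 1) + of_real w * \<phi> (1, 2)) \<le> u * 1 + v * 1 + w * 1"
      using pos \<phi> by (intro norm_triangle_le add_mono) (auto simp: norm_mult mult_left_le)
    then have y: "norm (of_real u * \<phi> (1, 0) + of_real v * \<phi> (0, 1) + of_real w * \<phi> (1, 2)) \<le> rate"
      by (simp add: rate_def)
    have "0 \<le> rate" using pos by (simp add: rate_def)
    then have "norm (of_real (rate * h) * (of_real h * (of_real u * \<phi> (1, 0) + of_real v * \<phi> (0, 1) + of_real w * \<phi> (1, 2)))) \<le> (rate * h) * (h * rate)"
      using h y unfolding norm_mult norm_of_real by (intro mult_mono) auto
    then show ?thesis unfolding bb by (simp add: power2_eq_square mult_ac)
  qed
  have "norm ((CLINT \<omega>|M. \<phi> (X h \<omega>)) - linearized h \<phi>) \<le>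
    norm ((CLINT \<omega>|M. \<phi> (X h \<omega>)) - (\<Sum>x\<in>S. prob (E x) *\<^sub>R \<phi> x)) +
    norm ((\<Sum>x\<in>S. prob (E x) *\<^sub>R \<phi> x) - (\<Sum>x\<in>S. of_real (b x) * \<phi> x)) +
    norm ((\<Sum>x\<in>S. of_real (b x) * \<phi> x) - linearized h \<phi>)"
    by (rule order.trans[OF _ add_right_mono[OF norm_triangle_ineq]])
       (rule order.trans[OF _ norm_triangle_ineq], simp)
  with 1 2 3 b_sum show ?thesis by linarith
qed

end

text \<open>By independence and Fubini, \<open>D\<close> can be integrated out first for a fixed
  value of \<open>A\<close>. The estimate is uniform in that value, so it survives averaging over
  \<open>A\<close>.\<close>

lemma (in prob_space) indep_expectation_close:
  fixes A :: "'a \<Rightarrow> 'b :: euclidean_space" and D :: "'a \<Rightarrow> 'b"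
    and F :: "'b \<Rightarrow> 'b \<Rightarrow> complex"
  assumes ind: "indep_var borel A borel D"
    and F[measurable]: "(\<lambda>p. F (fst p) (snd p)) \<in> borel_measurable (borel \<Otimes>\<^sub>M borel)" and F1: "\<And>a d. norm (F a d) \<le> 1"
    and G[measurable]: "G \<in> borel_measurable borel" and G1: "\<And>a. norm (G a) \<le> 1"
    and close: "\<And>a. norm ((CLINT \<omega>|M. F a (D \<omega>)) - G a) \<le> \<epsilon>"
  shows "norm ((CLINT \<omega>|M. F (A \<omega>) (D \<omega>)) - (CLINT \<omega>|M. G (A \<omega>))) \<le> \<epsilon>"
proof -
  have [measurable]: "random_variable borel A" "random_variable borel D"
    using ind by (auto dest: indep_var_rv1 indep_var_rv2)
  interpret a: prob_space "distr M borel A" by (rule prob_space_distr) measurable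
  interpret d: prob_space "distr M borel D" by (rule prob_space_distr) measurable
  interpret ad: pair_prob_space "distr M borel A" "distr M borel D" ..
  have joint: "distr M borel A \<Otimes>\<^sub>M distr M borel D = distr M (borel \<Otimes>\<^sub>M borel) (\<lambda>x. (A x, D x))"
    using ind by (simp add: indep_var_distribution_eq)
  have Fa[measurable]: "F a \<in> borel_measurable borel" for a
    using measurable_compose[OF _ F, of "\<lambda>d. (a, d)"] by simp
  have "(CLINT \<omega>|M. F (A \<omega>) (D \<omega>)) = (CLINT p|distr M borel A \<Otimes>\<^sub>M distr M borel D. F (fst p) (snd p))"
    unfolding joint by (subst integral_distr) auto
  also have "\<dots> = (CLINT a|distr M borel A. CLINT d|distr M borel D. F a d)"
    by (subst ad.integral_fst'[symmetric]) (auto intro!: ad.integrable_const_bound[where B = 1] simp: F1)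
  finally have "(CLINT \<omega>|M. F (A \<omega>) (D \<omega>)) - (CLINT \<omega>|M. G (A \<omega>)) =
     (CLINT a|distr M borel A. (CLINT d|distr M borel D. F a d)) - (CLINT a|distr M borel A. G a)"
    by (simp add: integral_distr)
  also have "\<dots> = (CLINT a|distr M borel A. (CLINT d|distr M borel D. F a d) - G a)"
  proof (rule Bochner_Integration.integral_diff[symmetric])
    show "integrable (distr M borel A) G"
      by (rule a.integrable_const_bound[where B = 1]) (auto simp: G1)
    have "integrable (distr M borel A) (\<lambda>a. CLINT d|distr M borel D. (\<lambda>p. F (fst p) (snd p)) (a, d))"
      by (rule ad.integrable_fst') (auto intro!: ad.integrable_const_bound[where B = 1] simp: F1)
    then show "integrable (distr M borel A) (\<lambda>a. CLINT d|distr M borel D. F a d)" by simp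
  qed
  also have "norm \<dots> \<le> (LINT a|distr M borel A. \<epsilon>)"
  proof (rule Bochner_Integration.integral_norm_bound_integral)
    show "integrable (distr M borel A) (\<lambda>a. (CLINT d|distr M borel D. F a d) - G a)"
    proof (rule Bochner_Integration.integrable_diff)
      show "integrable (distr M borel A) G"
        by (rule a.integrable_const_bound[where B = 1]) (auto simp: G1)
      have "integrable (distr M borel A) (\<lambda>a. CLINT d|distr M borel D. (\<lambda>p. F (fst p) (snd p)) (a, d))"
        by (rule ad.integrable_fst') (auto intro!: ad.integrable_const_bound[where B = 1] simp: F1)
      then show "integrable (distr M borel A) (\<lambda>a. CLINT d|distr M borel D. F a d)" by simp
    qed
    show "norm ((CLINT d|distr M borel D. F a d) - G a) \<le> \<epsilon>" for a
      using close[of a] by (simp add: integral_distr)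
  qed simp
  finally show ?thesis using a.prob_space by simp
qed

section \<open>The nearly constant expectation along a time grid\<close>

context cp_process
begin

lemma X_increment:
  assumes "0 \<le> s" "0 \<le> t"
  shows "distr M borel (\<lambda>\<omega>. X (s + t) \<omega> - X s \<omega>) = distr M borel (X t)"
  using levy assms unfolding levy_process_def by blast

text \<open>By \<open>rec\<close> the linearized expectation over one step reproduces
  \<open>\<psi> x\<close> exactly, so only the error of \<open>one_step\<close> accumulates.
  Subtracting \<open>N 0\<close> makes everything a function of the increments; \<open>N 0\<close>
  itself is 0 only almost surely.\<close>

lemma grid_chain:
  fixes a :: "real \<Rightarrow> real" and \<psi> :: "real \<Rightarrow> complex"
  assumes h: "0 < h" "rate * h \<le> 1"
    and a[measurable]: "a \<in> borel_measurable borel"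
    and \<psi>[measurable]: "\<psi> \<in> borel_measurable borel" and \<psi>1: "\<And>x. norm (\<psi> x) \<le> 1"
    and rec: "\<And>x. of_real rate * \<psi> x = of_real u * \<psi> (x + 1) + of_real v * (iexp (z * a x) * \<psi> x)
        + of_real w * (iexp (2 * z * a x) * \<psi> (x + 1))"
  defines "R \<equiv> \<lambda>m \<omega>. \<Sum>j<m. a (N (real j * h) \<omega> - N 0 \<omega>) * (L (real (Suc j) * h) \<omega> - L (real j * h) \<omega>)"
  shows "norm ((CLINT \<omega>|M. iexp (z * R m \<omega>) * \<psi> (N (real m * h) \<omega> - N 0 \<omega>)) - \<psi> 0) \<le> real m * (2 * (rate * h)\<^sup>2)"
proof (induction m)
  case 0
  show ?case by (simp add: R_def prob_space)
next
  case (Suc m)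
  define D where "D = (\<lambda>j \<omega>. X (real (Suc j) * h) \<omega> - X (real j * h) \<omega>)"
  define A where "A = (\<lambda>\<omega>. (R m \<omega>, N (real m * h) \<omega> - N 0 \<omega>))"
  have ind: "indep_vars (\<lambda>_. borel) D {..<Suc m}"
  proof -
    have "mono (\<lambda>j. real j * h)" using h by (auto simp: mono_def)
    moreover have "\<forall>n (t::nat \<Rightarrow> real). 0 \<le> t 0 \<and> mono t \<longrightarrow>
        indep_vars (\<lambda>_. borel) (\<lambda>i \<omega>. X (t (Suc i)) \<omega> - X (t i) \<omega>) {..<n}"
      using levy unfolding levy_process_def by blast
    ultimately show ?thesis unfolding D_def by (elim allE[of _ "Suc m"] allE[of _ "\<lambda>j. real j * h"]) simp
  qed
  \<comment> \<open>The past up to step \<open>m\<close> as a function of the first \<open>m\<close>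
    increments, which makes it independent of the next one.\<close>
  define fA where "fA = (\<lambda>g :: nat \<Rightarrow> real \<times> real. (\<Sum>j<m. a (\<Sum>i<j. fst (g i)) * snd (g j), \<Sum>i<m. fst (g i)))"
  have Nsum: "N (real j * h) \<omega> - N 0 \<omega> = (\<Sum>i<j. fst (D i \<omega>))" for j \<omega>
    using sum_lessThan_telescope[of "\<lambda>j. N (real j * h) \<omega>" j] by (simp add: D_def)
  have fA: "A = (\<lambda>\<omega>. fA (restrict (\<lambda>i. D i \<omega>) {..<m}))"
    unfolding A_def fA_def R_def Nsum by (auto simp: D_def)
  have [measurable]: "(\<lambda>g. g i) \<in> borel_measurable (\<Pi>\<^sub>M j\<in>{..<m}. (borel :: (real \<times> real) measure))" if "i < m" for i
    using that by (intro measurable_component_singleton) auto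
  have [measurable]: "(\<lambda>g. fst (g i)) \<in> borel_measurable (\<Pi>\<^sub>M j\<in>{..<m}. (borel :: (real \<times> real) measure))"
     "(\<lambda>g. snd (g i)) \<in> borel_measurable (\<Pi>\<^sub>M j\<in>{..<m}. (borel :: (real \<times> real) measure))" if "i < m" for i
    using that measurable_component_singleton[of i "{..<m}" "\<lambda>_. borel :: (real \<times> real) measure"]
    by (auto simp: borel_prod[symmetric] intro: measurable_compose[OF _ measurable_fst] measurable_compose[OF _ measurable_snd])
  have fA_meas: "fA \<in> borel_measurable (\<Pi>\<^sub>M j\<in>{..<m}. borel)"
    unfolding fA_def borel_prod[symmetric]
    by (intro measurable_Pair borel_measurable_sum borel_measurable_times measurable_compose[OF _ a]) auto
  have "indep_var (\<Pi>\<^sub>M j\<in>{..<m}. borel) (\<lambda>\<omega>. restrict (\<lambda>i. D i \<omega>) {..<m}) (\<Pi>\<^sub>M j\<in>{m}. borel) (\<lambda>\<omega>. restrict (\<lambda>i. D i \<omega>) {m})"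
    by (rule indep_var_restrict[OF ind]) auto
  from indep_var_compose[OF this fA_meas, of "\<lambda>g. g m" borel]
  have ind2: "indep_var borel A borel (D m)"
    unfolding fA comp_def by (simp add: measurable_component_singleton)
  define F where "F = (\<lambda>(r, x) (n, l). iexp (z * r) * (iexp (z * a x * l) * \<psi> (x + n)))"
  define G where "G = (\<lambda>(r, x). iexp (z * r) * \<psi> x)"
  have "norm ((CLINT \<omega>|M. F (A \<omega>) (D m \<omega>)) - (CLINT \<omega>|M. G (A \<omega>))) \<le> 2 * (rate * h)\<^sup>2"
  proof (rule indep_expectation_close[OF ind2])
    show "(\<lambda>p. F (fst p) (snd p)) \<in> borel_measurable (borel \<Otimes>\<^sub>M borel)"
      unfolding F_def split_beta borel_prod[symmetric] by measurable
    show "G \<in> borel_measurable borel" unfolding G_def split_beta borel_prod[symmetric] by measurable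
    show "norm (F p d) \<le> 1" for p d using \<psi>1 by (simp add: F_def split_beta norm_mult del: of_real_mult)
    show "norm (G p) \<le> 1" for p using \<psi>1 by (simp add: G_def split_beta norm_mult del: of_real_mult)
    fix p :: "real \<times> real"
    obtain r x where p: "p = (r, x)" by (cases p)
    define \<phi> where "\<phi> = (\<lambda>d. iexp (z * a x * snd d) * \<psi> (x + fst d))"
    have \<phi>m[measurable]: "\<phi> \<in> borel_measurable borel" unfolding \<phi>_def borel_prod[symmetric] by measurable
    have \<phi>1: "norm (\<phi> d) \<le> 1" for d using \<psi>1 by (simp add: \<phi>_def norm_mult del: of_real_mult)
    have lin: "linearized h \<phi> = \<psi> x"
    proof -
      have "linearized h \<phi> = \<psi> x - of_real h * (of_real rate * \<psi> x) + of_real h * (of_real u * \<psi> (x + 1) + of_real v * (iexp (z * a x) * \<psi> x)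
        + of_real w * (iexp (2 * z * a x) * \<psi> (x + 1)))"
        by (simp add: linearized_def \<phi>_def algebra_simps)
      then show ?thesis unfolding rec[symmetric] by simp
    qed
    have Dm[measurable]: "D m \<in> borel_measurable M" using ind2 by (rule indep_var_rv2)
    have "distr M borel (D m) = distr M borel (X h)"
      using X_increment[of "real m * h" h] h by (simp add: D_def algebra_simps)
    then have "(CLINT \<omega>|M. \<phi> (D m \<omega>)) = (CLINT \<omega>|M. \<phi> (X h \<omega>))"
      using integral_distr[OF Dm \<phi>m] integral_distr[OF measurable_X[of h] \<phi>m] h by simp
    then have "norm ((CLINT \<omega>|M. \<phi> (D m \<omega>)) - \<psi> x) \<le> 2 * (rate * h)\<^sup>2"
      using one_step[OF h \<phi>m \<phi>1] lin by simp
    moreover have "(CLINT \<omega>|M. F p (D m \<omega>)) - G p = iexp (z * r) * ((CLINT \<omega>|M. \<phi> (D m \<omega>)) - \<psi> x)"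
      by (simp add: p F_def G_def \<phi>_def split_beta right_diff_distrib del: of_real_mult)
    ultimately show "norm ((CLINT \<omega>|M. F p (D m \<omega>)) - G p) \<le> 2 * (rate * h)\<^sup>2"
      by (simp add: norm_mult del: of_real_mult)
  qed
  moreover have "F (A \<omega>) (D m \<omega>) = iexp (z * R (Suc m) \<omega>) * \<psi> (N (real (Suc m) * h) \<omega> - N 0 \<omega>)" for \<omega>
    by (simp add: F_def A_def D_def R_def exp_add[symmetric] algebra_simps)
  moreover have "G (A \<omega>) = iexp (z * R m \<omega>) * \<psi> (N (real m * h) \<omega> - N 0 \<omega>)" for \<omega>
    by (simp add: G_def A_def)
  ultimately have "norm ((CLINT \<omega>|M. iexp (z * R (Suc m) \<omega>) * \<psi> (N (real (Suc m) * h) \<omega> - N 0 \<omega>))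
      - (CLINT \<omega>|M. iexp (z * R m \<omega>) * \<psi> (N (real m * h) \<omega> - N 0 \<omega>))) \<le> 2 * (rate * h)\<^sup>2"
    by simp
  from norm_triangle_le[OF add_mono[OF this Suc]] show ?case
    by (simp add: algebra_simps)
qed

end


section \<open>Riemann sums for Stieltjes integrals\<close>

text \<open>The sum is the integral of a step function that at \<open>s\<close> takes the value of
  \<open>f\<close> at the last grid point before \<open>s\<close>. These points tend to
  \<open>s\<close> strictly from the left, so the step functions converge to the left limit
  \<open>A s\<close>, dominated by the indicator of the interval.\<close>

lemma
  fixes F f A :: "real \<Rightarrow> real"
  assumes F: "\<And>x y. x \<le> y \<Longrightarrow> F x \<le> F y" "\<And>x. continuous (at_right x) F"
    and t: "0 < t"
    and f: "\<And>x. 0 \<le> x \<Longrightarrow> x < t \<Longrightarrow> \<bar>f x\<bar> \<le> 1"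
    and A: "\<And>s. 0 < s \<Longrightarrow> s \<le> t \<Longrightarrow> (f \<longlongrightarrow> A s) (at_left s)"
  shows riemann_stieltjes_integrable: "set_integrable (interval_measure F) {0<..t} A"
    and riemann_stieltjes_limit:
      "(\<lambda>n. \<Sum>j<Suc n. f (real j * (t / real (Suc n))) * (F (real (Suc j) * (t / real (Suc n))) - F (real j * (t / real (Suc n)))))
        \<longlonglongrightarrow> (LINT s:{0<..t}|interval_measure F. A s)"
proof -
  define h where "h n = t / real (Suc n)" for n
  have h: "0 < h n" for n using t by (simp add: h_def)
  have hn: "real (Suc n) * h n = t" for n by (simp add: h_def)
  define st where "st n s = (\<Sum>j<Suc n. indicator {real j * h n<..real (Suc j) * h n} s *\<^sub>R f (real j * h n))" for n s
  have st_meas: "st n \<in> borel_measurable (interval_measure F)" for n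
    unfolding st_def by measurable
  have Ioc: "emeasure (interval_measure F) {a<..b} = ennreal (F b - F a)" if "a \<le> b" for a b
    using that F by (intro emeasure_interval_measure_Ioc) auto
  have Ioc': "measure (interval_measure F) {a<..b} = F b - F a" if "a \<le> b" for a b
    using that F by (intro measure_interval_measure_Ioc) auto
  have le: "real j * h n \<le> real (Suc j) * h n" for j n
    using h[of n] by (simp add: algebra_simps)
  have st_int: "(LINT s|interval_measure F. st n s) = (\<Sum>j<Suc n. f (real j * h n) * (F (real (Suc j) * h n) - F (real j * h n)))" for n
  proof -
    have i: "integrable (interval_measure F) (\<lambda>s. indicator {real j * h n<..real (Suc j) * h n} s *\<^sub>R f (real j * h n))" for j
      using Ioc[OF le] by (intro integrable_scaleR_left integrable_real_indicator) auto
    have "(LINT s|interval_measure F. st n s) = (\<Sum>j<Suc n. LINT s|interval_measure F. indicator {real j * h n<..real (Suc j) * h n} s *\<^sub>R f (real j * h n))"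
      unfolding st_def by (rule Bochner_Integration.integral_sum[OF i])
    also have "\<dots> = (\<Sum>j<Suc n. f (real j * h n) * (F (real (Suc j) * h n) - F (real j * h n)))"
      using Ioc'[OF le] by (intro sum.cong) (auto simp: mult.commute)
    finally show ?thesis .
  qed
  have st_in: "\<exists>g. s - h n \<le> g \<and> g < s \<and> 0 \<le> g \<and> st n s = f g" if s: "0 < s" "s \<le> t" for s n
  proof -
    \<comment> \<open>The index with \<open>k * h n < s \<le> (k + 1) * h n\<close>. The ceiling,
      not the floor, is taken so that a grid point is assigned to its left neighbour.\<close>
    define k where "k = nat (\<lceil>s / h n\<rceil> - 1)"
    have c1: "0 < \<lceil>s / h n\<rceil>" using s h[of n] by simp
    then have k: "real k = of_int \<lceil>s / h n\<rceil> - 1" by (simp add: k_def)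
    have "real k < s / h n" "s / h n \<le> real k + 1" unfolding k by linarith+
    then have kh: "real k * h n < s" "s \<le> real (Suc k) * h n"
      using h[of n] by (simp_all add: field_simps)
    have kn: "k < Suc n"
    proof -
      have "real k * h n < real (Suc n) * h n" using kh(1) s(2) hn[of n] by simp
      then show ?thesis using h[of n] by (simp only: mult_less_cancel_right_pos of_nat_less_iff)
    qed
    have uniq: "s \<in> {real j * h n<..real (Suc j) * h n} \<longleftrightarrow> j = k" for j
    proof
      assume j: "s \<in> {real j * h n<..real (Suc j) * h n}"
      have "real j * h n < real (Suc k) * h n" "real k * h n < real (Suc j) * h n" using j kh by auto
      then have "j < Suc k" "k < Suc j" using h[of n] by (simp_all only: mult_less_cancel_right_pos of_nat_less_iff)
      then show "j = k" by simp
    qed (use kh in auto)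
    have "st n s = (\<Sum>j<Suc n. if j = k then f (real j * h n) else 0)"
      unfolding st_def by (intro sum.cong) (use uniq in \<open>auto simp: indicator_def\<close>)
    also have "\<dots> = f (real k * h n)" using kn by (simp add: sum.delta)
    finally have "st n s = f (real k * h n)" .
    then show ?thesis using kh h[of n] by (intro exI[of _ "real k * h n"]) (auto simp: algebra_simps)
  qed
  have st_out: "st n s = 0" if "\<not> (0 < s \<and> s \<le> t)" for s n
  proof -
    have "s \<notin> {real j * h n<..real (Suc j) * h n}" if "j < Suc n" for j
    proof -
      have "real (Suc j) * h n \<le> real (Suc n) * h n" using that h[of n] by (intro mult_right_mono) auto
      moreover have "0 \<le> real j * h n" using h[of n] by simp
      ultimately show ?thesis using hn[of n] \<open>\<not> (0 < s \<and> s \<le> t)\<close> by auto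
    qed
    then show ?thesis unfolding st_def by (intro sum.neutral) auto
  qed
  have lim: "(\<lambda>n. st n s) \<longlonglongrightarrow> indicator {0<..t} s *\<^sub>R A s" for s
  proof (cases "0 < s \<and> s \<le> t")
    case True
    then have "\<forall>n. \<exists>g. s - h n \<le> g \<and> g < s \<and> 0 \<le> g \<and> st n s = f g"
      using st_in by blast
    then obtain g where g: "\<And>n. s - h n \<le> g n" "\<And>n. g n < s" "\<And>n. st n s = f (g n)"
      by metis
    have "(\<lambda>n. t * inverse (real (Suc n))) \<longlonglongrightarrow> t * 0"
      by (intro tendsto_mult tendsto_const LIMSEQ_inverse_real_of_nat)
    then have h0: "h \<longlonglongrightarrow> 0" by (simp add: h_def[abs_def] divide_inverse)
    have "g \<longlonglongrightarrow> s"
    proof (rule tendsto_sandwich[OF _ _ _ tendsto_const])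
      show "(\<lambda>n. s - h n) \<longlonglongrightarrow> s" using tendsto_diff[OF tendsto_const h0, of s] by simp
    qed (use g in \<open>auto intro!: always_eventually less_imp_le\<close>)
    then have "filterlim g (at_left s) sequentially"
      using g(2) by (auto simp: filterlim_at less_le intro!: always_eventually)
    from filterlim_compose[OF A this] True show ?thesis by (simp add: g(3))
  qed (simp add: st_out)
  have bound: "norm (st n s) \<le> indicator {0<..t} s" for n s
  proof (cases "0 < s \<and> s \<le> t")
    case True
    then obtain g where "g < s" "0 \<le> g" "st n s = f g" using st_in by blast
    then show ?thesis using True f[of g] by simp
  qed (simp add: st_out)
  have ind_int: "integrable (interval_measure F) (indicator {0<..t} :: real \<Rightarrow> real)"
    using Ioc[of 0 t] t by (intro integrable_real_indicator) auto
  have meas: "(\<lambda>s. indicator {0<..t} s *\<^sub>R A s) \<in> borel_measurable (interval_measure F)"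
    by (rule borel_measurable_LIMSEQ_real[OF lim st_meas])
  show "set_integrable (interval_measure F) {0<..t} A"
    unfolding set_integrable_def
    by (rule integrable_dominated_convergence[OF meas st_meas ind_int AE_I2[OF lim] AE_I2[OF bound]])
  have "(\<lambda>n. LINT s|interval_measure F. st n s) \<longlonglongrightarrow> (LINT s|interval_measure F. indicator {0<..t} s *\<^sub>R A s)"
    by (rule integral_dominated_convergence[OF meas st_meas ind_int AE_I2[OF lim] AE_I2[OF bound]])
  then show "(\<lambda>n. \<Sum>j<Suc n. f (real j * (t / real (Suc n))) * (F (real (Suc j) * (t / real (Suc n))) - F (real j * (t / real (Suc n)))))
        \<longlonglongrightarrow> (LINT s:{0<..t}|interval_measure F. A s)"
    unfolding st_int h_def set_lebesgue_integral_def .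
qed


section \<open>Path properties\<close>

text \<open>Left limits give the integrand its meaning, monotonicity and right continuity make
  \<open>l\<close> a distribution function, and unboundedness makes the first jump time finite and
  drives \<open>n\<close> to infinity.\<close>

definition good_path :: "(real \<Rightarrow> real) \<Rightarrow> (real \<Rightarrow> real) \<Rightarrow> bool" where
  "good_path n l \<longleftrightarrow> n 0 = 0 \<and> l 0 = 0 \<and>
     (\<forall>s t. 0 \<le> s \<longrightarrow> s \<le> t \<longrightarrow> n s \<le> n t \<and> l s \<le> l t) \<and> (\<forall>t\<ge>0. n t \<in> \<nat>) \<and>
     (\<forall>t\<ge>0. (n \<longlongrightarrow> n t) (at_right t) \<and> (l \<longlongrightarrow> l t) (at_right t)) \<and>
     (\<forall>t>0. \<exists>x. (n \<longlongrightarrow> x) (at_left t)) \<and>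
     (\<forall>m::nat. \<exists>k::nat. real m < n (real k))"

lemma good_path_left_limit:
  assumes "good_path n l" "0 < t"
  shows "(n \<longlongrightarrow> Lim (at_left t) n) (at_left t)" "Lim (at_left t) n \<in> \<nat>"
proof -
  obtain x where x: "(n \<longlongrightarrow> x) (at_left t)" using assms by (auto simp: good_path_def)
  then have "Lim (at_left t) n = x" by (intro tendsto_Lim) auto
  with x show 1: "(n \<longlongrightarrow> Lim (at_left t) n) (at_left t)" by simp
  show "Lim (at_left t) n \<in> \<nat>"
  proof (rule Lim_in_closed_set[OF closed_Nats _ _ 1])
    show "\<forall>\<^sub>F s in at_left t. n s \<in> \<nat>"
      using eventually_at_left_real[OF assms(2)] by eventually_elim (use assms(1) in \<open>auto simp: good_path_def\<close>)
  qed simp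
qed

lemma good_path_extension:
  assumes "good_path n l"
  shows "s \<le> t \<Longrightarrow> l (max 0 s) \<le> l (max 0 t)" and "continuous (at_right t) (\<lambda>s. l (max 0 s))"
proof -
  show "s \<le> t \<Longrightarrow> l (max 0 s) \<le> l (max 0 t)" using assms by (auto simp: good_path_def max_def)
  show "continuous (at_right t) (\<lambda>s. l (max 0 s))"
  proof (cases "0 \<le> t")
    case True
    have "\<forall>\<^sub>F s in at_right t. l s = l (max 0 s)"
      using eventually_at_right_less[of t] by eventually_elim (use True in \<open>auto simp: max_def\<close>)
    moreover have "(l \<longlongrightarrow> l (max 0 t)) (at_right t)"
      using assms True by (auto simp: good_path_def max_def)
    ultimately show ?thesis
      unfolding continuous_within by (rule Lim_transform_eventually[rotated])
  next
    case False
    then have "\<forall>\<^sub>F s in at_right t. l (max 0 t) = l (max 0 s)"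
      using eventually_at_right_real[of t 0] by (auto elim!: eventually_mono simp: max_def)
    then show ?thesis
      unfolding continuous_within by (rule Lim_transform_eventually[OF tendsto_const])
  qed
qed

section \<open>Almost sure regularity of the sample paths\<close>

lemma emeasure_convolution_atMost_le:
  assumes "real_distribution \<sigma>" "real_distribution \<tau>" and \<tau>: "AE y in \<tau>. 0 \<le> y"
  shows "emeasure (\<sigma> \<star> \<tau>) {..m} \<le> emeasure \<sigma> {..m}"
proof -
  interpret \<sigma>: real_distribution \<sigma> by fact
  interpret \<tau>: real_distribution \<tau> by fact
  have "emeasure (\<sigma> \<star> \<tau>) {..m} = (\<integral>\<^sup>+x. \<integral>\<^sup>+y. indicator {..m} (x + y) \<partial>\<tau> \<partial>\<sigma>)"
    by (rule emeasure_convolution_nn_integral) (use assms in auto)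
  also have "\<dots> \<le> (\<integral>\<^sup>+x. \<integral>\<^sup>+y. indicator {..m} x \<partial>\<tau> \<partial>\<sigma>)"
  proof (rule nn_integral_mono, rule nn_integral_mono_AE)
    show "AE y in \<tau>. (indicator {..m} (x + y) :: ennreal) \<le> indicator {..m} x" for x
      using \<tau> by eventually_elim (auto simp: indicator_def)
  qed
  also have "\<dots> = emeasure \<sigma> {..m}"
    by (simp add: \<tau>.emeasure_space_1[simplified])
  finally show ?thesis .
qed

context cp_process
begin

lemma AE_increment_Nats:
  assumes "0 \<le> s" "s < t"
  shows "AE \<omega> in M. N t \<omega> - N s \<omega> \<in> \<nat> \<and> L t \<omega> - L s \<omega> \<in> \<nat>"
proof -
  define P where "P = (\<lambda>x :: real \<times> real. fst x \<in> \<nat> \<and> snd x \<in> \<nat>)"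
  have "\<nat> \<times> \<nat> \<in> sets (borel \<Otimes>\<^sub>M borel :: (real \<times> real) measure)"
    by (rule pair_measureI[OF Nats_in_borel Nats_in_borel])
  moreover have "{x \<in> space borel. P x} = \<nat> \<times> \<nat>" by (auto simp: P_def)
  ultimately have P: "{x \<in> space borel. P x} \<in> sets borel"
    unfolding borel_prod by (simp only:)
  have X: "X r \<in> borel_measurable M" if "0 \<le> r" for r using measurable_X[OF that] .
  have "AE \<omega> in M. P (X (t - s) \<omega>)"
    using AE_Nats_X[of "t - s"] assms by (simp add: P_def)
  then have "AE x in distr M borel (X (t - s)). P x"
    using X[of "t - s"] P assms by (subst AE_distr_iff) auto
  then have "AE x in distr M borel (\<lambda>\<omega>. X (s + (t - s)) \<omega> - X s \<omega>). P x"
    by (subst X_increment) (use assms in auto)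
  moreover have "(\<lambda>\<omega>. X (s + (t - s)) \<omega> - X s \<omega>) \<in> borel_measurable M"
    by (rule borel_measurable_diff) (use X assms in auto)
  ultimately have "AE \<omega> in M. P (X (s + (t - s)) \<omega> - X s \<omega>)"
    using P by (subst (asm) AE_distr_iff) auto
  then show ?thesis by (simp add: P_def)
qed

text \<open>By \<open>functional_law\<close>, \<open>N (real k)\<close> is distributed as a Poisson
  variable of mean \<open>u * k\<close> plus an independent nonnegative one. The probability that
  the Poisson part is at most \<open>m\<close> tends to 0 as \<open>k\<close> grows.\<close>

lemma AE_N_unbounded: "AE \<omega> in M. \<forall>m::nat. \<exists>k::nat. real m < N (real k) \<omega>"
  unfolding AE_all_countable
proof
  fix m :: nat
  have [measurable]: "N (real k) \<in> borel_measurable M" for k by (rule measurable_N) simp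
  define B where "B = {\<omega> \<in> space M. \<forall>k. N (real k) \<omega> \<le> real m}"
  have [measurable]: "B \<in> events" unfolding B_def by measurable
  have le: "prob B \<le> (\<Sum>i\<le>m. inverse (fact i) * ((u * real k) ^ i / exp (u * real k)))" if k: "0 < k" for k
  proof -
    have l: "0 < u * real k" "0 < v * real k" "0 < w * real k" using k pos by auto
    have sp: "AE x in scaled_poisson (v * real k) (real i). x \<in> \<nat>" "AE x in scaled_poisson (w * real k) (real i). x \<in> \<nat>" for i
      using AE_scaled_poisson_Nats l by auto
    have "AE x in (scaled_poisson (v * real k) (real 0) \<star> scaled_poisson (w * real k) (real 1)). x \<in> \<nat>"
      by (intro AE_convolution[OF _ _ Nats_in_borel sp]) auto
    then have nn: "AE x in (scaled_poisson (v * real k) 0 \<star> scaled_poisson (w * real k) 1). 0 \<le> x"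
      unfolding of_nat_0 of_nat_1 by eventually_elim (auto simp: Nats_def)
    have "emeasure M B \<le> emeasure M {\<omega> \<in> space M. N (real k) \<omega> \<le> real m}"
      by (intro emeasure_mono) (auto simp: B_def)
    also have "\<dots> = emeasure (distr M borel (\<lambda>\<omega>. 1 * N (real k) \<omega> + 0 * L (real k) \<omega>)) {..real m}"
      by (subst emeasure_distr) (auto intro!: arg_cong[where f = "emeasure M"])
    also have "\<dots> = emeasure (functional_law (real k) 1 0) {..real m}"
      using k by (subst distr_functional) auto
    also have "\<dots> \<le> emeasure (scaled_poisson (u * real k) 1) {..real m}"
      unfolding functional_law_def mult_zero_right add_0_right using nn
      by (intro emeasure_convolution_atMost_le) (auto intro: real_distribution_convolution)
    also have "\<dots> = emeasure (measure_pmf (poisson_pmf (u * real k))) {..m}"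
      using l by (auto simp: scaled_poisson_def emeasure_distr intro!: arg_cong[where f = "emeasure _"])
    also have "\<dots> = ennreal (\<Sum>i\<le>m. (u * real k) ^ i / fact i * exp (- (u * real k)))"
      using l by (simp add: measure_pmf.emeasure_eq_measure measure_measure_pmf_finite)
    finally have "prob B \<le> (\<Sum>i\<le>m. (u * real k) ^ i / fact i * exp (- (u * real k)))"
      using l by (subst (asm) emeasure_eq_measure, subst (asm) ennreal_le_iff) (auto intro!: sum_nonneg)
    then show ?thesis by (simp add: exp_minus divide_inverse mult_ac)
  qed
  have "filterlim (\<lambda>k. u * real k) at_top sequentially"
    using pos by (intro filterlim_tendsto_pos_mult_at_top[OF tendsto_const _ filterlim_real_sequentially]) auto
  from filterlim_compose[OF tendsto_power_div_exp_0 this]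
  have "(\<lambda>k. \<Sum>i\<le>m. inverse (fact i) * ((u * real k) ^ i / exp (u * real k))) \<longlonglongrightarrow> (\<Sum>i\<le>m. inverse (fact i) * 0)"
    by (intro tendsto_sum tendsto_mult tendsto_const)
  moreover have "\<forall>\<^sub>F k in sequentially. prob B \<le> (\<Sum>i\<le>m. inverse (fact i) * ((u * real k) ^ i / exp (u * real k)))"
    using eventually_gt_at_top[of 0] by eventually_elim (rule le)
  ultimately have "prob B \<le> (\<Sum>i\<le>m. inverse (fact i) * 0)"
    by (rule tendsto_lowerbound) simp
  then have "prob B = 0" using measure_nonneg[of M B] by simp
  then have "AE \<omega> in M. \<omega> \<notin> B" using prob_eq_0 by auto
  then show "AE \<omega> in M. \<exists>k. real m < N (real k) \<omega>"
    by (rule AE_mp) (auto intro!: AE_I2 simp: B_def not_le)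
qed

text \<open>Integrality of increments holds simultaneously for the countably many rational pairs.
  Right continuity carries monotonicity and integrality to all times, since \<nat> is
  closed.\<close>

lemma AE_good_path: "AE \<omega> in M. good_path (\<lambda>t. N t \<omega>) (\<lambda>t. L t \<omega>)"
proof -
  define Q where "Q = {(p :: real, q). p \<in> \<rat> \<and> q \<in> \<rat> \<and> 0 \<le> p \<and> p < q}"
  have "countable Q"
    by (rule countable_subset[of _ "\<rat> \<times> \<rat>"]) (auto simp: Q_def countable_rat)
  then have "AE \<omega> in M. \<forall>pq\<in>Q. N (snd pq) \<omega> - N (fst pq) \<omega> \<in> \<nat> \<and> L (snd pq) \<omega> - L (fst pq) \<omega> \<in> \<nat>"
    by (subst AE_ball_countable) (auto simp only: Q_def fst_conv snd_conv split_paired_all case_prod_conv mem_Collect_eq intro!: AE_increment_Nats)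
  moreover have "AE \<omega> in M. X 0 \<omega> = 0"
    using levy unfolding levy_process_def by blast
  moreover have "AE \<omega> in M. (\<forall>t\<ge>0. ((\<lambda>s. X s \<omega>) \<longlongrightarrow> X t \<omega>) (at_right t)) \<and> (\<forall>t>0. \<exists>l. ((\<lambda>s. X s \<omega>) \<longlongrightarrow> l) (at_left t))"
    using levy unfolding levy_process_def by blast
  ultimately show ?thesis using AE_N_unbounded
  proof eventually_elim
    case (elim \<omega>)
    have inc: "N q \<omega> - N p \<omega> \<in> \<nat>" "L q \<omega> - L p \<omega> \<in> \<nat>" if "p \<in> \<rat>" "q \<in> \<rat>" "0 \<le> p" "p < q" for p q
      using elim(1) that by (auto simp: Q_def)
    have zero: "N 0 \<omega> = 0" "L 0 \<omega> = 0" using elim(2) by (auto simp: zero_prod_def)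
    have rcN: "((\<lambda>s. N s \<omega>) \<longlongrightarrow> N t \<omega>) (at_right t)" and rcL: "((\<lambda>s. L s \<omega>) \<longlongrightarrow> L t \<omega>) (at_right t)" if "0 \<le> t" for t
    proof -
      have "((\<lambda>s. X s \<omega>) \<longlongrightarrow> X t \<omega>) (at_right t)"
        by (rule elim(3)[THEN conjunct1, rule_format, OF that])
      from tendsto_fst[OF this] tendsto_snd[OF this]
      show "((\<lambda>s. N s \<omega>) \<longlongrightarrow> N t \<omega>) (at_right t)" "((\<lambda>s. L s \<omega>) \<longlongrightarrow> L t \<omega>) (at_right t)" by simp_all
    qed
    \<comment> \<open>The least multiple of \<open>1 / Suc n\<close> strictly above
      \<open>t\<close>. It is rational, tends to \<open>t\<close> from the right, and is monotone in
      \<open>t\<close> for each \<open>n\<close>, so two times are approximated without losing their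
      order.\<close>
    define r :: "real \<Rightarrow> nat \<Rightarrow> real" where "r t n = (of_int \<lfloor>t * real (Suc n)\<rfloor> + 1) / real (Suc n)" for t n
    have r_gt: "t < r t n" and r_le: "r t n \<le> t + 1 / real (Suc n)" for t n
    proof -
      have "t * real (Suc n) < of_int \<lfloor>t * real (Suc n)\<rfloor> + 1" "of_int \<lfloor>t * real (Suc n)\<rfloor> \<le> t * real (Suc n)" by linarith+
      then show "t < r t n" "r t n \<le> t + 1 / real (Suc n)" unfolding r_def by (simp_all add: field_simps del: of_nat_Suc)
    qed
    have r_rat: "r t n \<in> \<rat>" for t n unfolding r_def by (intro Rats_divide Rats_add Rats_of_int Rats_of_nat Rats_1)
    have r_mono: "r s n \<le> r t n" if "s \<le> t" for s t n
      unfolding r_def using that by (intro divide_right_mono add_right_mono) (auto intro!: floor_mono mult_right_mono)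
    have r_lim: "filterlim (r t) (at_right t) sequentially" for t
    proof -
      have "r t \<longlonglongrightarrow> t"
      proof (rule tendsto_sandwich[OF _ _ tendsto_const])
        show "(\<lambda>n. t + 1 / real (Suc n)) \<longlonglongrightarrow> t"
          using tendsto_add[OF tendsto_const LIMSEQ_inverse_real_of_nat, of t] by (simp add: divide_inverse)
      qed (use r_gt r_le in \<open>auto intro!: always_eventually less_imp_le simp del: of_nat_Suc\<close>)
      then show ?thesis using r_gt by (auto simp: filterlim_at less_imp_neq[symmetric] intro!: always_eventually)
    qed
    have Nr: "(\<lambda>n. N (r t n) \<omega>) \<longlonglongrightarrow> N t \<omega>" and Lr: "(\<lambda>n. L (r t n) \<omega>) \<longlonglongrightarrow> L t \<omega>" if "0 \<le> t" for t
      using filterlim_compose[OF rcN[OF that] r_lim] filterlim_compose[OF rcL[OF that] r_lim] by auto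
    have Nats0: "0 \<le> x" if "x \<in> \<nat>" for x :: real using that by (auto simp: Nats_def)
    have mono: "N s \<omega> \<le> N t \<omega> \<and> L s \<omega> \<le> L t \<omega>" if "0 \<le> s" "s \<le> t" for s t
    proof -
      have "N (r s n) \<omega> \<le> N (r t n) \<omega> \<and> L (r s n) \<omega> \<le> L (r t n) \<omega>" for n
      proof (cases "r s n = r t n")
        case False
        then have "r s n < r t n" using r_mono[OF that(2), of n] by simp
        with Nats0[OF inc(1)[OF r_rat r_rat, of s n t n]] Nats0[OF inc(2)[OF r_rat r_rat, of s n t n]] r_gt[of s n] that(1)
        show ?thesis by auto
      qed simp
      then show ?thesis
        using that by (auto intro!: LIMSEQ_le[OF Nr Nr] LIMSEQ_le[OF Lr Lr])
    qed
    have nat: "N t \<omega> \<in> \<nat>" if "0 \<le> t" for t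
    proof (rule Lim_in_closed_set[OF closed_Nats _ _ Nr[OF that]])
      show "\<forall>\<^sub>F n in sequentially. N (r t n) \<omega> \<in> \<nat>"
      proof (rule always_eventually, rule allI)
        fix n
        have "0 < r t n" using r_gt[of t n] that by linarith
        from inc(1)[OF Rats_0 r_rat order_refl this] show "N (r t n) \<omega> \<in> \<nat>" by (simp add: zero)
      qed
    qed simp
    have "\<exists>x. ((\<lambda>s. N s \<omega>) \<longlongrightarrow> x) (at_left t)" if "0 < t" for t
    proof -
      obtain l where "((\<lambda>s. X s \<omega>) \<longlongrightarrow> l) (at_left t)"
        using elim(3)[THEN conjunct2, rule_format, OF \<open>0 < t\<close>] by (rule exE)
      from tendsto_fst[OF this] show ?thesis by auto
    qed
    then show ?case
      unfolding good_path_def by (intro conjI allI impI zero rcN rcL mono[THEN conjunct1] mono[THEN conjunct2] nat elim(4)[rule_format])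
  qed
qed

end


section \<open>The law of the integral\<close>

context cp_process
begin

definition path_integral :: "(real \<Rightarrow> real) \<Rightarrow> real \<Rightarrow> 'a \<Rightarrow> real" where
  "path_integral a t \<omega> =
     (LINT s:{0<..t}|interval_measure (\<lambda>s. L (max 0 s) \<omega>). a (Lim (at_left s) (\<lambda>r. N r \<omega>)))"

definition riemann_sum :: "(real \<Rightarrow> real) \<Rightarrow> real \<Rightarrow> nat \<Rightarrow> 'a \<Rightarrow> real" where
  "riemann_sum a t n \<omega> = (\<Sum>j<Suc n. a (N (real j * (t / real (Suc n))) \<omega> - N 0 \<omega>) *
     (L (real (Suc j) * (t / real (Suc n))) \<omega> - L (real j * (t / real (Suc n))) \<omega>))"

text \<open>Measurable by construction, as a limit of random variables; on good paths and for
  positive times it agrees with \<open>path_integral\<close>.\<close>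

definition integral_version :: "(real \<Rightarrow> real) \<Rightarrow> real \<Rightarrow> 'a \<Rightarrow> real" where
  "integral_version a t \<omega> = lim (\<lambda>n. riemann_sum a t n \<omega>)"

text \<open>Continuity at the naturals suffices for passing to left limits, since the left limits of
  \<open>N\<close> are naturals. This admits an indicator of an interval with endpoints off \<nat>
  as well as the exponential.\<close>

definition admissible :: "(real \<Rightarrow> real) \<Rightarrow> bool" where
  "admissible a \<longleftrightarrow> a \<in> borel_measurable borel \<and> (\<forall>x\<ge>0. 0 \<le> a x \<and> a x \<le> 1) \<and> (\<forall>x\<in>\<nat>. isCont a x)"

lemma measurable_riemann_sum:
  assumes "a \<in> borel_measurable borel" "0 \<le> t"
  shows "riemann_sum a t n \<in> borel_measurable M"
proof -
  note [measurable] = assms(1)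
  have m: "N (real j * (t / real (Suc n))) \<in> borel_measurable M" "L (real j * (t / real (Suc n))) \<in> borel_measurable M" for j
    using assms(2) by (intro measurable_N measurable_L mult_nonneg_nonneg; simp)+
  have [measurable]: "N 0 \<in> borel_measurable M" by (rule measurable_N) simp
  show ?thesis
    unfolding riemann_sum_def
    by (intro borel_measurable_sum borel_measurable_times borel_measurable_diff m measurable_compose[OF _ assms(1)]) auto
qed

lemma measurable_integral_version:
  assumes "a \<in> borel_measurable borel" "0 \<le> t"
  shows "integral_version a t \<in> borel_measurable M"
  unfolding integral_version_def[abs_def] by (intro borel_measurable_lim_metric measurable_riemann_sum assms)

lemma path_limits:
  assumes a: "admissible a" and good: "good_path (\<lambda>t. N t \<omega>) (\<lambda>t. L t \<omega>)" and t: "0 < t"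
  shows "(\<lambda>n. riemann_sum a t n \<omega>) \<longlonglongrightarrow> path_integral a t \<omega>"
    and "set_integrable (interval_measure (\<lambda>s. L (max 0 s) \<omega>)) {0<..t} (\<lambda>s. a (Lim (at_left s) (\<lambda>r. N r \<omega>)))"
    and "integral_version a t \<omega> = path_integral a t \<omega>"
proof -
  have N0: "N 0 \<omega> = 0" using good by (simp add: good_path_def)
  have mono: "L (max 0 x) \<omega> \<le> L (max 0 y) \<omega>" if "x \<le> y" for x y
    using good_path_extension(1)[OF good that] .
  have rc: "continuous (at_right x) (\<lambda>s. L (max 0 s) \<omega>)" for x
    using good_path_extension(2)[OF good] .
  have bound: "\<bar>a (N x \<omega>)\<bar> \<le> 1" if "0 \<le> x" for x
  proof -
    have "0 \<le> N x \<omega>" using good that N0 by (auto simp: good_path_def)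
    then show ?thesis using a by (simp add: admissible_def)
  qed
  have left: "((\<lambda>r. a (N r \<omega>)) \<longlongrightarrow> a (Lim (at_left s) (\<lambda>r. N r \<omega>))) (at_left s)" if "0 < s" for s
    using good_path_left_limit[OF good that] a by (auto simp: admissible_def intro: isCont_tendsto_compose)
  show "set_integrable (interval_measure (\<lambda>s. L (max 0 s) \<omega>)) {0<..t} (\<lambda>s. a (Lim (at_left s) (\<lambda>r. N r \<omega>)))"
    using riemann_stieltjes_integrable[of "\<lambda>s. L (max 0 s) \<omega>" t "\<lambda>r. a (N r \<omega>)" "\<lambda>s. a (Lim (at_left s) (\<lambda>r. N r \<omega>))"]
      mono rc t bound left by blast
  have pos: "max 0 (real j * (t / real (Suc n))) = real j * (t / real (Suc n))" for j n
    using t by (simp add: max_def)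
  show lim: "(\<lambda>n. riemann_sum a t n \<omega>) \<longlonglongrightarrow> path_integral a t \<omega>"
    using riemann_stieltjes_limit[of "\<lambda>s. L (max 0 s) \<omega>" t "\<lambda>r. a (N r \<omega>)" "\<lambda>s. a (Lim (at_left s) (\<lambda>r. N r \<omega>))", unfolded pos]
      mono rc t bound left unfolding riemann_sum_def path_integral_def N0 diff_zero by blast
  show "integral_version a t \<omega> = path_integral a t \<omega>"
    unfolding integral_version_def by (rule limI[OF lim])
qed

lemma path_integral_mono:
  assumes a: "admissible a" and good: "good_path (\<lambda>t. N t \<omega>) (\<lambda>t. L t \<omega>)"
  shows "mono (\<lambda>t. path_integral a t \<omega>)"
proof (rule monoI)
  fix s t :: real assume st: "s \<le> t"
  let ?\<nu> = "interval_measure (\<lambda>s. L (max 0 s) \<omega>)"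
  define g where "g = (\<lambda>s. a (Lim (at_left s) (\<lambda>r. N r \<omega>)))"
  have g0: "0 \<le> g r" if "0 < r" for r
    using good_path_left_limit(2)[OF good that] a by (auto simp: g_def admissible_def Nats_def)
  have int: "integrable ?\<nu> (\<lambda>r. indicator {0<..t} r *\<^sub>R g r)" if "0 < t" for t
    using path_limits(2)[OF a good that] by (simp add: g_def set_integrable_def)
  have nonneg: "0 \<le> path_integral a t \<omega>" for t
    unfolding path_integral_def set_lebesgue_integral_def
    by (rule integral_nonneg_AE) (auto simp: indicator_def g0[unfolded g_def])
  show "path_integral a s \<omega> \<le> path_integral a t \<omega>"
  proof (cases "0 < s")
    case True
    have "(LINT r|?\<nu>. indicator {0<..s} r *\<^sub>R g r) \<le> (LINT r|?\<nu>. indicator {0<..t} r *\<^sub>R g r)"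
      by (rule integral_mono[OF int int]) (use True st g0 in \<open>auto simp: indicator_def\<close>)
    then show ?thesis by (simp add: path_integral_def set_lebesgue_integral_def g_def)
  next
    case False
    then have "path_integral a s \<omega> = 0" by (simp add: path_integral_def set_lebesgue_integral_def)
    then show ?thesis using nonneg[of t] by simp
  qed
qed

text \<open>With mesh \<open>t / Suc n\<close> the total error of \<open>grid_chain\<close> is of
  order \<open>1 / Suc n\<close>, while on good paths the Riemann sums converge to the
  integral.\<close>

lemma integral_version_char:
  fixes a :: "real \<Rightarrow> real" and \<psi> :: "real \<Rightarrow> complex"
  assumes a: "admissible a"
    and \<psi>[measurable]: "\<psi> \<in> borel_measurable borel" and \<psi>1: "\<And>x. norm (\<psi> x) \<le> 1"
    and rec: "\<And>x. of_real rate * \<psi> x = of_real u * \<psi> (x + 1) + of_real v * (iexp (z * a x) * \<psi> x)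
        + of_real w * (iexp (2 * z * a x) * \<psi> (x + 1))"
    and t: "0 < t"
  shows "(CLINT \<omega>|M. iexp (z * integral_version a t \<omega>) * \<psi> (N t \<omega>)) = \<psi> 0"
proof -
  have am: "a \<in> borel_measurable borel" using a by (simp add: admissible_def)
  have t0: "0 \<le> t" using t by simp
  note [measurable] = measurable_riemann_sum[OF am t0] measurable_integral_version[OF am t0] measurable_N[OF t0] measurable_N[OF order_refl]
  define E where "E n = (CLINT \<omega>|M. iexp (z * riemann_sum a t n \<omega>) * \<psi> (N t \<omega> - N 0 \<omega>))" for n
  have "E \<longlonglongrightarrow> (CLINT \<omega>|M. iexp (z * integral_version a t \<omega>) * \<psi> (N t \<omega>))"
    unfolding E_def
  proof (rule integral_dominated_convergence[where w = "\<lambda>_. 1"])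
    show "AE \<omega> in M. (\<lambda>n. iexp (z * riemann_sum a t n \<omega>) * \<psi> (N t \<omega> - N 0 \<omega>)) \<longlonglongrightarrow> iexp (z * integral_version a t \<omega>) * \<psi> (N t \<omega>)"
      using AE_good_path
    proof eventually_elim
      case (elim \<omega>)
      have "N 0 \<omega> = 0" using elim by (simp add: good_path_def)
      then show ?case
        unfolding path_limits(3)[OF a elim t] by (intro tendsto_intros path_limits(1)[OF a elim t]) (simp add: tendsto_const)
    qed
  qed (auto simp: norm_mult \<psi>1 simp del: of_real_mult)
  moreover have "E \<longlonglongrightarrow> \<psi> 0"
  proof (rule LIM_zero_cancel, rule Lim_null_comparison)
    have lim: "(\<lambda>n. 1 / real (Suc n)) \<longlonglongrightarrow> 0" using LIMSEQ_inverse_real_of_nat by (simp add: divide_inverse)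
    have "(\<lambda>n. 2 * (rate * t)\<^sup>2 * (1 / real (Suc n))) \<longlonglongrightarrow> 2 * (rate * t)\<^sup>2 * 0"
      by (intro tendsto_mult tendsto_const lim)
    then show "(\<lambda>n. 2 * (rate * t)\<^sup>2 * (1 / real (Suc n))) \<longlonglongrightarrow> 0" by simp
    have "(\<lambda>n. rate * t * (1 / real (Suc n))) \<longlonglongrightarrow> rate * t * 0" by (intro tendsto_mult tendsto_const lim)
    then have "\<forall>\<^sub>F n in sequentially. rate * t * (1 / real (Suc n)) < 1"
      by (rule order_tendstoD) simp
    then show "\<forall>\<^sub>F n in sequentially. norm (E n - \<psi> 0) \<le> 2 * (rate * t)\<^sup>2 * (1 / real (Suc n))"
    proof eventually_elim
      case (elim n)
      have h: "0 < t / real (Suc n)" "rate * (t / real (Suc n)) \<le> 1" using t elim by (auto simp del: of_nat_Suc)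
      have "real (Suc n) * (t / real (Suc n)) = t" by simp
      with grid_chain[OF h am \<psi> \<psi>1 rec, of "Suc n"]
      have "norm (E n - \<psi> 0) \<le> real (Suc n) * (2 * (rate * (t / real (Suc n)))\<^sup>2)"
        unfolding E_def riemann_sum_def by simp
      also have "\<dots> = 2 * (rate * t)\<^sup>2 * (1 / real (Suc n))"
        by (simp add: power2_eq_square divide_simps del: of_nat_Suc)
      finally show ?case .
    qed
  qed
  ultimately show ?thesis by (rule LIMSEQ_unique)
qed

text \<open>Almost sure finiteness of the limit comes from the weak convergence of the monotone integrals to a
  probability measure; no moments are needed.\<close>

lemma path_integral_law:
  fixes a :: "real \<Rightarrow> real" and \<psi> :: "real \<Rightarrow> real \<Rightarrow> complex"
  assumes a: "admissible a" and \<sigma>: "real_distribution \<sigma>"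
    and \<psi>[measurable]: "\<And>z. \<psi> z \<in> borel_measurable borel" and \<psi>1: "\<And>z x. norm (\<psi> z x) \<le> 1"
    and rec: "\<And>z x. of_real rate * \<psi> z x = of_real u * \<psi> z (x + 1) + of_real v * (iexp (z * a x) * \<psi> z x)
        + of_real w * (iexp (2 * z * a x) * \<psi> z (x + 1))"
    and \<psi>_lim: "\<And>z. (\<psi> z \<longlongrightarrow> 1) at_top" and \<psi>_0: "\<And>z. \<psi> z 0 = char \<sigma> z"
  shows "\<exists>Y\<in>borel_measurable M. (AE \<omega> in M. ((\<lambda>t. path_integral a t \<omega>) \<longlongrightarrow> Y \<omega>) at_top) \<and> distr M borel Y = \<sigma>"
proof -
  interpret \<sigma>: real_distribution \<sigma> by fact
  have am: "a \<in> borel_measurable borel" using a by (simp add: admissible_def)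
  \<comment> \<open>Sampling at \<open>Suc k\<close> keeps the time positive, as
    \<open>integral_version_char\<close> requires; monotonicity in \<open>t\<close> later extends
    convergence to all real times.\<close>
  define I where "I k = integral_version a (real (Suc k))" for k
  have I[measurable]: "I k \<in> borel_measurable M" for k
    unfolding I_def by (intro measurable_integral_version am) simp
  have N[measurable]: "N (real k) \<in> borel_measurable M" for k by (rule measurable_N) simp
  have I_eq: "AE \<omega> in M. \<forall>k. I k \<omega> = path_integral a (real (Suc k)) \<omega>"
    using AE_good_path by eventually_elim (simp add: I_def path_limits(3)[OF a])
  then have I_mono: "AE \<omega> in M. mono (\<lambda>k. I k \<omega>)"
    using AE_good_path
    by eventually_elim (auto simp: mono_def intro!: path_integral_mono[OF a, THEN monoD] simp del: of_nat_Suc)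
  have N_top: "AE \<omega> in M. filterlim (\<lambda>k. N (real (Suc k)) \<omega>) at_top sequentially"
    using AE_good_path
  proof eventually_elim
    case (elim \<omega>)
    show ?case
      unfolding filterlim_at_top
    proof
      fix Z :: real
      obtain m :: nat where "Z \<le> real m" using real_arch_simple by blast
      moreover obtain k :: nat where "real m < N (real k) \<omega>"
        using elim unfolding good_path_def by blast
      moreover have "N (real k) \<omega> \<le> N (real (Suc j)) \<omega>" if "k \<le> j" for j
        using elim that by (auto simp: good_path_def)
      ultimately have "Z \<le> N (real (Suc j)) \<omega>" if "k \<le> j" for j using that by (meson le_less_trans less_imp_le order.trans)
      then show "\<forall>\<^sub>F j in sequentially. Z \<le> N (real (Suc j)) \<omega>" by (auto simp: eventually_sequentially)
    qed
  qed
  \<comment> \<open>\<open>N\<close> tends to infinity and \<open>\<psi> z\<close> to 1, so dropping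
    the factor \<open>\<psi>\<close> from the exact identity costs a vanishing error.\<close>
  have I_char: "(\<lambda>k. char (distr M borel (I k)) z) \<longlonglongrightarrow> char \<sigma> z" for z
  proof (rule LIM_zero_cancel, rule Lim_null_comparison)
    have "(\<lambda>k. LINT \<omega>|M. norm (1 - \<psi> z (N (real (Suc k)) \<omega>))) \<longlonglongrightarrow> (LINT \<omega>|M. norm (1 - 1 :: complex))"
    proof (rule integral_dominated_convergence[where w = "\<lambda>_. 2"])
      show "AE \<omega> in M. (\<lambda>k. norm (1 - \<psi> z (N (real (Suc k)) \<omega>))) \<longlonglongrightarrow> norm (1 - 1 :: complex)"
        using N_top by eventually_elim (intro tendsto_intros filterlim_compose[OF \<psi>_lim])
      show "AE \<omega> in M. norm (norm (1 - \<psi> z (N (real (Suc k)) \<omega>))) \<le> 2" for k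
        using norm_triangle_ineq4[of 1 "\<psi> z (N (real (Suc k)) \<omega>)" for \<omega>] \<psi>1[of z]
        by (intro AE_I2) (simp add: order.trans[OF norm_triangle_ineq4])
    qed (auto simp del: of_nat_Suc)
    then show "(\<lambda>k. LINT \<omega>|M. norm (1 - \<psi> z (N (real (Suc k)) \<omega>))) \<longlonglongrightarrow> 0" by simp
    show "\<forall>\<^sub>F k in sequentially. norm (char (distr M borel (I k)) z - char \<sigma> z) \<le> (LINT \<omega>|M. norm (1 - \<psi> z (N (real (Suc k)) \<omega>)))"
    proof (intro always_eventually allI)
      fix k
      have "(CLINT \<omega>|M. iexp (z * I k \<omega>) * \<psi> z (N (real (Suc k)) \<omega>)) = char \<sigma> z"
        unfolding I_def \<psi>_0[symmetric] by (rule integral_version_char[OF a \<psi> \<psi>1 rec]) simp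
      then have "char (distr M borel (I k)) z - char \<sigma> z = (CLINT \<omega>|M. iexp (z * I k \<omega>)) - (CLINT \<omega>|M. iexp (z * I k \<omega>) * \<psi> z (N (real (Suc k)) \<omega>))"
        by (simp add: char_def integral_distr)
      also have "\<dots> = (CLINT \<omega>|M. iexp (z * I k \<omega>) - iexp (z * I k \<omega>) * \<psi> z (N (real (Suc k)) \<omega>))"
        by (rule Bochner_Integration.integral_diff[symmetric])
           (auto intro!: integrable_const_bound[where B = 1] simp: norm_mult \<psi>1 simp del: of_real_mult of_nat_Suc)
      also have "norm \<dots> \<le> (LINT \<omega>|M. norm (iexp (z * I k \<omega>) - iexp (z * I k \<omega>) * \<psi> z (N (real (Suc k)) \<omega>)))"
        by (rule integral_norm_bound)
      also have "(\<lambda>\<omega>. norm (iexp (z * I k \<omega>) - iexp (z * I k \<omega>) * \<psi> z (N (real (Suc k)) \<omega>))) = (\<lambda>\<omega>. norm (1 - \<psi> z (N (real (Suc k)) \<omega>)))"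
      proof
        fix \<omega>
        have "iexp (z * I k \<omega>) - iexp (z * I k \<omega>) * \<psi> z (N (real (Suc k)) \<omega>) = iexp (z * I k \<omega>) * (1 - \<psi> z (N (real (Suc k)) \<omega>))"
          by (simp add: algebra_simps)
        then show "norm (iexp (z * I k \<omega>) - iexp (z * I k \<omega>) * \<psi> z (N (real (Suc k)) \<omega>)) = norm (1 - \<psi> z (N (real (Suc k)) \<omega>))"
          by (simp only: norm_mult norm_exp_i_times mult_1)
      qed
      finally show "norm (char (distr M borel (I k)) z - char \<sigma> z) \<le> (LINT \<omega>|M. norm (1 - \<psi> z (N (real (Suc k)) \<omega>)))" .
    qed
  qed
  have weak: "weak_conv_m (\<lambda>k. distr M borel (I k)) \<sigma>"
    by (rule levy_continuity[OF _ \<sigma> I_char]) simp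
  \<comment> \<open>As the \<open>I k\<close> increase almost surely, weak convergence gives the
    probability that some \<open>I k\<close> exceeds \<open>x\<close> at each continuity point
    \<open>x\<close>. Such points are arbitrarily large, since atoms are countable, and the
    probability tends to 0 because \<open>\<sigma>\<close> has total mass 1.\<close>
  define B where "B x = {\<omega> \<in> space M. \<exists>k. x < I k \<omega>}" for x :: real
  have [measurable]: "B x \<in> events" for x unfolding B_def by measurable
  have prob_B: "prob (B x) = 1 - cdf \<sigma> x" if "isCont (cdf \<sigma>) x" for x
  proof -
    define A where "A k = {\<omega> \<in> space M. \<exists>i\<le>k. x < I i \<omega>}" for k
    have [measurable]: "A k \<in> events" for k unfolding A_def by measurable
    have "incseq A" by (auto simp: incseq_def A_def) (meson order.trans)
    then have "(\<lambda>k. prob (A k)) \<longlonglongrightarrow> prob (\<Union>k. A k)"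
      by (intro finite_Lim_measure_incseq) auto
    moreover have "(\<Union>k. A k) = B x" by (auto simp: A_def B_def)
    moreover have "prob (A k) = 1 - cdf (distr M borel (I k)) x" for k
    proof -
      have "prob (A k) = prob {\<omega> \<in> space M. x < I k \<omega>}"
      proof (rule measure_eq_AE)
        show "AE \<omega> in M. (\<omega> \<in> A k) = (\<omega> \<in> {\<omega> \<in> space M. x < I k \<omega>})"
          using I_mono by eventually_elim (auto simp: A_def mono_def intro: less_le_trans)
      qed measurable
      also have "\<dots> = prob (space M - {\<omega> \<in> space M. I k \<omega> \<le> x})"
        by (intro arg_cong[where f = prob]) auto
      also have "\<dots> = 1 - prob {\<omega> \<in> space M. I k \<omega> \<le> x}"
        by (rule prob_compl) measurable
      also have "prob {\<omega> \<in> space M. I k \<omega> \<le> x} = cdf (distr M borel (I k)) x"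
        by (auto simp: cdf_def measure_distr intro!: arg_cong[where f = prob])
      finally show ?thesis .
    qed
    moreover have "(\<lambda>k. 1 - cdf (distr M borel (I k)) x) \<longlonglongrightarrow> 1 - cdf \<sigma> x"
      using weak that by (intro tendsto_intros) (auto simp: weak_conv_m_def weak_conv_def)
    ultimately show ?thesis by (auto intro: LIMSEQ_unique)
  qed
  have "\<exists>x\<ge>real n. isCont (cdf \<sigma>) x" for n
    using open_minus_countable[OF \<sigma>.countable_atoms, of "{real n<..}"] \<sigma>.isCont_cdf
    by (auto simp: less_le intro!: less_imp_le)
  then obtain x where x: "\<And>n::nat. real n \<le> x n" "\<And>n. isCont (cdf \<sigma>) (x n)" by metis
  have "filterlim x at_top sequentially"
    by (rule filterlim_at_top_mono[OF filterlim_real_sequentially]) (auto intro: always_eventually x)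
  from filterlim_compose[OF \<sigma>.cdf_lim_at_top_prob this]
  have "(\<lambda>n. 1 - cdf \<sigma> (x n)) \<longlonglongrightarrow> 1 - 1" by (intro tendsto_intros)
  moreover have "prob (\<Inter>n. B (x n)) \<le> 1 - cdf \<sigma> (x n)" for n
    unfolding prob_B[OF x(2), symmetric] by (intro finite_measure_mono) auto
  ultimately have "prob (\<Inter>n. B (x n)) \<le> 0"
    by (intro LIMSEQ_le_const[of "\<lambda>n. 1 - cdf \<sigma> (x n)"]) auto
  then have "prob (\<Inter>n. B (x n)) = 0" using measure_nonneg[of M "\<Inter>n. B (x n)"] by linarith
  then have "AE \<omega> in M. \<omega> \<notin> (\<Inter>n. B (x n))" by (subst (asm) prob_eq_0) auto
  then have bounded: "AE \<omega> in M. \<exists>c. \<forall>k. I k \<omega> \<le> c"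
    by (rule AE_mp) (auto intro!: AE_I2 simp: B_def not_less)
  define Y where "Y \<omega> = lim (\<lambda>k. I k \<omega>)" for \<omega>
  have [measurable]: "Y \<in> borel_measurable M" unfolding Y_def[abs_def] by measurable
  have I_lim: "AE \<omega> in M. (\<lambda>k. I k \<omega>) \<longlonglongrightarrow> Y \<omega>"
    using I_mono bounded
  proof eventually_elim
    case (elim \<omega>)
    then obtain c where c: "\<And>k. I k \<omega> \<le> c" by blast
    obtain l where "(\<lambda>k. I k \<omega>) \<longlonglongrightarrow> l"
      by (rule incseq_convergent[of "\<lambda>k. I k \<omega>" c]) (use elim c in auto)
    then show ?case unfolding Y_def by (simp add: limI)
  qed
  have "AE \<omega> in M. ((\<lambda>t. path_integral a t \<omega>) \<longlongrightarrow> Y \<omega>) at_top"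
    using I_lim I_eq AE_good_path
  proof eventually_elim
    case (elim \<omega>)
    show ?case
    proof (rule tendsto_at_topI_sequentially_real)
      show "mono (\<lambda>t. path_integral a t \<omega>)" by (rule path_integral_mono[OF a elim(3)])
      show "(\<lambda>n. path_integral a (real n) \<omega>) \<longlonglongrightarrow> Y \<omega>"
        using elim(1,2) by (subst filterlim_sequentially_Suc[symmetric]) simp
    qed
  qed
  moreover have "distr M borel Y = \<sigma>"
  proof (rule Levy_uniqueness)
    show "char (distr M borel Y) = char \<sigma>"
    proof
      fix z
      have "(\<lambda>k. CLINT \<omega>|M. iexp (z * I k \<omega>)) \<longlonglongrightarrow> (CLINT \<omega>|M. iexp (z * Y \<omega>))"
      proof (rule integral_dominated_convergence[where w = "\<lambda>_. 1"])
        show "AE \<omega> in M. (\<lambda>k. iexp (z * I k \<omega>)) \<longlonglongrightarrow> iexp (z * Y \<omega>)"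
          using I_lim by eventually_elim (intro tendsto_intros)
      qed auto
      then have "(\<lambda>k. char (distr M borel (I k)) z) \<longlonglongrightarrow> char (distr M borel Y) z"
        by (simp add: char_def integral_distr)
      then show "char (distr M borel Y) z = char \<sigma> z" using I_char by (rule LIMSEQ_unique)
    qed
  qed (use \<sigma> in simp_all)
  ultimately show ?thesis by (intro bexI[of _ Y]) auto
qed

end


section \<open>The two laws\<close>

text \<open>A nondecreasing path in the naturals can leave 0 only by a discontinuity. The infimum
  \<open>T'\<close> of the times with \<open>1 \<le> n t\<close> is attained by right continuity,
  and it is the first discontinuity.\<close>

lemma good_path_first_jump:
  assumes good: "good_path n l"
  defines "T \<equiv> Inf {t. 0 < t \<and> \<not> isCont n t}"
  shows "0 < T" and "\<And>s. 0 < s \<Longrightarrow> s \<le> T \<Longrightarrow> Lim (at_left s) n = 0"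
    and "\<And>s. T < s \<Longrightarrow> 1 \<le> Lim (at_left s) n"
proof -
  have n0: "n 0 = 0" and mono: "\<And>s t. 0 \<le> s \<Longrightarrow> s \<le> t \<Longrightarrow> n s \<le> n t" and nat: "\<And>t. 0 \<le> t \<Longrightarrow> n t \<in> \<nat>"
    and rc: "\<And>t. 0 \<le> t \<Longrightarrow> (n \<longlongrightarrow> n t) (at_right t)"
    using good unfolding good_path_def by blast+
  obtain k :: nat where "real 0 < n (real k)" using good unfolding good_path_def by blast
  then have k: "1 \<le> n (real k)" using nat[of "real k"] by (auto simp: Nats_def)
  define S where "S = {t. 0 \<le> t \<and> 1 \<le> n t}"
  define T' where "T' = Inf S"
  have "real k \<in> S" using k by (simp add: S_def)
  then have S: "S \<noteq> {}" by blast
  have "bdd_below S" by (rule bdd_belowI[of _ 0]) (simp add: S_def)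
  note S = S this
  have T'0: "0 \<le> T'" unfolding T'_def by (rule cInf_greatest[OF S(1)]) (simp add: S_def)
  have "1 \<le> n T'"
  proof (rule ccontr)
    assume "\<not> 1 \<le> n T'"
    then have "\<forall>\<^sub>F t in at_right T'. n t < 1"
      using rc[OF T'0] by (intro order_tendstoD) auto
    then obtain b where b: "T' < b" "\<And>t. T' < t \<Longrightarrow> t < b \<Longrightarrow> n t < 1"
      by (auto simp: eventually_at_right[OF lt_ex[THEN someI_ex]] eventually_at_right_field)
    have "b \<le> T'" unfolding T'_def
    proof (rule cInf_greatest[OF S(1)])
      fix t assume t: "t \<in> S"
      then have "T' \<le> t" unfolding T'_def by (rule cInf_lower[OF _ S(2)])
      moreover have "t \<noteq> T'" using t \<open>\<not> 1 \<le> n T'\<close> by (auto simp: S_def)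
      ultimately show "b \<le> t" using b(2)[of t] t by (auto simp: S_def not_less[symmetric])
    qed
    then show False using b(1) by simp
  qed
  then have T'_pos: "0 < T'" using n0 T'0 by (cases "T' = 0") auto
  have before: "n t = 0" if "0 \<le> t" "t < T'" for t
  proof -
    have "t \<notin> S" using that cInf_lower[OF _ S(2), of t] by (auto simp: T'_def)
    then have "n t < 1" using that by (auto simp: S_def)
    then show ?thesis using nat[OF that(1)] by (auto simp: Nats_def)
  qed
  have after: "1 \<le> n t" if "T' \<le> t" for t using mono[OF T'0 that] \<open>1 \<le> n T'\<close> by simp
  have left0: "(n \<longlongrightarrow> 0) (at_left s)" if "0 < s" "s \<le> T'" for s
  proof (rule tendsto_eventually)
    show "\<forall>\<^sub>F t in at_left s. n t = 0"
      using eventually_at_left_real[OF that(1)] by eventually_elim (use that before in auto)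
  qed
  have "T = T'"
    unfolding T_def
  proof (rule cInf_eq_minimum)
    have "\<not> isCont n T'"
    proof
      assume "isCont n T'"
      then have "(n \<longlongrightarrow> n T') (at_left T')" by (simp add: isCont_def filterlim_at_split)
      then have "n T' = 0" using left0[OF T'_pos order_refl] by (intro tendsto_unique) auto
      then show False using \<open>1 \<le> n T'\<close> by simp
    qed
    then show "T' \<in> {t. 0 < t \<and> \<not> isCont n t}" using T'_pos by simp
    fix t assume t: "t \<in> {t. 0 < t \<and> \<not> isCont n t}"
    show "T' \<le> t"
    proof (rule ccontr)
      assume "\<not> T' \<le> t"
      then have "\<forall>\<^sub>F r in nhds t. n r = 0"
        using t eventually_nhds_in_open[of "{0<..<T'}" t] before by (auto elim!: eventually_mono)
      then have "isCont n t"
        by (subst isCont_cong[where g = "\<lambda>_. 0"]) auto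
      then show False using t by simp
    qed
  qed
  show "0 < T" using \<open>T = T'\<close> T'_pos by simp
  show "Lim (at_left s) n = 0" if "0 < s" "s \<le> T" for s
    using left0[of s] that \<open>T = T'\<close> by (intro tendsto_Lim) auto
  show "1 \<le> Lim (at_left s) n" if "T < s" for s
  proof (rule tendsto_lowerbound)
    have "0 < s" using that \<open>T = T'\<close> T'_pos by simp
    then show "(n \<longlongrightarrow> Lim (at_left s) n) (at_left s)" by (rule good_path_left_limit(1)[OF good])
    show "\<forall>\<^sub>F r in at_left s. 1 \<le> n r"
      using eventually_at_left_real[OF that] by eventually_elim (use after \<open>T = T'\<close> in auto)
  qed simp
qed

text \<open>The left limit of \<open>N\<close> is still 0 at the first jump time itself, so the
  integrand equals 1 up to and including that time and 0 afterwards. A simultaneous jump of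
  \<open>L\<close> is therefore counted.\<close>

lemma (in cp_process) path_integral_indicator:
  assumes good: "good_path (\<lambda>t. N t \<omega>) (\<lambda>t. L t \<omega>)" and t: "first_jump_time N \<omega> \<le> t"
  shows "path_integral (indicator {-1/2..<1/2}) t \<omega> = L (first_jump_time N \<omega>) \<omega>"
proof -
  define T where "T = first_jump_time N \<omega>"
  note J = good_path_first_jump[OF good, folded first_jump_time_def, folded T_def]
  have eq: "indicator {0<..t} s *\<^sub>R (indicator {-1/2..<1/2} (Lim (at_left s) (\<lambda>r. N r \<omega>)) :: real) = indicator {0<..T} s" for s
    using J(2)[of s] J(3)[of s] t by (cases "s \<le> T") (auto simp: indicator_def T_def[symmetric])
  have "path_integral (indicator {-1/2..<1/2}) t \<omega> = measure (interval_measure (\<lambda>s. L (max 0 s) \<omega>)) {0<..T}"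
    unfolding path_integral_def set_lebesgue_integral_def eq by simp
  also have "\<dots> = L (max 0 T) \<omega> - L (max 0 0) \<omega>"
    using J(1) good_path_extension[OF good] by (intro measure_interval_measure_Ioc) auto
  also have "\<dots> = L T \<omega>" using J(1) good by (simp add: good_path_def)
  finally show ?thesis by (simp add: T_def)
qed

locale cp_process_special = cp_process +
  assumes ratio: "u = 2 / 9 * (u + v + w)" "v = 7 / 10 * (u + v + w)" "w = 7 / 90 * (u + v + w)"
begin

text \<open>This supplies \<open>rec\<close>, with \<open>x\<close> and \<open>x'\<close> for the
  values of \<open>\<psi>\<close> at two successive levels. With \<open>W = iexp y\<close> it is (1
  - q W) x = (p + r W^2) x', multiplied by the total rate.\<close>

lemma rho_recursion:
  assumes "x = rho_char (iexp y) * x'"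
  shows "of_real rate * x = of_real u * x' + of_real v * (iexp y * x) + of_real w * (iexp (2 * y) * x')"
proof -
  define W where "W = iexp y"
  have W2: "iexp (2 * y) = W\<^sup>2"
    by (simp add: W_def power2_eq_square exp_add[symmetric] mult.left_commute)
  have nz: "1 - 7 / 10 * W \<noteq> 0"
  proof
    assume "1 - 7 / 10 * W = 0"
    then have "norm (7 / 10 * W) = 1" by (metis eq_iff_diff_eq_0 norm_one)
    then show False by (simp add: norm_mult W_def)
  qed
  have r: "2 / 9 * rate = u" "7 / 10 * rate = v" "7 / 90 * rate = w"
    by (simp_all only: rate_def ratio[symmetric])
  have "(1 - 7 / 10 * W) * x = (2 / 9 + 7 / 90 * W\<^sup>2) * x'"
    using nz unfolding assms rho_char_def W_def[symmetric] by simp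
  then have "of_real rate * x = of_real rate * (2 / 9 * x' + 7 / 10 * (W * x) + 7 / 90 * (W\<^sup>2 * x'))"
    by (simp add: algebra_simps)
  also have "\<dots> = of_real (2 / 9 * rate) * x' + of_real (7 / 10 * rate) * (W * x) + of_real (7 / 90 * rate) * (W\<^sup>2 * x')"
    by (simp add: algebra_simps)
  finally show ?thesis
    unfolding W2 W_def[symmetric] r .
qed

lemma rho_law_rho: "rho_law M N L rho"
proof -
  \<comment> \<open>The recursion must hold at every real \<open>x\<close>, not only at naturals. A
    half-open window of length 1 achieves this: if \<open>a x = 1\<close> then
    \<open>x < 1/2 \<le> x + 1\<close>, and if \<open>a x = 0\<close> then \<open>\<psi> z\<close>
    agrees at \<open>x\<close> and \<open>x + 1\<close>. The endpoints avoid \<nat>, as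
    \<open>admissible\<close> demands.\<close>
  define \<psi> where "\<psi> z x = (if x < 1 / 2 then rho_char (iexp z) else 1)" for z x :: real
  define a :: "real \<Rightarrow> real" where "a = indicator {-1/2..<1/2}"
  have rho1: "rho_char 1 = 1" by (simp add: rho_char_def)
  have "admissible a"
    unfolding admissible_def
  proof (intro conjI ballI)
    fix x :: real assume "x \<in> \<nat>"
    then obtain m where m: "x = real m" by (auto elim: Nats_cases)
    show "isCont a x"
    proof (cases "m = 0")
      case True
      then have "\<forall>\<^sub>F y in nhds x. a y = 1"
        using m eventually_nhds_in_open[of "{-1/2<..<1/2}" x] by (auto simp: a_def elim!: eventually_mono)
      then show ?thesis by (subst isCont_cong[where g = "\<lambda>_. 1"]) auto
    next
      case False
      then have "\<forall>\<^sub>F y in nhds x. a y = 0"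
        using m eventually_nhds_in_open[of "{1/2<..}" x] by (auto simp: a_def elim!: eventually_mono)
      then show ?thesis by (subst isCont_cong[where g = "\<lambda>_. 0"]) auto
    qed
  qed (auto simp: a_def indicator_def)
  moreover have "\<psi> z \<in> borel_measurable borel" for z unfolding \<psi>_def by measurable
  moreover have "norm (\<psi> z x) \<le> 1" for z x
    using real_distribution.cmod_char_le_1[OF real_distribution_rho, of z] by (simp add: \<psi>_def char_rho)
  moreover have "of_real rate * \<psi> z x = of_real u * \<psi> z (x + 1) + of_real v * (iexp (z * a x) * \<psi> z x)
        + of_real w * (iexp (2 * z * a x) * \<psi> z (x + 1))" for z x
    using rho_recursion[of "\<psi> z x" "z * a x" "\<psi> z (x + 1)"]
    by (auto simp: \<psi>_def a_def rho1 indicator_def mult.assoc split: if_splits)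
  moreover have "(\<psi> z \<longlongrightarrow> 1) at_top" for z
    by (rule tendsto_eventually, use eventually_ge_at_top[of "1 / 2"] in eventually_elim) (simp add: \<psi>_def)
  moreover have "\<psi> z 0 = char rho z" for z by (simp add: \<psi>_def char_rho)
  ultimately obtain Y where Y: "Y \<in> borel_measurable M"
    "AE \<omega> in M. ((\<lambda>t. path_integral a t \<omega>) \<longlongrightarrow> Y \<omega>) at_top" "distr M borel Y = rho"
    using path_integral_law[of a rho \<psi>] real_distribution_rho by blast
  have "AE \<omega> in M. Y \<omega> = L (first_jump_time N \<omega>) \<omega>"
    using Y(2) AE_good_path
  proof eventually_elim
    case (elim \<omega>)
    have "((\<lambda>t. path_integral a t \<omega>) \<longlongrightarrow> L (first_jump_time N \<omega>) \<omega>) at_top"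
      using eventually_ge_at_top[of "first_jump_time N \<omega>"]
      unfolding a_def by (intro tendsto_eventually, eventually_elim) (rule path_integral_indicator[OF elim(2)])
    with elim(1) show ?case by (intro tendsto_unique[of at_top]) auto
  qed
  then show ?thesis
    unfolding rho_law_def using Y(1) by (intro bexI[of _ Y] conjI Y(3)[symmetric])
qed

lemma mu_law_mu:
  assumes c: "1 < c" and \<mu>: "real_distribution \<mu>" "\<And>z. char \<mu> z = rho_char (iexp z) * char \<mu> (z / c)"
  shows "mu_law M c N L \<mu>"
proof -
  interpret \<mu>: real_distribution \<mu> by fact
  define a where "a x = c powr (- x)" for x :: real
  \<comment> \<open>By the functional equation this is the infinite product of
    \<open>rho_char (iexp (z * a (x + m)))\<close> over the naturals \<open>m\<close>, in a form
    that makes sense at every real \<open>x\<close>.\<close>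
  define \<psi> where "\<psi> z x = char \<mu> (z * a x)" for z x :: real
  have "admissible a"
    unfolding admissible_def
  proof (intro conjI ballI allI impI)
    show "a \<in> borel_measurable borel" unfolding a_def by measurable
    show "a x \<le> 1" if "0 \<le> x" for x
      using powr_mono[of "- x" 0 c] that c by (simp add: a_def)
    show "isCont a x" for x unfolding a_def using c by (intro continuous_intros) auto
  qed (simp add: a_def)
  moreover have "\<psi> z \<in> borel_measurable borel" for z unfolding \<psi>_def a_def by measurable
  moreover have "norm (\<psi> z x) \<le> 1" for z x by (simp add: \<psi>_def \<mu>.cmod_char_le_1)
  moreover have "of_real rate * \<psi> z x = of_real u * \<psi> z (x + 1) + of_real v * (iexp (z * a x) * \<psi> z x)
        + of_real w * (iexp (2 * z * a x) * \<psi> z (x + 1))" for z x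
  proof -
    have "a (x + 1) = a x / c" using c by (simp add: a_def powr_diff powr_minus divide_simps powr_add)
    then have "\<psi> z x = rho_char (iexp (z * a x)) * \<psi> z (x + 1)"
      unfolding \<psi>_def using \<mu>(2)[of "z * a x"] by simp
    from rho_recursion[OF this] show ?thesis by (simp add: mult.assoc)
  qed
  moreover have "(\<psi> z \<longlongrightarrow> 1) at_top" for z
  proof -
    have "(a \<longlongrightarrow> 0) at_top"
    proof -
      have "filterlim (\<lambda>x. ln c * x) at_top at_top"
        using c by (intro filterlim_tendsto_pos_mult_at_top[OF tendsto_const _ filterlim_ident]) simp
      then have "filterlim (\<lambda>x. - (ln c * x)) at_bot at_top" by (simp add: filterlim_uminus_at_bot)
      moreover have "a = (\<lambda>x. exp (- (ln c * x)))" using c by (auto simp: a_def powr_def)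
      ultimately show ?thesis using filterlim_compose[OF exp_at_bot] by simp
    qed
    then have "((\<lambda>x. z * a x) \<longlongrightarrow> z * 0) at_top" by (intro tendsto_mult tendsto_const)
    from isCont_tendsto_compose[OF \<mu>.isCont_char this] show ?thesis
      by (simp add: \<psi>_def[abs_def] \<mu>.char_zero)
  qed
  moreover have "\<psi> z 0 = char \<mu> z" for z using c by (simp add: \<psi>_def a_def)
  ultimately obtain Y where Y: "Y \<in> borel_measurable M"
    "AE \<omega> in M. ((\<lambda>t. path_integral a t \<omega>) \<longlongrightarrow> Y \<omega>) at_top" "distr M borel Y = \<mu>"
    using path_integral_law[of a \<mu> \<psi>] \<mu>(1) by blast
  show ?thesis
    unfolding mu_law_def exp_integral_def
    using Y(2)[unfolded path_integral_def a_def] Y(1) by (intro bexI[of _ Y] conjI Y(3)[symmetric])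
qed

end

lemma cp_process_special_of_bivariate:
  assumes "is_bivariate_process k c (2/9) (7/10) (7/90) M N L" and ck: "c powi (- k) = 2"
  shows "\<exists>u v w. cp_process_special M N L u v w"
proof -
  obtain u v w where u: "0 \<le> u" "0 \<le> v" "0 \<le> w" "0 < u + v + w"
    and r: "2 / 9 = u / (u + v + w)" "7 / 10 = v / (u + v + w)" "7 / 90 = w / (u + v + w)"
    and cp: "compound_poisson_process M (\<lambda>t \<omega>. (N t \<omega>, L t \<omega>)) (jump_measure k c u v w)"
    using assms(1) unfolding is_bivariate_process_def by blast
  have r': "u = 2 / 9 * (u + v + w)" "v = 7 / 10 * (u + v + w)" "w = 7 / 90 * (u + v + w)"
    using u(4) r by (simp_all add: field_simps)
  then have "0 < u" "0 < v" "0 < w" using u(4) by linarith+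
  then have "cp_process_special M N L u v w"
    using cp r' jump_measure_char[OF ck u(1-3)]
    unfolding compound_poisson_process_def levy_process_def cp_process_special_def cp_process_def
      cp_process_axioms_def cp_process_special_axioms_def
    by (simp only:) blast
  then show ?thesis by blast
qed

theorem corollary6p5:
  fixes k :: int
  assumes "k < 0"
  shows "\<exists>(c::real) (p::real) (q::real) (r::real).
           c > 1 \<and> p \<ge> 0 \<and> q \<ge> 0 \<and> r \<ge> 0 \<and> p + q + r = 1 \<and> p + r > 0 \<and> q + r > 0 \<and>
           (\<exists>\<mu> \<rho>.
              (\<forall>(M::'a measure) N L. is_bivariate_process k c p q r M N L \<longrightarrow>
                 mu_law M c N L \<mu> \<and> rho_law M N L \<rho>) \<and>
              \<mu> \<in> ID \<and> \<rho> \<in> ID0)"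
proof -
  define K where "K = nat (- k)"
  have K: "0 < K" using assms by (simp add: K_def)
  define c where "c = root K 2"
  have c: "1 < c" "c ^ K = 2" using K by (simp_all add: c_def)
  have ck: "c powi (- k) = 2" using c(2) assms by (simp add: power_int_def K_def)
  obtain \<mu> where \<mu>: "infinitely_divisible \<mu>" "\<And>z. char \<mu> z = rho_char (iexp z) * char \<mu> (z / c)"
    using mu_exists[OF c] by blast
  have \<mu>_dist: "real_distribution \<mu>" using \<mu>(1) by (simp add: infinitely_divisible_def)
  have "mu_law M c N L \<mu> \<and> rho_law M N L rho" if "is_bivariate_process k c (2/9) (7/10) (7/90) M N L"
    for M :: "'a measure" and N L
  proof -
    obtain u v w where "cp_process_special M N L u v w"
      using cp_process_special_of_bivariate[OF _ ck] \<open>is_bivariate_process k c (2/9) (7/10) (7/90) M N L\<close> by blast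
    then interpret cp_process_special M N L u v w .
    show ?thesis using mu_law_mu[OF c(1) \<mu>_dist \<mu>(2)] rho_law_rho by blast
  qed
  moreover have "\<mu> \<in> ID" "rho \<in> ID0"
    using \<mu>(1) quasi_infinitely_divisible_rho rho_not_infinitely_divisible by (simp_all add: ID_def ID0_def)
  ultimately show ?thesis
    using c(1) by (intro exI[of _ c] exI[of _ "2/9"] exI[of _ "7/10"] exI[of _ "7/90"] conjI exI[of _ \<mu>] exI[of _ rho]) auto
qed

end
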